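(* Any non-trivial finite-dimensional real Lie algebra $\mathfrak g\neq\mathbb R,\mathbb R^2$ satisfying $b_3(\mathfrak g)=0$ is solvable and not nilpotent. If in addition $b_2(\mathfrak g)=0$, then $\mathfrak g$ cannot be a direct sum of two non-trivial subalgebras, and its derived algebra $\mathfrak g'=[\mathfrak g,\mathfrak g]$ is a codimension one ideal.
   Context: $b_n(\mathfrak g)=\dim H^n(\mathfrak g)$ is the $n$th Betti number of the Lie algebra cohomology of $\mathfrak g$ with trivial real coefficients. $\mathbb R$ and $\mathbb R^2$ denote the Abelian Lie algebras of dimension one and two. "Non-trivial" means non-zero; "direct sum" means direct sum as Lie algebras. *)

theory Defs
  imports "HOL-Analysis.Analysis" "HOL-Library.Function_Algebras"
begin

subsection \<open>Real-valued functions as a vector space, dimension of a quotient\<close>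

instantiation "fun" :: (type, real_vector) real_vector
begin

definition scaleR_fun :: "real \<Rightarrow> ('a \<Rightarrow> 'b) \<Rightarrow> 'a \<Rightarrow> 'b"
  where "scaleR_fun c f = (\<lambda>x. c *\<^sub>R f x)"

instance
  by standard (simp_all add: scaleR_fun_def fun_eq_iff scaleR_add_right scaleR_add_left)

end

text \<open>
  \<open>S\<close> represents a basis of the quotient space \<open>V / W\<close>: the classes of the elements of \<open>S\<close> are
  distinct, linearly independent, and span \<open>V / W\<close>.
\<close>

definition quotient_basis :: "'v::real_vector set \<Rightarrow> 'v set \<Rightarrow> 'v set \<Rightarrow> bool"
  where "quotient_basis V W S \<longleftrightarrow> finite S \<and> S \<subseteq> V
    \<and> (\<forall>c. (\<Sum>s\<in>S. c s *\<^sub>R s) \<in> W \<longrightarrow> (\<forall>s\<in>S. c s = 0))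
    \<and> (\<forall>v\<in>V. \<exists>c. v - (\<Sum>s\<in>S. c s *\<^sub>R s) \<in> W)"

definition quotient_dim :: "'v::real_vector set \<Rightarrow> 'v set \<Rightarrow> nat"
  where "quotient_dim V W = (THE k. \<exists>S. quotient_basis V W S \<and> card S = k)"

lemma quotient_basis_card:
  fixes V W :: "'v::real_vector set"
  assumes W: "subspace W" and V: "subspace V" and WV: "W \<subseteq> V"
    and B: "finite B" "independent B" "span B = W" and S: "quotient_basis V W S"
  shows "dim V = card S + card B"
proof -
  have fS: "finite S" and SV: "S \<subseteq> V"
    and ind: "\<And>c. (\<Sum>s\<in>S. c s *\<^sub>R s) \<in> W \<Longrightarrow> (\<forall>s\<in>S. c s = 0)"
    and sp: "\<And>v. v \<in> V \<Longrightarrow> \<exists>c. v - (\<Sum>s\<in>S. c s *\<^sub>R s) \<in> W"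
    using S unfolding quotient_basis_def by blast+
  have BW: "B \<subseteq> W" using B(3) span_superset by blast
  have disj: "S \<inter> B = {}"
  proof (rule ccontr)
    assume "S \<inter> B \<noteq> {}"
    then obtain s where s: "s \<in> S" "s \<in> W" using BW by blast
    have "(\<Sum>t\<in>S. (if t = s then 1 else 0) *\<^sub>R t) = s"
      using fS s(1) by (simp add: if_distrib [of "\<lambda>c. c *\<^sub>R _"] cong: if_cong)
    then show False using ind [of "\<lambda>t. if t = s then 1 else 0"] s by auto
  qed
  have indep: "independent (S \<union> B)"
  proof (rule independent_if_scalars_zero)
    show "finite (S \<union> B)" using fS B(1) by simp
    fix f x assume z: "(\<Sum>x\<in>S \<union> B. f x *\<^sub>R x) = 0" and x: "x \<in> S \<union> B"
    have eq: "(\<Sum>x\<in>S. f x *\<^sub>R x) = - (\<Sum>x\<in>B. f x *\<^sub>R x)"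
      using z fS B(1) disj by (simp add: sum.union_disjoint eq_neg_iff_add_eq_0)
    have "(\<Sum>x\<in>B. f x *\<^sub>R x) \<in> W"
      using BW W by (intro subspace_sum) (auto intro: subspace_scale)
    then have "(\<Sum>x\<in>S. f x *\<^sub>R x) \<in> W" using eq W by (simp add: subspace_neg)
    then have f0: "\<forall>s\<in>S. f s = 0" by (rule ind)
    then have "(\<Sum>x\<in>B. f x *\<^sub>R x) = 0" using eq by simp
    then have "\<forall>s\<in>B. f s = 0" using B(1,2) independentD by blast
    then show "f x = 0" using f0 x by blast
  qed
  have "V \<subseteq> span (S \<union> B)"
  proof
    fix v assume "v \<in> V"
    then obtain c where "v - (\<Sum>s\<in>S. c s *\<^sub>R s) \<in> W" using sp by blast
    then have "v - (\<Sum>s\<in>S. c s *\<^sub>R s) \<in> span (S \<union> B)"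
      using B(3) span_mono [of B "S \<union> B"] by blast
    moreover have "(\<Sum>s\<in>S. c s *\<^sub>R s) \<in> span (S \<union> B)"
      by (intro span_sum span_scale span_base) blast
    ultimately have "v - (\<Sum>s\<in>S. c s *\<^sub>R s) + (\<Sum>s\<in>S. c s *\<^sub>R s) \<in> span (S \<union> B)"
      by (rule span_add)
    then show "v \<in> span (S \<union> B)" by simp
  qed
  then have "dim V = card (S \<union> B)"
    using indep SV BW WV by (intro dim_unique [of "S \<union> B"]) auto
  then show ?thesis using disj fS B(1) by (simp add: card_Un_disjoint)
qed

lemma quotient_dim_eq:
  fixes V W :: "'v::real_vector set"
  assumes W: "subspace W" and V: "subspace V" and WV: "W \<subseteq> V"
    and fin: "finite A" "V \<subseteq> span A"
  shows "quotient_dim V W + dim W = dim V"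
proof -
  obtain B where B: "B \<subseteq> W" "independent B" "W \<subseteq> span B" "card B = dim W"
    using basis_exists by blast
  have fB: "finite B"
    using B(1,2) WV fin independent_span_bound by blast
  have spB: "span B = W" using B W by (metis span_minimal subset_antisym)
  obtain C where C: "B \<subseteq> C" "C \<subseteq> V" "independent C" "V \<subseteq> span C"
    using maximal_independent_subset_extend [of B V] B(1,2) WV by (metis subset_trans)
  have fC: "finite C"
    using C(2,3) fin independent_span_bound by blast
  let ?S = "C - B"
  have "quotient_basis V W ?S"
    unfolding quotient_basis_def
  proof (intro conjI allI impI ballI)
    show "finite ?S" "?S \<subseteq> V" using fC C(2) by auto
  next
    fix c s assume "(\<Sum>s\<in>?S. c s *\<^sub>R s) \<in> W" and s: "s \<in> ?S"
    then obtain u where u: "(\<Sum>s\<in>?S. c s *\<^sub>R s) = (\<Sum>b\<in>B. u b *\<^sub>R b)"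
      using spB span_finite [OF fB] by auto
    let ?f = "\<lambda>x. if x \<in> B then - u x else c x"
    have "(\<Sum>x\<in>C. ?f x *\<^sub>R x) = (\<Sum>x\<in>?S. ?f x *\<^sub>R x) + (\<Sum>x\<in>B. ?f x *\<^sub>R x)"
      using C(1) fC by (rule sum.subset_diff)
    also have "\<dots> = (\<Sum>x\<in>?S. c x *\<^sub>R x) - (\<Sum>b\<in>B. u b *\<^sub>R b)"
      by (simp add: sum_negf)
    also have "\<dots> = 0" using u by simp
    finally have "?f s = 0" using s independentD [OF C(3) fC, of ?f s] by blast
    then show "c s = 0" using s by simp
  next
    fix v assume "v \<in> V"
    then obtain u where u: "v = (\<Sum>x\<in>C. u x *\<^sub>R x)"
      using C(4) span_finite [OF fC] by auto
    also have "\<dots> = (\<Sum>x\<in>?S. u x *\<^sub>R x) + (\<Sum>x\<in>B. u x *\<^sub>R x)"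
      using C(1) fC by (rule sum.subset_diff)
    finally have "v - (\<Sum>x\<in>?S. u x *\<^sub>R x) = (\<Sum>x\<in>B. u x *\<^sub>R x)" by simp
    also have "\<dots> \<in> W" unfolding spB [symmetric] by (intro span_sum span_scale span_base)
    finally show "\<exists>c. v - (\<Sum>x\<in>?S. c x *\<^sub>R x) \<in> W" by blast
  qed
  moreover have card: "card S = dim V - dim W" if "quotient_basis V W S" for S
    using quotient_basis_card [OF W V WV fB B(2) spB that] B(4) by simp
  ultimately have "quotient_dim V W = dim V - dim W"
    unfolding quotient_dim_def by (intro the_equality) auto
  moreover have "dim W \<le> dim V"
    using quotient_basis_card [OF W V WV fB B(2) spB \<open>quotient_basis V W ?S\<close>] B(4) by simp
  ultimately show ?thesis by simp
qed


subsection \<open>Real Lie algebras\<close>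

text \<open>
  The Lie algebra is carried by a subspace \<open>g\<close> of an arbitrary real vector space, and only the values
  of the bracket on \<open>g\<close> matter. Subalgebras are then Lie algebras for the same bracket.
\<close>

locale lie_algebra =
  fixes g :: "'a::real_vector set" and br :: "'a \<Rightarrow> 'a \<Rightarrow> 'a"
  assumes subspace_carrier: "subspace g"
    and bracket_closed: "\<lbrakk>x \<in> g; y \<in> g\<rbrakk> \<Longrightarrow> br x y \<in> g"
    and bracket_add_left: "\<lbrakk>x \<in> g; y \<in> g; z \<in> g\<rbrakk> \<Longrightarrow> br (x + y) z = br x z + br y z"
    and bracket_add_right: "\<lbrakk>x \<in> g; y \<in> g; z \<in> g\<rbrakk> \<Longrightarrow> br x (y + z) = br x y + br x z"
    and bracket_scale_left: "\<lbrakk>x \<in> g; y \<in> g\<rbrakk> \<Longrightarrow> br (c *\<^sub>R x) y = c *\<^sub>R br x y"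
    and bracket_scale_right: "\<lbrakk>x \<in> g; y \<in> g\<rbrakk> \<Longrightarrow> br x (c *\<^sub>R y) = c *\<^sub>R br x y"
    and bracket_self: "x \<in> g \<Longrightarrow> br x x = 0"
    and jacobi: "\<lbrakk>x \<in> g; y \<in> g; z \<in> g\<rbrakk> \<Longrightarrow>
      br x (br y z) + br y (br z x) + br z (br x y) = 0"

definition finite_dimensional :: "'v::real_vector set \<Rightarrow> bool"
  where "finite_dimensional V \<longleftrightarrow> (\<exists>B. finite B \<and> span B = V)"

definition lie_abelian :: "'a::real_vector set \<Rightarrow> ('a \<Rightarrow> 'a \<Rightarrow> 'a) \<Rightarrow> bool"
  where "lie_abelian g br \<longleftrightarrow> (\<forall>x\<in>g. \<forall>y\<in>g. br x y = 0)"

definition lie_subalgebra :: "'a::real_vector set \<Rightarrow> 'a set \<Rightarrow> ('a \<Rightarrow> 'a \<Rightarrow> 'a) \<Rightarrow> bool"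
  where "lie_subalgebra h g br \<longleftrightarrow> subspace h \<and> h \<subseteq> g \<and> (\<forall>x\<in>h. \<forall>y\<in>h. br x y \<in> h)"

definition lie_ideal :: "'a::real_vector set \<Rightarrow> 'a set \<Rightarrow> ('a \<Rightarrow> 'a \<Rightarrow> 'a) \<Rightarrow> bool"
  where "lie_ideal h g br \<longleftrightarrow> subspace h \<and> h \<subseteq> g \<and> (\<forall>x\<in>g. \<forall>y\<in>h. br x y \<in> h)"

definition lie_direct_sum :: "'a::real_vector set \<Rightarrow> 'a set \<Rightarrow> 'a set \<Rightarrow> ('a \<Rightarrow> 'a \<Rightarrow> 'a) \<Rightarrow> bool"
  where "lie_direct_sum g h k br \<longleftrightarrow> lie_subalgebra h g br \<and> lie_subalgebra k g br
    \<and> g = {x + y | x y. x \<in> h \<and> y \<in> k} \<and> h \<inter> k = {0}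
    \<and> (\<forall>x\<in>h. \<forall>y\<in>k. br x y = 0)"

definition bracket_span :: "('a::real_vector \<Rightarrow> 'a \<Rightarrow> 'a) \<Rightarrow> 'a set \<Rightarrow> 'a set \<Rightarrow> 'a set"
  where "bracket_span br h k = span {br x y | x y. x \<in> h \<and> y \<in> k}"

definition derived_algebra :: "'a::real_vector set \<Rightarrow> ('a \<Rightarrow> 'a \<Rightarrow> 'a) \<Rightarrow> 'a set"
  where "derived_algebra g br = bracket_span br g g"

primrec derived_series :: "'a::real_vector set \<Rightarrow> ('a \<Rightarrow> 'a \<Rightarrow> 'a) \<Rightarrow> nat \<Rightarrow> 'a set"
  where
    "derived_series g br 0 = g"
  | "derived_series g br (Suc n) = derived_algebra (derived_series g br n) br"

primrec lower_central_series :: "'a::real_vector set \<Rightarrow> ('a \<Rightarrow> 'a \<Rightarrow> 'a) \<Rightarrow> nat \<Rightarrow> 'a set"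
  where
    "lower_central_series g br 0 = g"
  | "lower_central_series g br (Suc n) = bracket_span br g (lower_central_series g br n)"

definition lie_solvable :: "'a::real_vector set \<Rightarrow> ('a \<Rightarrow> 'a \<Rightarrow> 'a) \<Rightarrow> bool"
  where "lie_solvable g br \<longleftrightarrow> (\<exists>n. derived_series g br n = {0})"

definition lie_nilpotent :: "'a::real_vector set \<Rightarrow> ('a \<Rightarrow> 'a \<Rightarrow> 'a) \<Rightarrow> bool"
  where "lie_nilpotent g br \<longleftrightarrow> (\<exists>n. lower_central_series g br n = {0})"


subsection \<open>Lie algebra cohomology with trivial real coefficients\<close>

text \<open>
  An \<open>n\<close>-cochain is an alternating \<open>n\<close>-linear form on \<open>g\<close>. It is represented as a function on lists,
  normalised to vanish on all lists other than those of length \<open>n\<close> with entries in \<open>g\<close>, so that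
  distinct representatives are distinct forms.
\<close>

definition cochains :: "'a::real_vector set \<Rightarrow> nat \<Rightarrow> ('a list \<Rightarrow> real) set"
  where "cochains g n = {f.
      (\<forall>xs. \<not> (length xs = n \<and> set xs \<subseteq> g) \<longrightarrow> f xs = 0)
    \<and> (\<forall>xs i x y. length xs = n \<and> set xs \<subseteq> g \<and> i < n \<and> x \<in> g \<and> y \<in> g \<longrightarrow>
        f (xs[i := x + y]) = f (xs[i := x]) + f (xs[i := y]))
    \<and> (\<forall>xs i c x. length xs = n \<and> set xs \<subseteq> g \<and> i < n \<and> x \<in> g \<longrightarrow>
        f (xs[i := c *\<^sub>R x]) = c * f (xs[i := x]))
    \<and> (\<forall>xs. length xs = n \<and> set xs \<subseteq> g \<and> \<not> distinct xs \<longrightarrow> f xs = 0)}"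

text \<open>
  The Chevalley--Eilenberg differential
  \<open>(df)(x\<^sub>0, \<dots>, x\<^sub>n) = (\<Sum>i<j. (-1)^(i+j) f([x\<^sub>i, x\<^sub>j], x\<^sub>0, \<dots>, x\<^sub>n))\<close>, where on the right
  \<open>x\<^sub>i\<close> and \<open>x\<^sub>j\<close> are omitted from the list following the bracket. The same formula serves all degrees.
\<close>

definition ce_d :: "'a::real_vector set \<Rightarrow> ('a \<Rightarrow> 'a \<Rightarrow> 'a) \<Rightarrow> ('a list \<Rightarrow> real) \<Rightarrow> 'a list \<Rightarrow> real"
  where "ce_d g br f = (\<lambda>xs. if set xs \<subseteq> g
      then \<Sum>j<length xs. \<Sum>i<j. (-1) ^ (i + j) * f (br (xs ! i) (xs ! j) # nths xs (- {i, j}))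
      else 0)"

definition cocycles :: "'a::real_vector set \<Rightarrow> ('a \<Rightarrow> 'a \<Rightarrow> 'a) \<Rightarrow> nat \<Rightarrow> ('a list \<Rightarrow> real) set"
  where "cocycles g br n = {f \<in> cochains g n. ce_d g br f = 0}"

primrec coboundaries :: "'a::real_vector set \<Rightarrow> ('a \<Rightarrow> 'a \<Rightarrow> 'a) \<Rightarrow> nat \<Rightarrow> ('a list \<Rightarrow> real) set"
  where
    "coboundaries g br 0 = {0}"
  | "coboundaries g br (Suc n) = ce_d g br ` cochains g n"

definition betti :: "'a::real_vector set \<Rightarrow> ('a \<Rightarrow> 'a \<Rightarrow> 'a) \<Rightarrow> nat \<Rightarrow> nat"
  where "betti g br n = quotient_dim (cocycles g br n) (coboundaries g br n)"

end

theory Submission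
  imports Defs "HOL-Computational_Algebra.Fundamental_Theorem_Algebra"
begin

text \<open>
  \<^emph>\<open>Solvability.\<close> Complexify. A minimal nonsolvable complex subalgebra \<open>h\<close> has a maximal subalgebra that
  is solvable, so by Lie's theorem of codimension one; the filtration of \<open>h\<close> that it induces shows that
  \<open>h\<close> is \<open>sl\<^sub>2\<close> modulo a solvable ideal, and the Casimir operator lifts the triple \<open>e, f, t = [e, f]\<close> to
  \<open>h\<close>. The form \<open>tr (ad [x, y] ad z)\<close> is closed. If it equals \<open>d \<alpha>\<close>, then evaluating at the cycle
  \<open>e \<and> f \<and> t\<close> gives \<open>tr (ad t ad t) = 0\<close>, which is impossible as \<open>ad t\<close> has integral eigenvalues, one
  of them being \<open>2\<close>.

  \<^emph>\<open>Non-nilpotency.\<close> For a nilpotent algebra of dimension at least \<open>3\<close> one constructs a closed non-exact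
  \<open>3\<close>-form by induction along ideals \<open>h'\<close> of codimension one. As \<open>ad x\<close> is nilpotent, among the closed
  non-exact \<open>3\<close>-forms on \<open>h'\<close> there is one whose Lie derivative along \<open>x\<close> is exact, and this one
  extends to a closed form.

  \<^emph>\<open>The case \<open>b\<^sub>2 = 0\<close>.\<close> Two independent closed \<open>1\<close>-forms would produce a closed non-exact \<open>2\<close>-form;
  hence the derived algebra has codimension one. For a direct sum of two solvable algebras it would have
  codimension at least two.
\<close>

section \<open>Linear algebra over a field\<close>

text \<open>Complexification is forced by eigenvalues: a real algebra such as so(3) is not solvable
  but contains no sl2 triple, and Lie's theorem fails over the reals. The hypothesis on cohomology
  is real, however, so it is applied to the real and to the imaginary part of a complex-valued form.
  One sl2 triple is enough, because the closed 3-form only has to be tested on one cycle.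

  Algebras, ideals and modules are subsets of a fixed vector space, and quotients are not formed.
  Statements about a quotient of \<open>a\<close> by \<open>b\<close> are phrased for vectors of
  \<open>a\<close> modulo \<open>b\<close>, or through a projection with kernel \<open>b\<close>.

  In the nilpotent case a closed form on the ideal extends to a closed form only if its Lie
  derivative along the complementary direction is exact; this obstacle dictates the choice of the
  form. The induction starts in dimension three, as there are no nonzero 3-forms below. Nonzero
  nilpotent algebras of dimension at most two are abelian, so they are the two exceptions in the
  theorem.\<close>

locale field_space = vector_space scale
  for scale :: "'f::field \<Rightarrow> 'v::ab_group_add \<Rightarrow> 'v"
begin

lemmas scale_simps = scale_right_distrib scale_left_distrib scale_right_diff_distrib
  scale_left_diff_distrib scale_minus_left scale_minus_right

lemma scale_two: "scale 2 x = x + x"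
  using scale_left_distrib [of 1 1 x] by simp

lemma subspace_line_sum:
  assumes "subspace S"
  shows "subspace {scale c v + y | c y. y \<in> S}"
proof -
  have "{scale c v + y | c y. y \<in> S} = {x + y | x y. x \<in> span {v} \<and> y \<in> S}"
    unfolding span_singleton by auto
  then show ?thesis using subspace_sums [OF subspace_span assms] by simp
qed

text \<open>The ambient space may be infinite-dimensional, so finiteness is a property of subsets;
  asking only for containment in a finitely generated span makes it pass to every subset.\<close>

definition fin_dim :: "'v set \<Rightarrow> bool"
  where "fin_dim S \<longleftrightarrow> (\<exists>A. finite A \<and> S \<subseteq> span A)"

lemma linear_endoI:
  assumes "\<And>x y. f (x + y) = f x + f y" "\<And>c x. f (scale c x) = scale c (f x)"
  shows "Vector_Spaces.linear scale scale f"
  using assms by (simp add: Vector_Spaces.linear_iff vector_space_axioms)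

lemma fin_dim_subset: "fin_dim T \<Longrightarrow> S \<subseteq> T \<Longrightarrow> fin_dim S"
  unfolding fin_dim_def by blast

lemma fin_dim_basis:
  assumes "fin_dim S" "subspace S"
  obtains B where "finite B" "independent B" "span B = S" "B \<subseteq> S" "card B = dim S"
proof -
  obtain B where B: "B \<subseteq> S" "independent B" "S \<subseteq> span B" "card B = dim S"
    by (rule basis_exists)
  obtain A where "finite A" "S \<subseteq> span A" using assms(1) fin_dim_def by blast
  then have "finite B" using B(1,2) independent_span_bound by blast
  moreover have "span B = S" using span_minimal [OF B(1) assms(2)] B(3) by blast
  ultimately show thesis using B that by blast
qed

lemma fin_dim_dim_mono:
  assumes "fin_dim T" "S \<subseteq> T" "subspace S" "subspace T"
  shows "dim S \<le> dim T"
proof -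
  obtain C where "finite C" "span C = T" "card C = dim T"
    by (rule fin_dim_basis [OF assms(1,4)])
  then show ?thesis using assms(2) dim_le_card by metis
qed

lemma fin_dim_subspace_eq:
  assumes "fin_dim T" "S \<subseteq> T" "subspace S" "subspace T" "dim T \<le> dim S"
  shows "S = T"
proof (rule ccontr)
  assume ne: "S \<noteq> T"
  obtain B where B: "finite B" "independent B" "span B = S" "B \<subseteq> S" "card B = dim S"
    by (rule fin_dim_basis [OF fin_dim_subset [OF assms(1,2)] assms(3)])
  obtain C where C: "finite C" "independent C" "span C = T" "C \<subseteq> T" "card C = dim T"
    by (rule fin_dim_basis [OF assms(1,4)])
  obtain x where x: "x \<in> T" "x \<notin> S" using ne assms(2) by blast
  have "independent (insert x B)" using x B independent_insertI by blast
  moreover have "insert x B \<subseteq> span C" using x B C assms by auto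
  ultimately have "card (insert x B) \<le> card C"
    using independent_span_bound C(1) by blast
  moreover have "card (insert x B) = Suc (card B)"
    using x B by (metis card_insert_disjoint span_base)
  ultimately show False using B C assms(5) by simp
qed

lemma fin_dim_psubset_dim:
  assumes "fin_dim T" "S \<subset> T" "subspace S" "subspace T"
  shows "dim S < dim T"
  using fin_dim_subspace_eq [OF assms(1) _ assms(3,4)] assms(2) by (metis leI psubset_eq)

text \<open>A basis of \<open>D\<close> stays independent when \<open>x\<close> is added, so the
  values of \<open>l\<close> on it can be prescribed. This is the source of hyperplanes and of
  closed 1-forms below.\<close>

lemma vanishing_functional:
  assumes "subspace D" "x \<notin> D"
  obtains l where "Vector_Spaces.linear scale (*) l" "\<And>y. y \<in> D \<Longrightarrow> l y = 0" "l x = 1"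
proof -
  have F: "vector_space ((*) :: 'f \<Rightarrow> 'f \<Rightarrow> 'f)"
    by unfold_locales (simp_all add: ring_distribs)
  have P: "vector_space_pair scale ((*) :: 'f \<Rightarrow> 'f \<Rightarrow> 'f)"
    by (rule vector_space_pair.intro [OF vector_space_axioms F])
  obtain B where B: "B \<subseteq> D" "independent B" "D \<subseteq> span B" "card B = dim D"
    by (rule basis_exists)
  have "x \<notin> span B" using span_minimal [OF B(1) assms(1)] assms(2) by blast
  then have "independent (insert x B)" using B independent_insertI by blast
  then obtain l where l: "Vector_Spaces.linear scale (*) l"
      "\<And>y. y \<in> insert x B \<Longrightarrow> l y = (if y = x then 1 else 0)"
    using vector_space_pair.linear_independent_extend [OF P, of "insert x B" "\<lambda>y. if y = x then 1 else 0"] by blast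
  have "l y = 0" if "y \<in> D" for y
  proof (rule vector_space_pair.linear_eq_0_on_span [OF P l(1)])
    show "y \<in> span B" using that B by blast
    show "l b = 0" if "b \<in> B" for b using l(2) [of b] that B assms by auto
  qed
  then show thesis using l that by simp
qed

text \<open>The map \<open>q\<close> stands in for the quotient map modulo \<open>b\<close>: its
  image is a complement of \<open>b\<close>. It is the identity minus a retraction onto
  \<open>b\<close>.\<close>

lemma subspace_projection:
  assumes "subspace b"
  obtains q where "Vector_Spaces.linear scale scale q" "\<And>x. x - q x \<in> b" "\<And>x. q x = 0 \<longleftrightarrow> x \<in> b"
proof -
  obtain p where p: "range p \<subseteq> b" "Vector_Spaces.linear scale scale p" "\<And>v. v \<in> b \<Longrightarrow> p v = v"
    using vector_space_pair.linear_exists_left_inverse_on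
      [OF vector_space_pair.intro [OF vector_space_axioms vector_space_axioms] linear_id assms] by auto
  interpret p: Vector_Spaces.linear scale scale p by fact
  have "Vector_Spaces.linear scale scale (\<lambda>x. x - p x)"
    by (rule linear_endoI) (simp_all add: p.add p.scale scale_right_diff_distrib)
  moreover have "x - (x - p x) \<in> b" for x using p(1) by auto
  moreover have "x - p x = 0 \<longleftrightarrow> x \<in> b" for x using p(1,3) by (metis eq_iff_diff_eq_0 rangeI subsetD)
  ultimately show thesis by (rule that)
qed

text \<open>An injective endomorphism of a finite-dimensional space is onto. The space is the
  quotient of \<open>h\<close> by \<open>D\<close>, realised as the image \<open>M\<close> of
  \<open>h\<close> under a projection with kernel \<open>D\<close>, and \<open>S\<close> is the
  operator induced by \<open>T\<close>.\<close>

lemma inj_mod_imp_surj_mod: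
  assumes T: "Vector_Spaces.linear scale scale T" and h: "fin_dim h" "subspace h" "T ` h \<subseteq> h"
    and D: "subspace D" "D \<subseteq> h" "T ` D \<subseteq> D"
    and inj: "\<And>y. y \<in> h \<Longrightarrow> T y \<in> D \<Longrightarrow> y \<in> D" and z: "z \<in> h"
  obtains y where "y \<in> h" "z - T y \<in> D"
proof -
  interpret T: Vector_Spaces.linear scale scale T by fact
  obtain q where q: "Vector_Spaces.linear scale scale q" "\<And>x. x - q x \<in> D" "\<And>x. q x = 0 \<longleftrightarrow> x \<in> D"
    using subspace_projection [OF D(1)] by blast
  interpret q: Vector_Spaces.linear scale scale q by fact
  define M where "M = q ` h"
  have Mh: "M \<subseteq> h"
  proof
    fix y assume "y \<in> M"
    then obtain x where x: "x \<in> h" "y = q x" unfolding M_def by blast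
    have "x - (x - q x) \<in> h" using subspace_diff [OF h(2) x(1), of "x - q x"] q(2) [of x] D(2) by blast
    then show "y \<in> h" using x(2) by simp
  qed
  have sM: "subspace M" unfolding M_def using h(2) q.subspace_image by simp
  define S where "S = (\<lambda>x. q (T x))"
  have S: "Vector_Spaces.linear scale scale S"
    unfolding S_def by (rule linear_endoI) (simp_all add: q.add q.scale T.add T.scale)
  interpret S: Vector_Spaces.linear scale scale S by fact
  have qq: "q (q x) = q x" for x
    using q(2) [of x] q(3) [of "x - q x"] by (simp add: q.diff)
  have "x = 0" if "x \<in> M" "S x = 0" for x
  proof -
    have "T x \<in> D" using that q(3) S_def by simp
    then have "x \<in> D" using inj that(1) Mh by blast
    then show ?thesis using q(3) [of x] qq that(1) M_def by auto
  qed
  then have injS: "inj_on S M" using S.inj_on_iff_eq_0 [OF sM] by blast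
  have SM: "S ` M \<subseteq> M" using Mh h(3) unfolding S_def M_def by blast
  obtain B where B: "finite B" "independent B" "span B = M" "B \<subseteq> M" "card B = dim M"
    by (rule fin_dim_basis [OF fin_dim_subset [OF h(1) Mh] sM])
  have "independent (S ` B)"
    using S.independent_injective_image [OF B(2)] injS B(3) by simp
  then have "dim (S ` M) = card (S ` B)"
    using B S.span_image dim_span_eq_card_independent by metis
  also have "\<dots> = dim M" using B injS by (metis card_image inj_on_subset)
  finally have "S ` M = M"
    using fin_dim_subspace_eq [of M "S ` M"] SM sM S.subspace_image fin_dim_subset [OF h(1) Mh] by simp
  then obtain y where y: "y \<in> M" "q z = S y" using z M_def by (metis imageE imageI)
  then have "z - T y \<in> D" using q(3) [of "z - T y"] by (simp add: q.diff S_def)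
  then show thesis using that y(1) Mh by blast
qed

end

section \<open>Lie algebras over a field, with a bracket defined on the whole space\<close>

locale field_lie = field_space scale
  for scale :: "'f::field \<Rightarrow> 'a::ab_group_add \<Rightarrow> 'a" (infixr \<open>*s\<close> 75) +
  fixes br :: "'a \<Rightarrow> 'a \<Rightarrow> 'a"
  assumes br_add_left: "br (x + y) z = br x z + br y z"
    and br_scale_left: "br (c *s x) y = c *s br x y"
    and br_add_right: "br x (y + z) = br x y + br x z"
    and br_scale_right: "br x (c *s y) = c *s br x y"
    and br_self: "br x x = 0"
    and br_jacobi: "br x (br y z) + br y (br z x) + br z (br x y) = 0"
begin

lemma linear_br: "Vector_Spaces.linear scale scale (br x)"
  by (rule linear_endoI) (simp_all add: br_add_right br_scale_right)

lemma br_zero [simp]: "br x 0 = 0" "br 0 x = 0"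
  using br_scale_right [of x 0 0] br_scale_left [of 0 0 x] by simp_all

lemma br_minus: "br x (- y) = - br x y" "br (- x) y = - br x y"
  using br_scale_right [of x "- 1" y] br_scale_left [of "- 1" x y] by (simp_all add: scale_minus_left)

lemma br_diff: "br x (y - z) = br x y - br x z" "br (x - y) z = br x z - br y z"
  using br_add_right [of x y "- z"] br_add_left [of x "- y" z] by (simp_all add: br_minus)

lemma br_swap: "br x y = - br y x"
proof -
  have "br x y + br y x = br (x + y) (x + y)"
    unfolding br_add_left br_add_right by (simp add: br_self)
  also have "\<dots> = 0" by (rule br_self)
  finally show ?thesis by (simp add: eq_neg_iff_add_eq_0)
qed

lemma br_derivation: "br x (br y z) = br (br x y) z + br y (br x z)"
  using br_jacobi [of x y z] br_swap [of z "br x y"] br_swap [of z x]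
  by (simp add: br_minus algebra_simps)

lemmas br_bilinear = br_add_left br_add_right br_scale_left br_scale_right br_minus br_diff

end

section \<open>Eigenvectors relative to an invariant subspace\<close>

locale complex_space = field_space scale
  for scale :: "complex \<Rightarrow> 'v::ab_group_add \<Rightarrow> 'v" (infixr \<open>*\<^sub>C\<close> 75)
begin

text \<open>The Krylov filtration of \<open>w\<close> under \<open>T\<close> modulo
  \<open>b\<close>: stage \<open>0\<close> is \<open>b\<close> itself and each stage adds at most
  one dimension, so that arguments about a vector of a quotient become arguments about this
  chain.\<close>

definition krylov :: "('v \<Rightarrow> 'v) \<Rightarrow> 'v set \<Rightarrow> 'v \<Rightarrow> nat \<Rightarrow> 'v set"
  where "krylov T b w n = {(\<Sum>i<n. c i *\<^sub>C (T ^^ i) w) + z | c z. z \<in> b}"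

lemma krylovI: "x = (\<Sum>i<n. c i *\<^sub>C (T ^^ i) w) + z \<Longrightarrow> z \<in> b \<Longrightarrow> x \<in> krylov T b w n"
  unfolding krylov_def by (intro CollectI exI [of _ c] exI [of _ z]) simp

lemma krylov_0: "krylov T b w 0 = b"
  by (auto simp: krylov_def)

lemma subspace_krylov:
  assumes "subspace b" shows "subspace (krylov T b w n)"
proof (rule subspaceI)
  show "0 \<in> krylov T b w n"
    by (rule krylovI [of _ "\<lambda>_. 0" _ _ _ 0]) (simp_all add: subspace_0 [OF assms])
next
  fix x y assume "x \<in> krylov T b w n" "y \<in> krylov T b w n"
  then obtain c z d u where 1: "x = (\<Sum>i<n. c i *\<^sub>C (T ^^ i) w) + z" "z \<in> b"
    "y = (\<Sum>i<n. d i *\<^sub>C (T ^^ i) w) + u" "u \<in> b" unfolding krylov_def by blast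
  have "x + y = (\<Sum>i<n. (c i + d i) *\<^sub>C (T ^^ i) w) + (z + u)"
    unfolding 1 by (simp add: scale_left_distrib sum.distrib)
  then show "x + y \<in> krylov T b w n"
    using subspace_add [OF assms 1(2,4)] by (rule krylovI)
next
  fix k x assume "x \<in> krylov T b w n"
  then obtain c z where 1: "x = (\<Sum>i<n. c i *\<^sub>C (T ^^ i) w) + z" "z \<in> b"
    unfolding krylov_def by blast
  have "k *\<^sub>C x = (\<Sum>i<n. (k * c i) *\<^sub>C (T ^^ i) w) + k *\<^sub>C z"
    unfolding 1 by (simp add: scale_right_distrib scale_sum_right)
  then show "k *\<^sub>C x \<in> krylov T b w n"
    using subspace_scale [OF assms 1(2)] by (rule krylovI)
qed

lemma krylov_Suc: "krylov T b w (Suc n) = {c *\<^sub>C (T ^^ n) w + z | c z. z \<in> krylov T b w n}"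
proof (intro subset_antisym subsetI)
  fix x assume "x \<in> krylov T b w (Suc n)"
  then obtain c z where "x = (\<Sum>i<Suc n. c i *\<^sub>C (T ^^ i) w) + z" "z \<in> b"
    unfolding krylov_def by blast
  then have "x = c n *\<^sub>C (T ^^ n) w + ((\<Sum>i<n. c i *\<^sub>C (T ^^ i) w) + z)" "z \<in> b" by simp_all
  then show "x \<in> {c *\<^sub>C (T ^^ n) w + z | c z. z \<in> krylov T b w n}" using krylovI by blast
next
  fix x assume "x \<in> {c *\<^sub>C (T ^^ n) w + z | c z. z \<in> krylov T b w n}"
  then obtain k c z where 1: "x = k *\<^sub>C (T ^^ n) w + ((\<Sum>i<n. c i *\<^sub>C (T ^^ i) w) + z)" "z \<in> b"
    unfolding krylov_def by blast
  have "x = (\<Sum>i<Suc n. (c (n := k)) i *\<^sub>C (T ^^ i) w) + z"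
    unfolding 1 by (simp add: lessThan_Suc)
  then show "x \<in> krylov T b w (Suc n)" using 1(2) by (rule krylovI)
qed

lemma krylov_subset_Suc: "krylov T b w n \<subseteq> krylov T b w (Suc n)"
proof
  fix x assume "x \<in> krylov T b w n"
  then have "0 *\<^sub>C (T ^^ n) w + x \<in> krylov T b w (Suc n)" unfolding krylov_Suc by blast
  then show "x \<in> krylov T b w (Suc n)" by simp
qed

lemma base_subset_krylov: "b \<subseteq> krylov T b w n"
  by (induction n) (use krylov_0 krylov_subset_Suc in blast)+

lemma krylov_last: "subspace b \<Longrightarrow> (T ^^ n) w \<in> krylov T b w (Suc n)"
  unfolding krylov_Suc using subspace_0 [OF subspace_krylov [of b T w n]]
  by (metis (mono_tags, lifting) CollectI add.right_neutral scale_one)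

lemma krylov_subset:
  assumes "subspace a" "b \<subseteq> a" "T ` a \<subseteq> a" "w \<in> a"
  shows "krylov T b w n \<subseteq> a"
proof (induction n)
  case 0 then show ?case using krylov_0 assms by simp
next
  case (Suc n)
  have "(T ^^ n) w \<in> a" by (induction n) (use assms in auto)
  then show ?case using Suc unfolding krylov_Suc
    using assms(1) subspace_add subspace_scale by blast
qed

lemma krylov_image:
  assumes "Vector_Spaces.linear scale scale T" "subspace b" "T ` b \<subseteq> b"
  shows "T ` krylov T b w n \<subseteq> krylov T b w (Suc n)"
proof (induction n)
  interpret T: Vector_Spaces.linear scale scale T by fact
  case 0 then show ?case using assms krylov_0 base_subset_krylov by fast
next
  interpret T: Vector_Spaces.linear scale scale T by fact
  case (Suc n)
  show ?case
  proof
    fix x assume "x \<in> T ` krylov T b w (Suc n)"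
    then obtain c z where 1: "x = T (c *\<^sub>C (T ^^ n) w + z)" "z \<in> krylov T b w n"
      unfolding krylov_Suc by blast
    then have "x = c *\<^sub>C (T ^^ Suc n) w + T z" "T z \<in> krylov T b w (Suc n)"
      using Suc by (auto simp: T.add T.scale)
    then show "x \<in> krylov T b w (Suc (Suc n))" unfolding krylov_Suc [of _ _ _ "Suc n"] by blast
  qed
qed

text \<open>Otherwise every stage would be strictly larger than the one before, and the dimensions
  would exceed that of \<open>a\<close>.\<close>

lemma krylov_stabilises:
  assumes "fin_dim a" "subspace a" "subspace b" "b \<subseteq> a" "T ` a \<subseteq> a" "w \<in> a"
  obtains n where "(T ^^ n) w \<in> krylov T b w n"
proof (rule ccontr)
  assume "\<not> thesis"
  then have no: "(T ^^ n) w \<notin> krylov T b w n" for n using that by blast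
  have sub: "krylov T b w n \<subseteq> a" for n using krylov_subset assms by blast
  have "n \<le> dim (krylov T b w n)" for n
  proof (induction n)
    case (Suc n)
    have "krylov T b w n \<subset> krylov T b w (Suc n)"
      using krylov_subset_Suc no krylov_last [OF assms(3)] by blast
    then have "dim (krylov T b w n) < dim (krylov T b w (Suc n))"
      using fin_dim_psubset_dim fin_dim_subset [OF assms(1) sub] subspace_krylov [OF assms(3)] by metis
    then show ?case using Suc by simp
  qed simp
  from this [of "Suc (dim a)"] show False
    using fin_dim_dim_mono [OF assms(1) sub subspace_krylov [OF assms(3)] assms(2), of "Suc (dim a)"] by simp
qed

section \<open>Polynomials in an operator\<close>

definition poly_endo :: "complex poly \<Rightarrow> ('v \<Rightarrow> 'v) \<Rightarrow> 'v \<Rightarrow> 'v"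
  where "poly_endo p T v = (\<Sum>i\<le>degree p. coeff p i *\<^sub>C (T ^^ i) v)"

lemma poly_endo_eq:
  assumes "degree p < N"
  shows "poly_endo p T v = (\<Sum>i<N. coeff p i *\<^sub>C (T ^^ i) v)"
  unfolding poly_endo_def
  by (rule sum.mono_neutral_left) (use assms in \<open>auto simp: coeff_eq_0\<close>)

lemma poly_endo_linear_factor:
  assumes "Vector_Spaces.linear scale scale T"
  shows "poly_endo ([:- z, 1:] * q) T v = T (poly_endo q T v) - z *\<^sub>C poly_endo q T v"
proof -
  interpret T: Vector_Spaces.linear scale scale T by fact
  \<comment> \<open>Two more than the degree of \<open>q\<close>, so that the coefficients of
    \<open>q\<close> and of \<open>pCons 0 q\<close> are covered by the same range of
    summation.\<close>
  define N where "N = Suc (Suc (degree q))"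
  have "degree ([:- z, 1:] * q) \<le> Suc (degree q)"
    using degree_mult_le [of "[:- z, 1:]" q] by simp
  then have "poly_endo ([:- z, 1:] * q) T v
      = (\<Sum>i<N. (coeff (pCons 0 q) i + - z * coeff q i) *\<^sub>C (T ^^ i) v)"
    by (subst poly_endo_eq [where N = N]) (simp_all add: N_def algebra_simps)
  also have "\<dots> = (\<Sum>i<N. coeff (pCons 0 q) i *\<^sub>C (T ^^ i) v) - z *\<^sub>C (\<Sum>i<N. coeff q i *\<^sub>C (T ^^ i) v)"
    by (simp add: scale_left_diff_distrib scale_left_distrib sum_subtractf scale_sum_right)
  also have "(\<Sum>i<N. coeff q i *\<^sub>C (T ^^ i) v) = poly_endo q T v"
    by (subst poly_endo_eq [where N = N]) (simp_all add: N_def)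
  also have "(\<Sum>i<N. coeff (pCons 0 q) i *\<^sub>C (T ^^ i) v) = T (poly_endo q T v)"
    unfolding N_def poly_endo_def lessThan_Suc_atMost
    by (subst sum.atMost_Suc_shift) (simp add: T.sum T.scale)
  finally show ?thesis .
qed

text \<open>Linear factors of \<open>p\<close> are split off one at a time. As long as the cofactor
  still sends \<open>w\<close> into \<open>b\<close>, the degree drops; once it does not, the value
  of the cofactor at \<open>w\<close> is an eigenvector modulo \<open>b\<close> for the root just
  removed.\<close>

lemma poly_endo_eigenvector:
  assumes T: "Vector_Spaces.linear scale scale T" and a: "subspace a" "T ` a \<subseteq> a" and b: "subspace b"
    and w: "w \<in> a" "w \<notin> b" and p: "p \<noteq> 0" "poly_endo p T w \<in> b"
  shows "\<exists>v \<in> a - b. \<exists>l. T v - l *\<^sub>C v \<in> b"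
  using p
proof (induction "degree p" arbitrary: p)
  case 0
  then obtain c where c: "p = [:c:]" "c \<noteq> 0" by (metis degree_eq_zeroE pCons_0_0)
  then have "c *\<^sub>C w \<in> b" using 0 by (simp add: poly_endo_def)
  then have "inverse c *\<^sub>C c *\<^sub>C w \<in> b" by (rule subspace_scale [OF b])
  then show ?case using w c by simp
next
  case (Suc n)
  then obtain z where "poly p z = 0"
    using fundamental_theorem_of_algebra [of p] by (metis constant_degree nat.distinct(1))
  then obtain q where q: "p = [:- z, 1:] * q" by (metis dvdE poly_eq_0_iff_dvd)
  have ne: "q \<noteq> 0" using q Suc by auto
  have "degree p = Suc (degree q)" using ne unfolding q by (subst degree_mult_eq) auto
  then have dq: "n = degree q" using Suc by simp
  have "(T ^^ i) w \<in> a" for i by (induction i) (use w a in auto)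
  then have qa: "poly_endo q T w \<in> a"
    unfolding poly_endo_def by (intro subspace_sum [OF a(1)] subspace_scale [OF a(1)])
  show ?case
  proof (cases "poly_endo q T w \<in> b")
    case True
    then show ?thesis using Suc(1) [OF dq ne] by blast
  next
    case False
    have "T (poly_endo q T w) - z *\<^sub>C poly_endo q T w \<in> b"
      using Suc(4) unfolding q poly_endo_linear_factor [OF T] .
    then show ?thesis using False qa by blast
  qed
qed

lemma relative_eigenvector:
  assumes T: "Vector_Spaces.linear scale scale T" and a: "fin_dim a" "subspace a" "T ` a \<subseteq> a"
    and b: "subspace b" "b \<subset> a"
  obtains v l where "v \<in> a" "v \<notin> b" "T v - l *\<^sub>C v \<in> b"
proof -
  obtain w where w: "w \<in> a" "w \<notin> b" using b(2) by blast
  obtain n where "(T ^^ n) w \<in> krylov T b w n"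
    using krylov_stabilises [OF a(1,2) b(1) _ a(3) w(1)] b(2) by blast
  then obtain c z where c: "(T ^^ n) w = (\<Sum>i<n. c i *\<^sub>C (T ^^ i) w) + z" "z \<in> b"
    unfolding krylov_def by blast
  \<comment> \<open>The monic polynomial of the relation that expresses \<open>(T ^^ n) w\<close> by
    lower powers modulo \<open>b\<close>; it sends \<open>w\<close> to the remainder
    \<open>z\<close>.\<close>
  define p where "p = monom 1 n - (\<Sum>i<n. monom (c i) i)"
  have co: "coeff p i = (if i = n then 1 else if i < n then - c i else 0)" for i
    unfolding p_def by (simp add: coeff_sum)
  then have "coeff p n = 1" by simp
  then have p0: "p \<noteq> 0" by auto
  have "degree p < Suc n" using co by (intro le_imp_less_Suc degree_le) auto
  then have "poly_endo p T w = (\<Sum>i<Suc n. coeff p i *\<^sub>C (T ^^ i) w)" by (rule poly_endo_eq)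
  also have "\<dots> = (\<Sum>i<n. - (c i *\<^sub>C (T ^^ i) w)) + (T ^^ n) w"
    by (simp add: co)
  also have "\<dots> = z" unfolding c(1) by (simp add: sum_negf)
  finally have "poly_endo p T w \<in> b" using c(2) by simp
  then show thesis using poly_endo_eigenvector [OF T a(2,3) b(1) w p0] that by blast
qed

end

section \<open>Solvable subalgebras and Lie's theorem\<close>

locale complex_lie = complex_space scale + field_lie scale br
  for scale :: "complex \<Rightarrow> 'a::ab_group_add \<Rightarrow> 'a" (infixr \<open>*\<^sub>C\<close> 75) and br
begin

text \<open>A chain of subspaces in place of the derived series: \<open>D\<close> may be any
  solvable subspace containing the brackets of \<open>S\<close>, not only their span. Such a
  \<open>D\<close> is automatically an ideal of \<open>S\<close>, and induction runs along the chain
  from the bottom.\<close>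

inductive solv :: "'a set \<Rightarrow> bool" where
  solv_zero: "solv {0}"
| solv_step: "subspace S \<Longrightarrow> solv D \<Longrightarrow> D \<subseteq> S \<Longrightarrow> (\<And>x y. x \<in> S \<Longrightarrow> y \<in> S \<Longrightarrow> br x y \<in> D) \<Longrightarrow> solv S"

lemma solv_subspace: "solv S \<Longrightarrow> subspace S"
  by (induction rule: solv.induct) auto

lemma solv_closed: "solv S \<Longrightarrow> x \<in> S \<Longrightarrow> y \<in> S \<Longrightarrow> br x y \<in> S"
  by (induction rule: solv.induct) auto

text \<open>The chain of \<open>S\<close> is intersected with \<open>T\<close>.\<close>

lemma solv_mono:
  assumes "solv S" "T \<subseteq> S" "subspace T" "\<And>x y. x \<in> T \<Longrightarrow> y \<in> T \<Longrightarrow> br x y \<in> T"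
  shows "solv T"
  using assms
proof (induction arbitrary: T rule: solv.induct)
  case solv_zero
  then have "T = {0}" using subspace_0 [of T] by blast
  then show ?case using solv.solv_zero by simp
next
  case (solv_step S D)
  have "solv (D \<inter> T)"
  proof (rule solv_step.IH)
    show "subspace (D \<inter> T)" using solv_subspace [OF solv_step.hyps(2)] solv_step.prems(2) by (rule subspace_inter)
    show "br x y \<in> D \<inter> T" if "x \<in> D \<inter> T" "y \<in> D \<inter> T" for x y 
      using that solv_closed [OF solv_step.hyps(2)] solv_step.prems(3) by blast
  qed blast
  then show ?case
    by (rule solv.solv_step [OF solv_step.prems(2)]) (use solv_step.hyps(4) solv_step.prems(1,3) in blast)+
qed

text \<open>A step of the chain may repeat the same subspace; the first strict one, counted from
  \<open>S\<close>, gives \<open>D\<close>.\<close>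

lemma solv_commutator_proper:
  assumes "solv S" "S \<noteq> {0}"
  obtains D where "subspace D" "D \<subset> S" "\<And>x y. x \<in> S \<Longrightarrow> y \<in> S \<Longrightarrow> br x y \<in> D"
proof -
  have "\<exists>D. subspace D \<and> D \<subset> S \<and> (\<forall>x\<in>S. \<forall>y\<in>S. br x y \<in> D)"
    using assms
  proof (induction rule: solv.induct)
    case (solv_step S D)
    show ?case
    proof (cases "D = S")
      case False
      then show ?thesis using solv_subspace [OF solv_step.hyps(2)] solv_step.hyps(3,4) by blast
    next
      case True
      then show ?thesis using solv_step.IH solv_step.prems by simp
    qed
  qed simp
  then show thesis using that by blast
qed

text \<open>
  The commutator \<open>[x, y]\<close> acts by zero on a weight vector \<open>u\<close>: on the Krylov chain of \<open>u\<close> under \<open>x\<close>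
  the operator \<open>y - l y\<close> lowers the filtration by one step, with leading coefficient a nonzero
  multiple of \<open>l [x, y]\<close>. This replaces the usual trace argument.
\<close>

lemma weight_vanishes_on_commutator:
  assumes a: "fin_dim a" "subspace a" "br x ` a \<subseteq> a" and b: "subspace b" "b \<subseteq> a" "br x ` b \<subseteq> b"
    and m: "\<And>y. y \<in> m \<Longrightarrow> br x y \<in> m" "\<And>y z. y \<in> m \<Longrightarrow> z \<in> b \<Longrightarrow> br y z \<in> b"
    and u: "u \<in> a" "u \<notin> b" "\<And>y. y \<in> m \<Longrightarrow> br y u - l y *\<^sub>C u \<in> b"
    and y: "y \<in> m"
  shows "l (br x y) = 0"
proof (rule ccontr)
  assume nz: "l (br x y) \<noteq> 0"
  define K where "K = krylov (br x) b u"
  define P where "P = (\<lambda>k. (br x ^^ k) u)"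
  have K: "subspace (K k)" "K 0 = b" "K k \<subseteq> K (Suc k)" "P k \<in> K (Suc k)" "b \<subseteq> K k" for k
    unfolding K_def P_def
    by (rule subspace_krylov [OF b(1)] krylov_0 krylov_subset_Suc krylov_last [OF b(1)] base_subset_krylov)+
  have Kx: "br x p \<in> K (Suc k)" if "p \<in> K k" for p k
    using krylov_image [OF linear_br b(1,3)] that unfolding K_def by blast
  have P: "P 0 = u" "P (Suc k) = br x (P k)" for k unfolding P_def by simp_all
  \<comment> \<open>The first conjunct says that \<open>y - l y\<close> maps \<open>P k\<close> into
    the stage below it, the second computes its leading term on \<open>P (Suc k)\<close>. Moving
    \<open>y\<close> past one more factor \<open>x\<close> produces one more commutator, whence the
    coefficient \<open>Suc k\<close>.\<close>
  have *: "(\<forall>y\<in>m. br y (P k) - l y *\<^sub>C P k \<in> K k)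
    \<and> (\<forall>y\<in>m. br y (P (Suc k)) - l y *\<^sub>C P (Suc k) + of_nat (Suc k) *\<^sub>C l (br x y) *\<^sub>C P k \<in> K k)" for k
  proof (induction k)
    case 0
    have 1: "br y u - l y *\<^sub>C u \<in> K 0" if "y \<in> m" for y
      using u(3) [OF that] K(2) by simp
    have "br y (br x u) - l y *\<^sub>C br x u + l (br x y) *\<^sub>C u \<in> K 0" if "y \<in> m" for y
    proof -
      have "br y (br x u) - l y *\<^sub>C br x u + l (br x y) *\<^sub>C u
        = br x (br y u - l y *\<^sub>C u) - (br (br x y) u - l (br x y) *\<^sub>C u)"
        using br_derivation [of x y u] by (simp add: br_bilinear)
      moreover have "br x (br y u - l y *\<^sub>C u) \<in> K 0" using 1 [OF that] b(3) K(2) by blast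
      ultimately show ?thesis
        using subspace_diff [OF K(1)] 1 [OF m(1) [OF that]] by metis
    qed
    then show ?case using 1 P by simp
  next
    case (Suc k)
    have 1: "br y (P (Suc k)) - l y *\<^sub>C P (Suc k) \<in> K (Suc k)" if "y \<in> m" for y
    proof -
      define A where "A = br y (P (Suc k)) - l y *\<^sub>C P (Suc k)"
      have "A + of_nat (Suc k) *\<^sub>C l (br x y) *\<^sub>C P k \<in> K (Suc k)"
        using Suc that K(3) unfolding A_def by blast
      then have "(A + of_nat (Suc k) *\<^sub>C l (br x y) *\<^sub>C P k) - of_nat (Suc k) *\<^sub>C l (br x y) *\<^sub>C P k \<in> K (Suc k)"
        by (intro subspace_diff subspace_scale K)
      then show ?thesis unfolding A_def by simp
    qed
    have "br y (P (Suc (Suc k))) - l y *\<^sub>C P (Suc (Suc k))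
        + of_nat (Suc (Suc k)) *\<^sub>C l (br x y) *\<^sub>C P (Suc k) \<in> K (Suc k)" if "y \<in> m" for y
    proof -
      define d where "d = (of_nat (Suc k) :: complex)"
      define A where "A = br y (P (Suc k)) - l y *\<^sub>C P (Suc k) + d *\<^sub>C l (br x y) *\<^sub>C P k"
      define B where "B = br (br x y) (P (Suc k)) - l (br x y) *\<^sub>C P (Suc k)"
      have d: "of_nat (Suc (Suc k)) = d + 1" unfolding d_def by simp
      have "br y (P (Suc (Suc k))) - l y *\<^sub>C P (Suc (Suc k))
        + of_nat (Suc (Suc k)) *\<^sub>C l (br x y) *\<^sub>C P (Suc k) = br x A - B"
        unfolding A_def B_def P(2) d using br_derivation [of x y "br x (P k)"]
        by (simp add: br_bilinear scale_simps algebra_simps)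
      moreover have "br x A \<in> K (Suc k)" using Suc that Kx unfolding A_def d_def by blast
      moreover have "B \<in> K (Suc k)" unfolding B_def using 1 m(1) [OF that] by blast
      ultimately show ?thesis using subspace_diff [OF K(1)] by metis
    qed
    then show ?case using 1 by blast
  qed
  define E where "E = (\<lambda>p. br y p - l y *\<^sub>C p)"
  have E0: "E p \<in> b" if "p \<in> b" for p
    unfolding E_def using that y by (intro subspace_diff subspace_scale b(1) m(2))
  have E: "E p \<in> K k" if "p \<in> K (Suc k)" for p k
    using that
  proof (induction k arbitrary: p)
    case 0
    then obtain c z where "p = c *\<^sub>C P 0 + z" "z \<in> b"
      using krylov_Suc [of "br x" b u 0] K(2) unfolding K_def P_def by auto
    then have "E p = c *\<^sub>C (br y (P 0) - l y *\<^sub>C P 0) + E z" "E z \<in> K 0"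
      "br y (P 0) - l y *\<^sub>C P 0 \<in> K 0"
      using E0 K(2) * [of 0] y unfolding E_def
      by (auto simp: br_bilinear scale_simps algebra_simps)
    then show ?case using subspace_add [OF K(1)] subspace_scale [OF K(1)] by metis
  next
    case (Suc k)
    then obtain c z where "p = c *\<^sub>C P (Suc k) + z" "z \<in> K (Suc k)"
      using krylov_Suc [of "br x" b u "Suc k"] unfolding K_def P_def by auto
    then have "E p = c *\<^sub>C (br y (P (Suc k)) - l y *\<^sub>C P (Suc k)) + E z" "E z \<in> K (Suc k)"
      "br y (P (Suc k)) - l y *\<^sub>C P (Suc k) \<in> K (Suc k)"
      using Suc(1) K(3) * [of "Suc k"] y unfolding E_def
      by (auto simp: br_bilinear scale_simps algebra_simps)
    then show ?case using subspace_add [OF K(1)] subspace_scale [OF K(1)] by metis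
  qed
  have ex: "\<exists>n. P n \<in> K n"
    using krylov_stabilises [OF a(1,2) b(1,2) a(3) u(1)] unfolding P_def K_def by blast
  \<comment> \<open>At the first \<open>n = Suc k\<close> with \<open>P n\<close> in
    \<open>K n\<close> the operator \<open>E\<close> sends \<open>P n\<close> into
    \<open>K k\<close>; its leading term, a nonzero multiple of \<open>P k\<close>, would then lie
    in \<open>K k\<close> as well, against minimality. The factor \<open>Suc k\<close> is invertible
    in characteristic zero.\<close>
  define n where "n = (LEAST n. P n \<in> K n)"
  have n: "P n \<in> K n" unfolding n_def using ex by (rule LeastI_ex)
  have "n \<noteq> 0" using n u(2) P K(2) by metis
  then obtain k where k: "n = Suc k" using not0_implies_Suc by blast
  then have nk: "P k \<notin> K k" using not_less_Least [of k "\<lambda>n. P n \<in> K n"] n_def by simp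
  have "E (P (Suc k)) \<in> K k" using E n k by blast
  moreover have "E (P (Suc k)) + of_nat (Suc k) *\<^sub>C l (br x y) *\<^sub>C P k \<in> K k"
    using * [of k] y unfolding E_def by blast
  ultimately have low: "(E (P (Suc k)) + of_nat (Suc k) *\<^sub>C l (br x y) *\<^sub>C P k) - E (P (Suc k)) \<in> K k"
    using subspace_diff [OF K(1)] by blast
  define q where "q = of_nat (Suc k) * l (br x y)"
  have q: "q \<noteq> 0" using nz unfolding q_def by (simp del: of_nat_Suc)
  have "q *\<^sub>C P k \<in> K k" using low unfolding q_def by simp
  then have "inverse q *\<^sub>C q *\<^sub>C P k \<in> K k" by (rule subspace_scale [OF K(1)])
  then show False using nk q by simp
qed

text \<open>Stated modulo \<open>b\<close> because it will be used for a subalgebra \<open>m\<close>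
  acting on \<open>h\<close> modulo \<open>m\<close>. By induction on the dimension, a hyperplane of
  \<open>m\<close> containing all brackets has a weight vector; the weight space is stable under the
  remaining direction \<open>x0\<close>, which has an eigenvector in it.\<close>

lemma Lie_theorem:
  assumes "solv m" "fin_dim m" and a: "fin_dim a" "subspace a" and b: "subspace b" "b \<subset> a"
    and ma: "\<And>x v. x \<in> m \<Longrightarrow> v \<in> a \<Longrightarrow> br x v \<in> a"
    and mb: "\<And>x v. x \<in> m \<Longrightarrow> v \<in> b \<Longrightarrow> br x v \<in> b"
  shows "\<exists>v\<in>a - b. \<forall>x\<in>m. \<exists>l. br x v - l *\<^sub>C v \<in> b"
  using assms(1,2) ma mb
proof (induction "dim m" arbitrary: m rule: less_induct)
  case less
  note sm = solv_subspace [OF less(2)]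
  show ?case
  proof (cases "m = {0}")
    case True
    obtain v where "v \<in> a" "v \<notin> b" using b by blast
    moreover have "br 0 v - 0 *\<^sub>C v \<in> b" using subspace_0 [OF b(1)] by simp
    ultimately show ?thesis using True by blast
  next
    case False
    then obtain D where D: "subspace D" "D \<subset> m" "\<And>x y. x \<in> m \<Longrightarrow> y \<in> m \<Longrightarrow> br x y \<in> D"
      using solv_commutator_proper less(2) by blast
    then obtain x0 where x0: "x0 \<in> m" "x0 \<notin> D" by blast
    obtain f where f: "Vector_Spaces.linear scale (*) f" "\<And>y. y \<in> D \<Longrightarrow> f y = 0" "f x0 = 1"
      by (rule vanishing_functional [OF D(1) x0(2)]) blast
    interpret f: Vector_Spaces.linear scale "(*)" f by fact
    \<comment> \<open>The kernel of \<open>f\<close> contains \<open>D\<close>, hence all brackets,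
      so \<open>m1\<close> is an ideal of codimension one in \<open>m\<close>.\<close>
    define m1 where "m1 = {y \<in> m. f y = 0}"
    have sm1: "subspace m1"
      unfolding m1_def using sm by (auto simp: subspace_def f.add f.scale)
    have "x0 \<notin> m1" unfolding m1_def using f(3) by simp
    then have m1: "m1 \<subset> m" using x0 unfolding m1_def by blast
    have mm: "br x y \<in> m1" if "x \<in> m" "y \<in> m" for x y
      unfolding m1_def using D(2) D(3) [OF that] f(2) by auto
    have "solv m1" using solv_mono [OF less(2) _ sm1] m1 mm by blast
    moreover have "fin_dim m1" using fin_dim_subset less(3) m1 by blast
    moreover have "dim m1 < dim m" using fin_dim_psubset_dim less(3) m1(1) sm1 sm by blast
    ultimately have "\<exists>v\<in>a - b. \<forall>x\<in>m1. \<exists>l. br x v - l *\<^sub>C v \<in> b"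
      using less m1 by blast
    then obtain w l where w: "w \<in> a" "w \<notin> b" "\<And>y. y \<in> m1 \<Longrightarrow> br y w - l y *\<^sub>C w \<in> b"
      by (metis DiffE)
    \<comment> \<open>The weight space of \<open>l\<close> modulo \<open>b\<close>. It contains
      \<open>b\<close> strictly, so \<open>x0\<close> will have a relative eigenvector for the pair
      \<open>b\<close>, \<open>W\<close>.\<close>
    define W where "W = {u \<in> a. \<forall>y\<in>m1. br y u - l y *\<^sub>C u \<in> b}"
    have sW: "subspace W"
    proof (rule subspaceI)
      show "0 \<in> W" unfolding W_def using subspace_0 a b by auto
    next
      fix u v assume uv: "u \<in> W" "v \<in> W"
      have "br y (u + v) - l y *\<^sub>C (u + v) \<in> b" if "y \<in> m1" for y
      proof -
        have "br y (u + v) - l y *\<^sub>C (u + v) = (br y u - l y *\<^sub>C u) + (br y v - l y *\<^sub>C v)"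
          by (simp add: br_bilinear scale_simps)
        then show ?thesis using uv that subspace_add [OF b(1)] unfolding W_def by simp
      qed
      then show "u + v \<in> W" using uv subspace_add [OF a(2)] unfolding W_def by simp
    next
      fix c u assume u: "u \<in> W"
      have "br y (c *\<^sub>C u) - l y *\<^sub>C (c *\<^sub>C u) \<in> b" if "y \<in> m1" for y
      proof -
        have "br y (c *\<^sub>C u) - l y *\<^sub>C (c *\<^sub>C u) = c *\<^sub>C (br y u - l y *\<^sub>C u)"
          by (simp add: br_bilinear scale_simps mult.commute)
        then show ?thesis using u that subspace_scale [OF b(1)] unfolding W_def by simp
      qed
      then show "c *\<^sub>C u \<in> W" using u subspace_scale [OF a(2)] unfolding W_def by simp
    qed
    have bW: "b \<subseteq> W"
      unfolding W_def using b less(5) m1 subspace_diff [OF b(1)] subspace_scale [OF b(1)] by blast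
    have bm: "br y z \<in> b" if "y \<in> m1" "z \<in> b" for y z using less(5) that m1 by blast
    have xW: "br x0 u \<in> W" if u: "u \<in> W" for u
    proof (cases "u \<in> b")
      case True then show ?thesis using less(5) x0 bW by blast
    next
      case False
      have ua: "u \<in> a" "\<And>y. y \<in> m1 \<Longrightarrow> br y u - l y *\<^sub>C u \<in> b" using u unfolding W_def by auto
      have "br y (br x0 u) - l y *\<^sub>C br x0 u \<in> b" if y: "y \<in> m1" for y
      proof -
        have z: "br x0 y \<in> m1" using m1 mm x0 y by blast
        have "br x0 ` a \<subseteq> a" "br x0 ` b \<subseteq> b" using less(4,5) x0 by auto
        moreover have "br x0 y \<in> m1" if "y \<in> m1" for y using m1 mm x0 that by blast
        ultimately have "l (br x0 y) = 0"
          using weight_vanishes_on_commutator [OF a _ b(1) _ _ _ _ ua(1) False ua(2) y] b(2) bm by blast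
        then have 1: "br (br x0 y) u \<in> b" using ua(2) [OF z] by simp
        have "br y (br x0 u) - l y *\<^sub>C br x0 u = br x0 (br y u - l y *\<^sub>C u) - br (br x0 y) u"
          using br_derivation [of x0 y u] by (simp add: br_bilinear)
        moreover have "br x0 (br y u - l y *\<^sub>C u) \<in> b" using less(5) x0 ua(2) y by blast
        ultimately show ?thesis using 1 subspace_diff [OF b(1)] by simp
      qed
      then show ?thesis using less(4) x0 ua unfolding W_def by blast
    qed
    have Wa: "W \<subseteq> a" and "w \<in> W" unfolding W_def using w by auto
    then have "b \<subset> W" using bW w by blast
    then obtain v k where v: "v \<in> W" "v \<notin> b" "br x0 v - k *\<^sub>C v \<in> b"
      using relative_eigenvector [OF linear_br fin_dim_subset [OF a(1) Wa] sW _ b(1), of x0] xW by blast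
    have "\<exists>l. br x v - l *\<^sub>C v \<in> b" if x: "x \<in> m" for x
    proof -
      define x' where "x' = x - f x *\<^sub>C x0"
      have x': "x' \<in> m1" unfolding x'_def m1_def
        using x x0 sm subspace_diff subspace_scale f by (simp add: f.diff f.scale)
      have "br x v - (f x * k + l x') *\<^sub>C v = f x *\<^sub>C (br x0 v - k *\<^sub>C v) + (br x' v - l x' *\<^sub>C v)"
        unfolding x'_def by (simp add: br_bilinear scale_simps algebra_simps)
      moreover have "br x' v - l x' *\<^sub>C v \<in> b" using v x' unfolding W_def by blast
      ultimately have "br x v - (f x * k + l x') *\<^sub>C v \<in> b"
        using v(3) subspace_add [OF b(1)] subspace_scale [OF b(1)] by metis
      then show ?thesis by blast
    qed
    then show ?thesis using v Wa by blast
  qed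
qed

end

section \<open>A subalgebra that is \<open>sl\<^sub>2\<close> modulo a solvable ideal\<close>

context complex_lie
begin

definition subalg :: "'a set \<Rightarrow> bool"
  where "subalg S \<longleftrightarrow> subspace S \<and> (\<forall>x\<in>S. \<forall>y\<in>S. br x y \<in> S)"

text \<open>Model: vector fields on a line near a point, with \<open>m\<close> the fields vanishing
  at the point and \<open>v\<close> a translation. Stage \<open>i\<close> consists of the fields
  that vanish to order at least \<open>i + 1\<close>, since a bracket with \<open>v\<close> lowers
  the order by one.\<close>

primrec filt :: "'a \<Rightarrow> 'a set \<Rightarrow> nat \<Rightarrow> 'a set" where
  "filt v m 0 = m"
| "filt v m (Suc i) = {y \<in> filt v m i. br v y \<in> filt v m i}"

lemma subspace_filt: "subspace m \<Longrightarrow> subspace (filt v m i)"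
proof (induction i)
  case (Suc i)
  then have s: "subspace (filt v m i)" by simp
  show ?case
    unfolding filt.simps subspace_def
    using subspace_0 [OF s] subspace_add [OF s] subspace_scale [OF s] by (auto simp: br_bilinear)
qed simp

text \<open>Lie's classification on the line: a finite-dimensional transitive algebra that is not
  solvable acts through the span of \<open>d/dx\<close>, \<open>x d/dx\<close>,
  \<open>x^2 d/dx\<close>. In the proof \<open>v\<close>, \<open>t\<close> and \<open>u\<close> play
  these three fields up to scalars, and \<open>k\<close> is the kernel of the action.\<close>

lemma codim_one_sl2:
  assumes h: "subalg h" "fin_dim h" "\<not> solv h"
    and v: "v \<in> h" and g: "Vector_Spaces.linear scale (*) g" "g v = 1"
    and m: "m = {x \<in> h. g x = 0}" "solv m"
  obtains e f t k where "e \<in> h" "f \<in> h" "t \<in> h" "solv k" "k \<subseteq> h" "e \<notin> k"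
    "\<And>x. x \<in> k \<Longrightarrow> br e x \<in> k" "\<And>x. x \<in> k \<Longrightarrow> br f x \<in> k" "\<And>x. x \<in> k \<Longrightarrow> br t x \<in> k"
    "br t e - 2 *\<^sub>C e \<in> k" "br t f + 2 *\<^sub>C f \<in> k" "br e f = t"
proof -
  interpret g: Vector_Spaces.linear scale "(*)" g by fact
  define M where "M = filt v m"
  have sm: "subspace m" and sh: "subspace h" and hh: "\<And>x y. x \<in> h \<Longrightarrow> y \<in> h \<Longrightarrow> br x y \<in> h"
    using m(2) solv_subspace h(1) unfolding subalg_def by blast+
  have M0: "M 0 = m" and MS: "M (Suc i) = {y \<in> M i. br v y \<in> M i}" for i
    unfolding M_def by simp_all
  have sM: "subspace (M i)" for i unfolding M_def by (rule subspace_filt [OF sm])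
  note M_add = subspace_add [OF sM] and M_diff = subspace_diff [OF sM]
    and M_scale = subspace_scale [OF sM] and M_neg = subspace_neg [OF sM]
  have dec: "M (Suc i) \<subseteq> M i" for i unfolding MS by blast
  have Mm: "M i \<subseteq> m" for i by (induction i) (use M0 dec in auto)
  have mh: "m \<subseteq> h" unfolding m(1) by blast
  have mm: "br x y \<in> m" if "x \<in> m" "y \<in> m" for x y using solv_closed m(2) that by blast
  have dec_h: "x - g x *\<^sub>C v \<in> m" if "x \<in> h" for x
    unfolding m(1) using that v g(2) subspace_diff [OF sh] subspace_scale [OF sh]
    by (simp add: g.diff g.scale)
  have vM: "br v y \<in> M i" if "y \<in> M (Suc i)" for y i using that unfolding MS by blast
  have vh: "br v y \<in> h" if "y \<in> m" for y using hh v mh that by blast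

  \<comment> \<open>In the model: a bracket with a field vanishing at the point does not lower the
    order of vanishing.\<close>
  have F1: "br s y \<in> M i" if "s \<in> m" "y \<in> M i" for s y i
    using that
  proof (induction i arbitrary: s y)
    case 0 then show ?case using mm M0 by simp
  next
    case (Suc i)
    define c where "c = g (br v s)"
    define s' where "s' = br v s - c *\<^sub>C v"
    have s': "s' \<in> m" unfolding s'_def c_def using dec_h vh Suc by blast
    have "br v (br s y) = c *\<^sub>C br v y + br s' y + br s (br v y)"
      using br_derivation [of v s y] unfolding s'_def by (simp add: br_bilinear)
    moreover have "br v y \<in> M i" using vM Suc by blast
    moreover have "br s' y \<in> M i" "br s y \<in> M i" "br s (br v y) \<in> M i"
      using Suc s' dec vM by blast+
    ultimately show ?case unfolding MS using M_add M_scale by simp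
  qed
  \<comment> \<open>In the model: a bracket with a field of order at least two raises the
    order.\<close>
  have F2: "br s y \<in> M (Suc i)" if "s \<in> M 1" "y \<in> M i" for s y i
    using that(2)
  proof (induction i arbitrary: y)
    case 0
    have "br y s \<in> M 1" using F1 [of y s 1] 0 M0 that by simp
    then show ?case using br_swap [of s y] M_neg by simp
  next
    case (Suc i)
    have sm: "br v s \<in> m" "s \<in> m" using that(1) vM [of s 0] Mm M0 by auto
    have "br v (br s y) = br (br v s) y + br s (br v y)" by (rule br_derivation)
    moreover have "br (br v s) y \<in> M (Suc i)" using F1 sm Suc by blast
    moreover have "br s (br v y) \<in> M (Suc i)" using Suc vM by blast
    moreover have "br s y \<in> M (Suc i)" using F1 sm Suc by blast
    ultimately show ?case unfolding MS [of "Suc i"] using M_add by simp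
  qed

  \<comment> \<open>Otherwise \<open>v\<close> normalises \<open>m\<close>, which becomes an ideal
    with a one-dimensional quotient, and \<open>h\<close> is solvable.\<close>
  have "\<not> m \<subseteq> M 1"
  proof
    assume a: "m \<subseteq> M 1"
    have vm: "br v y \<in> m" if "y \<in> m" for y using a that vM [of y 0] M0 by auto
    have "solv h"
    proof (rule solv_step [OF sh m(2) mh])
      fix x y assume xy: "x \<in> h" "y \<in> h"
      define x' where "x' = x - g x *\<^sub>C v"
      define y' where "y' = y - g y *\<^sub>C v"
      have x': "x' \<in> m" "y' \<in> m" unfolding x'_def y'_def using dec_h xy by blast+
      have "br x y = g x *\<^sub>C br v y' - g y *\<^sub>C br v x' + br x' y'"
        unfolding x'_def y'_def using br_swap [of x v]
        by (simp add: br_bilinear br_self scale_simps algebra_simps)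
      then show "br x y \<in> m"
        using vm x' mm subspace_add [OF sm] subspace_diff [OF sm] subspace_scale [OF sm] by simp
    qed
    then show False using h(3) by blast
  qed
  then obtain t0 where t0: "t0 \<in> m" "t0 \<notin> M 1" by blast
  have nM1: "y \<in> M 1" if "y \<in> m" "g (br v y) = 0" for y
    using that vh MS [of 0] M0 m(1) by simp
  have gt0: "g (br v t0) \<noteq> 0" using nM1 t0 by blast
  have gM1: "g (br v y) = 0" if "y \<in> M 1" for y
    using vM [of y 0] that M0 m(1) by simp
  \<comment> \<open>Otherwise \<open>M 1\<close> is an ideal of codimension two; the quotient is
    spanned by \<open>v\<close> and \<open>t0\<close>, its brackets lie on the line of
    \<open>w\<close>, and \<open>h\<close> is solvable.\<close>
  have "\<not> M 1 \<subseteq> M 2"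
  proof
    assume a: "M 1 \<subseteq> M 2"
    have vM1: "br v y \<in> M 1" if "y \<in> M 1" for y using a that vM [of y 1] by (auto simp: numeral_2_eq_2)
    define w where "w = br v t0"
    define D where "D = {c *\<^sub>C w + y | c y. y \<in> M 1}"
    have DI: "c *\<^sub>C w + y \<in> D" if "y \<in> M 1" for c y unfolding D_def using that by blast
    have sD: "subspace D" unfolding D_def by (rule subspace_line_sum [OF sM])
    have hM: "\<exists>a b y. x = a *\<^sub>C v + b *\<^sub>C t0 + y \<and> y \<in> M 1" if "x \<in> h" for x
    proof -
      define x' where "x' = x - g x *\<^sub>C v"
      have x': "x' \<in> m" unfolding x'_def using dec_h that by blast
      define b where "b = g (br v x') / g (br v t0)"
      have "x' - b *\<^sub>C t0 \<in> M 1"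
        using x' t0 gt0 unfolding b_def
        by (intro nM1 subspace_diff [OF sm] subspace_scale [OF sm]) (simp_all add: br_bilinear g.diff g.scale)
      then show ?thesis unfolding x'_def
        by (intro exI [of _ "g x"] exI [of _ b] exI [of _ "x - g x *\<^sub>C v - b *\<^sub>C t0"]) simp
    qed
    have hM1: "br x y \<in> M 1" if "x \<in> h" "y \<in> M 1" for x y
    proof -
      obtain a b z where x: "x = a *\<^sub>C v + b *\<^sub>C t0 + z" "z \<in> M 1" using hM [OF \<open>x \<in> h\<close>] by blast
      have "br v y \<in> M 1" "br t0 y \<in> M 1" "br z y \<in> M 1"
        using vM1 F1 t0 x(2) Mm that by blast+
      then show ?thesis unfolding x(1) using M_add M_scale by (simp add: br_bilinear)
    qed
    have wh: "w \<in> h" unfolding w_def using vh t0 by blast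
    have Dh: "D \<subseteq> h"
      unfolding D_def using wh Mm mh subspace_add [OF sh] subspace_scale [OF sh] by blast
    have M1M1: "br x y \<in> M 1" if "x \<in> M 1" "y \<in> M 1" for x y using that Mm mh hM1 by blast
    have sol1: "solv (M 1)" using solv_mono [OF m(2) Mm sM] M1M1 by blast
    have solD: "solv D"
    proof (rule solv_step [OF sD sol1])
      show "M 1 \<subseteq> D" using DI [of _ 0] by auto
      fix x y assume "x \<in> D" "y \<in> D"
      then obtain c d x' y' where x: "x = c *\<^sub>C w + x'" "y = d *\<^sub>C w + y'" "x' \<in> M 1" "y' \<in> M 1"
        unfolding D_def by blast
      have "br x y = c *\<^sub>C br w y' - d *\<^sub>C br w x' + br x' y'"
        unfolding x(1,2) using br_swap [of x' w] by (simp add: br_bilinear br_self scale_simps)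
      then show "br x y \<in> M 1"
        using hM1 [OF wh] x(3,4) M1M1 M_add M_diff M_scale by simp
    qed
    have "solv h"
    proof (rule solv_step [OF sh solD Dh])
      fix x y assume "x \<in> h" "y \<in> h"
      then obtain a b x' c d y' where x: "x = a *\<^sub>C v + b *\<^sub>C t0 + x'" "x' \<in> M 1"
        "y = c *\<^sub>C v + d *\<^sub>C t0 + y'" "y' \<in> M 1" using hM by metis
      have t0h: "t0 \<in> h" using t0 mh by blast
      define z where "z = a *\<^sub>C br v y' + b *\<^sub>C br t0 y' - c *\<^sub>C br v x' - d *\<^sub>C br t0 x' + br x' y'"
      have z: "z \<in> M 1"
        unfolding z_def using hM1 [OF v] hM1 [OF t0h] x(2,4) M1M1 M_add M_diff M_scale by simp
      have "br x y = (a * d - b * c) *\<^sub>C w + z"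
        unfolding x(1,3) z_def w_def using br_swap [of x' v] br_swap [of x' t0] br_swap [of t0 v]
        by (simp add: br_bilinear br_self scale_simps algebra_simps)
      then show "br x y \<in> D" using DI z by simp
    qed
    then show False using h(3) by blast
  qed
  then obtain u0 where u0: "u0 \<in> M 1" "u0 \<notin> M 2" by blast
  have bu0: "br v u0 \<in> m" "br v u0 \<notin> M 1"
    using u0 vM [of u0 0] M0 MS [of 1] by (auto simp: numeral_2_eq_2)
  \<comment> \<open>Normalises \<open>u\<close> so that \<open>br t v\<close> is congruent to
    \<open>v\<close> modulo \<open>m\<close>.\<close>
  define r where "r = g (br (br v u0) v)"
  have r0: "r \<noteq> 0"
  proof
    assume "r = 0"
    then have "g (br v (br v u0)) = 0" unfolding r_def using br_swap [of v "br v u0"] by (simp add: g.neg)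
    then show False using nM1 bu0 by blast
  qed
  define u where "u = inverse r *\<^sub>C u0"
  define t where "t = br v u"
  have u: "u \<in> M 1" unfolding u_def using u0 M_scale by blast
  have t: "t \<in> m" unfolding t_def using vM [of u 0] u M0 by simp
  have tv: "g (br t v) = 1"
    unfolding t_def u_def using r0 r_def by (simp add: br_bilinear g.scale)
  have tv': "g (br v t) = - 1" using tv br_swap [of v t] by (simp add: g.neg)
  have tM1: "t \<notin> M 1" using gM1 tv' by fastforce
  have uM2: "u \<notin> M 2" using tM1 vM [of u 1] unfolding t_def by (auto simp: numeral_2_eq_2)
  define s where "s = v - br t v"
  have s: "s \<in> m" unfolding s_def m(1) using v hh t mh subspace_diff [OF sh] tv g(2) by (auto simp: g.diff)
  have vt: "br v t = s - v" unfolding s_def using br_swap [of v t] by simp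
  \<comment> \<open>The element \<open>t\<close>, minus the Euler field of the model, acts on the
    layer between \<open>M i\<close> and \<open>M (Suc i)\<close> by the scalar
    \<open>- i\<close>.\<close>
  have A: "br t y + of_nat i *\<^sub>C y \<in> M (Suc i)" if "y \<in> M i" for y i
    using that
  proof (induction i arbitrary: y)
    case 0
    then have y: "y \<in> m" using M0 by simp
    define c where "c = g (br v y)"
    define s2 where "s2 = br v y - c *\<^sub>C v"
    have s2: "s2 \<in> m" unfolding s2_def c_def using dec_h vh y by blast
    have "br v (br t y) = br s y - s2 - c *\<^sub>C s + br t s2"
      using br_derivation [of v t y] unfolding vt unfolding s2_def s_def
      by (simp add: br_bilinear scale_simps algebra_simps)
    moreover have "br s y - s2 - c *\<^sub>C s + br t s2 \<in> m"
      using mm s y s2 t by (intro subspace_add [OF sm] subspace_diff [OF sm] subspace_scale [OF sm])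
    ultimately show ?case using mm t y MS [of 0] M0 by simp
  next
    case (Suc i)
    define w where "w = br v y"
    have w: "w \<in> M i" unfolding w_def using vM Suc by blast
    have "br v (br t y + of_nat (Suc i) *\<^sub>C y) = (br t w + of_nat i *\<^sub>C w) + br s y"
      using br_derivation [of v t y] unfolding vt unfolding w_def
      by (simp add: br_bilinear scale_simps algebra_simps)
    then have "br v (br t y + of_nat (Suc i) *\<^sub>C y) \<in> M (Suc i)"
      using Suc(1) [OF w] F1 [OF s Suc(2)] M_add by simp
    moreover have "br t y + of_nat (Suc i) *\<^sub>C y \<in> M (Suc i)"
      using F1 [OF t Suc(2)] Suc(2) M_add M_scale by blast
    ultimately show ?case unfolding MS [of "Suc i"] by blast
  qed
  \<comment> \<open>Bracketing twice with \<open>v\<close> and applying \<open>g\<close> is a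
    functional on \<open>M 1\<close> with kernel \<open>M 2\<close> that does not vanish at
    \<open>u\<close>.\<close>
  have u2: "\<exists>c. y - c *\<^sub>C u \<in> M 2" if y: "y \<in> M 1" for y
  proof -
    define c where "c = g (br (br v y) v)"
    have 1: "y - c *\<^sub>C u \<in> M 1" using y u M_diff M_scale by blast
    have "br v (y - c *\<^sub>C u) \<in> m" using vM [of _ 0] 1 M0 by simp
    moreover have "g (br v (br v (y - c *\<^sub>C u))) = 0"
      using tv' br_swap [of v "br v y"] unfolding t_def c_def
      by (simp add: br_bilinear g.diff g.scale g.neg)
    ultimately have "br v (y - c *\<^sub>C u) \<in> M 1" by (rule nM1)
    then show ?thesis using 1 MS [of 1] by (auto simp: numeral_2_eq_2)
  qed

  \<comment> \<open>A field of order exactly three would, together with \<open>u\<close>, generate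
    fields of every higher order, against finite dimension.\<close>
  have M23: "M 2 \<subseteq> M 3"
  proof (rule ccontr)
    assume "\<not> M 2 \<subseteq> M 3"
    then obtain y2 where y2: "y2 \<in> M 2" "y2 \<notin> M 3" by blast
    define Y where "Y = (\<lambda>j. (br u ^^ j) y2)"
    have YS: "Y (Suc j) = br u (Y j)" for j unfolding Y_def by simp
    \<comment> \<open>Bracketing with \<open>v\<close> brings \<open>Y (Suc j)\<close> back to a
      multiple \<open>c\<close> of \<open>Y j\<close> modulo the next stage, so
      \<open>c \<noteq> 0\<close> keeps the order from jumping. The scalars start at
      \<open>- 2\<close> and decrease by \<open>j + 3\<close>; being negative is the property that
      survives the induction.\<close>
    have Q: "Y j \<in> M (j + 2) \<and> Y j \<notin> M (j + 3)
      \<and> (\<exists>c<0. br v (br u (Y j)) - of_real c *\<^sub>C Y j \<in> M (j + 3))" for j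
    proof (induction j)
      case 0
      obtain c where c: "br v y2 - c *\<^sub>C u \<in> M 2"
        using u2 vM [of y2 1] y2(1) by (auto simp: numeral_2_eq_2)
      have "br v (br u y2) - of_real (- 2) *\<^sub>C y2
        = (br t y2 + of_nat 2 *\<^sub>C y2) + br u (br v y2 - c *\<^sub>C u)"
        using br_derivation [of v u y2] unfolding t_def by (simp add: br_bilinear br_self scale_simps)
      moreover have "br t y2 + of_nat 2 *\<^sub>C y2 \<in> M 3" using A [OF y2(1)] by (simp add: eval_nat_numeral)
      moreover have "br u (br v y2 - c *\<^sub>C u) \<in> M 3" using F2 [OF u c] by (simp add: eval_nat_numeral)
      ultimately have "br v (br u y2) - of_real (- 2) *\<^sub>C y2 \<in> M 3" using M_add by metis
      moreover have "(- 2 :: real) < 0" by simp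
      ultimately show ?case using y2 unfolding Y_def
        by (metis add_0 funpow_0)
    next
      case (Suc j)
      then obtain c where c: "c < 0" "br v (br u (Y j)) - of_real c *\<^sub>C Y j \<in> M (j + 3)" by blast
      have 1: "Y (Suc j) \<in> M (Suc j + 2)" using F2 [OF u, of "Y j" "j + 2"] Suc unfolding YS by simp
      have 2: "Y (Suc j) \<notin> M (Suc j + 3)"
      proof
        assume "Y (Suc j) \<in> M (Suc j + 3)"
        then have "br v (br u (Y j)) \<in> M (j + 3)" using vM [of "Y (Suc j)" "j + 3"] YS by simp
        then have "br v (br u (Y j)) - (br v (br u (Y j)) - of_real c *\<^sub>C Y j) \<in> M (j + 3)"
          using c(2) M_diff by blast
        then have "of_real c *\<^sub>C Y j \<in> M (j + 3)" by simp
        then have "inverse (of_real c) *\<^sub>C of_real c *\<^sub>C Y j \<in> M (j + 3)" by (rule M_scale)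
        then show False using Suc c(1) by simp
      qed
      define w where "w = br v (br u (Y j)) - of_real c *\<^sub>C Y j"
      define z where "z = Y (Suc j)"
      have "br v (br u z) - of_real (c - real (j + 3)) *\<^sub>C z
          = (br t z + of_nat (j + 3) *\<^sub>C z) + br u w"
        using br_derivation [of v u z] unfolding t_def w_def z_def YS
        by (simp add: br_bilinear br_self scale_simps algebra_simps)
      moreover have "br t z + of_nat (j + 3) *\<^sub>C z \<in> M (Suc j + 3)"
        using A [of z "j + 3"] 1 unfolding z_def by (simp add: eval_nat_numeral)
      moreover have "br u w \<in> M (Suc j + 3)" using F2 [OF u, of w "j + 3"] c(2) unfolding w_def by simp
      ultimately have "br v (br u z) - of_real (c - real (j + 3)) *\<^sub>C z \<in> M (Suc j + 3)"
        using M_add by metis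
      moreover have "c - real (j + 3) < 0" using c(1) by simp
      ultimately show ?case using 1 2 unfolding z_def by blast
    qed
    have fM: "fin_dim (M i)" for i using h(2) fin_dim_subset Mm mh by blast
    have "dim (M (j + 2)) + j \<le> dim (M 2)" for j
    proof (induction j)
      case (Suc j)
      have "M (Suc j + 2) \<subset> M (j + 2)"
        using Q [of j] dec [of "j + 2"] by (auto simp: eval_nat_numeral)
      then have "dim (M (Suc j + 2)) < dim (M (j + 2))" by (rule fin_dim_psubset_dim [OF fM _ sM sM])
      then show ?case using Suc by simp
    qed (simp add: numeral_2_eq_2)
    from this [of "Suc (dim (M 2))"] show False by simp
  qed
  define k where "k = M 2"
  have sk: "subspace k" unfolding k_def by (rule sM)
  note k_add = subspace_add [OF sk] and k_diff = subspace_diff [OF sk] and k_scale = subspace_scale [OF sk]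
  have vk: "br v x \<in> k" if "x \<in> k" for x
    using M23 that vM [of x 2] unfolding k_def by (auto simp: eval_nat_numeral)
  have mk: "br y x \<in> k" if "y \<in> m" "x \<in> k" for x y using F1 that unfolding k_def by blast
  have km: "k \<subseteq> m" unfolding k_def by (rule Mm)
  have um: "u \<in> m" using u Mm by blast
  have tu: "br t u + u \<in> k" using A [OF u] unfolding k_def by (simp add: eval_nat_numeral)
  \<comment> \<open>Modulo \<open>k\<close> the algebra is spanned by \<open>v\<close>,
    \<open>t\<close>, \<open>u\<close>, and the coefficient of \<open>v\<close> in
    \<open>br t v\<close> is \<open>1\<close> by the normalisation of \<open>u\<close>.\<close>
  obtain b c where bc: "br t v - v - b *\<^sub>C t - c *\<^sub>C u \<in> k"
  proof -
    define b where "b = - g (br v (br t v - v))"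
    have 1: "br t v - v \<in> m" using subspace_neg [OF sm s] unfolding s_def by simp
    have "br t v - v - b *\<^sub>C t \<in> M 1"
    proof (rule nM1)
      show "br t v - v - b *\<^sub>C t \<in> m" using 1 t by (metis subspace_diff subspace_scale sm)
      show "g (br v (br t v - v - b *\<^sub>C t)) = 0"
        using tv' unfolding b_def by (simp add: br_bilinear g.diff g.scale g.neg)
    qed
    then show thesis using u2 that unfolding k_def by blast
  qed
  define d1 where "d1 = br t v - v - b *\<^sub>C t - c *\<^sub>C u"
  define d2 where "d2 = br t u + u"
  have d: "d1 \<in> k" "d2 \<in> k" unfolding d1_def d2_def using bc tu by auto
  \<comment> \<open>Expanding \<open>[t, t] = 0\<close> with \<open>t = [v, u]\<close> puts
    \<open>b u\<close> into \<open>k\<close>, whence \<open>b = 0\<close>.\<close>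
  have "0 = br t (br v u)" using br_self t_def by simp
  also have "\<dots> = br (br t v) u + br v (br t u)" by (rule br_derivation)
  also have "\<dots> = (br d1 u + b *\<^sub>C d2 + br v d2) - b *\<^sub>C u"
    unfolding d1_def d2_def by (simp add: br_bilinear br_self scale_simps t_def)
  finally have "b *\<^sub>C u = br d1 u + b *\<^sub>C d2 + br v d2" by (simp add: algebra_simps)
  also have "\<dots> \<in> k"
    using d mk [OF um d(1)] br_swap [of d1 u] vk [OF d(2)] k_add k_diff k_scale by simp
  finally have bu: "b *\<^sub>C u \<in> k" .
  have b0: "b = 0"
  proof (rule ccontr)
    assume "b \<noteq> 0"
    then have "u = inverse b *\<^sub>C b *\<^sub>C u" by simp
    also have "\<dots> \<in> k" using bu by (rule k_scale)
    finally show False using uM2 unfolding k_def by blast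
  qed
  \<comment> \<open>Adding \<open>r u\<close> to \<open>v\<close> gives an eigenvector of
    \<open>t\<close> modulo \<open>k\<close>: the condition is \<open>c - r = r\<close>. Doubling
    \<open>u\<close> and \<open>t\<close> then produces the usual weights \<open>2\<close> and
    \<open>- 2\<close>, while \<open>br e f = H\<close> holds exactly.\<close>
  define r where "r = c / 2"
  have c: "c *\<^sub>C u = r *\<^sub>C u + r *\<^sub>C u"
    unfolding r_def by (simp flip: scale_left_distrib)
  define e where "e = v + r *\<^sub>C u"
  define f where "f = 2 *\<^sub>C u"
  define H where "H = 2 *\<^sub>C t"
  show thesis
  proof (rule that [of e f H k])
    show "e \<in> h" "f \<in> h" "H \<in> h"
      unfolding e_def f_def H_def using v um t mh
      by (auto intro!: subspace_add [OF sh] subspace_scale [OF sh])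
    show "k \<subseteq> h" using km mh by blast
    show "solv k" using solv_mono [OF m(2) km sk] mk km by blast
    have "u \<in> h" using um mh by blast
    then have "g u = 0" using um m(1) by blast
    then have "g e = 1" unfolding e_def using g(2) by (simp add: g.add g.scale)
    then show "e \<notin> k" using km m(1) by auto
    show "br e x \<in> k" "br f x \<in> k" "br H x \<in> k" if "x \<in> k" for x
      unfolding e_def f_def H_def
      using vk mk um t that k_add k_scale by (auto simp: br_bilinear)
    have "br H e - 2 *\<^sub>C e = 2 *\<^sub>C d1 + r *\<^sub>C d2 + r *\<^sub>C d2"
      unfolding e_def H_def d1_def d2_def b0 c scale_two
      by (simp add: br_bilinear scale_simps)
    then show "br H e - 2 *\<^sub>C e \<in> k" using d k_add k_scale by simp
    have "br H f + 2 *\<^sub>C f = 4 *\<^sub>C d2"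
      unfolding f_def H_def d2_def by (simp add: br_bilinear scale_simps)
    then show "br H f + 2 *\<^sub>C f \<in> k" using d k_scale by simp
    show "br e f = H" unfolding e_def f_def H_def t_def by (simp add: br_bilinear br_self)
  qed
qed

lemma nonsolvable_sl2_mod_solvable:
  assumes L: "subalg L" "fin_dim L" "\<not> solv L"
  obtains e f t k where "e \<in> L" "f \<in> L" "t \<in> L" "solv k" "k \<subseteq> L" "e \<notin> k"
    "\<And>x. x \<in> k \<Longrightarrow> br e x \<in> k" "\<And>x. x \<in> k \<Longrightarrow> br f x \<in> k" "\<And>x. x \<in> k \<Longrightarrow> br t x \<in> k"
    "br t e - 2 *\<^sub>C e \<in> k" "br t f + 2 *\<^sub>C f \<in> k" "br e f = t"
proof -
  obtain h where h: "subalg h" "\<not> solv h" "h \<subseteq> L"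
    and hmin: "\<And>S. subalg S \<Longrightarrow> \<not> solv S \<Longrightarrow> S \<subseteq> L \<Longrightarrow> dim h \<le> dim S"
    using ex_has_least_nat [of "\<lambda>S. subalg S \<and> \<not> solv S \<and> S \<subseteq> L" L dim] L by blast
  have fh: "fin_dim h" using fin_dim_subset L(2) h(3) by blast
  have sh: "subspace h" using h(1) unfolding subalg_def by blast
  have proper: "solv S" if "subalg S" "S \<subset> h" for S
  proof (rule ccontr)
    assume "\<not> solv S"
    then have "dim h \<le> dim S" using hmin [OF that(1)] that(2) h(3) by blast
    moreover have "dim S < dim h"
      using fin_dim_psubset_dim [OF fh that(2) _ sh] that(1) unfolding subalg_def by blast
    ultimately show False by simp
  qed
  have "{0} \<subset> h" using h(2) solv_zero subspace_0 [OF sh] by (metis empty_subsetI insert_subset psubsetI)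
  moreover have "subalg {0}" unfolding subalg_def by simp
  moreover have "\<forall>S. subalg S \<and> S \<subset> h \<longrightarrow> dim S < dim h"
    using fin_dim_psubset_dim [OF fh _ _ sh] unfolding subalg_def by meson
  ultimately obtain m where m: "subalg m" "m \<subset> h"
    and mmax: "\<And>S. subalg S \<Longrightarrow> S \<subset> h \<Longrightarrow> dim S \<le> dim m"
    using ex_has_greatest_nat [of "\<lambda>S. subalg S \<and> S \<subset> h" "{0}" dim "dim h"] by blast
  have solm: "solv m" using proper m by blast
  have sm: "subspace m" using solm by (rule solv_subspace)
  have mm: "br x y \<in> m" if "x \<in> m" "y \<in> m" for x y using m(1) that unfolding subalg_def by blast
  have "\<exists>v\<in>h - m. \<forall>x\<in>m. \<exists>l. br x v - l *\<^sub>C v \<in> m"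
  proof (rule Lie_theorem [OF solm _ fh sh sm m(2)])
    show "fin_dim m" using fin_dim_subset fh m(2) by blast
    show "br x v \<in> h" if "x \<in> m" "v \<in> h" for x v using that m(2) h(1) unfolding subalg_def by blast
  qed (rule mm)
  then obtain v where v: "v \<in> h" "v \<notin> m" "\<And>x. x \<in> m \<Longrightarrow> \<exists>l. br x v - l *\<^sub>C v \<in> m" by blast
  \<comment> \<open>The bracket of \<open>v\<close> with \<open>m\<close> stays in the line of
    \<open>v\<close> plus \<open>m\<close>, so \<open>h'\<close> is a subalgebra strictly above
    \<open>m\<close>; maximality of \<open>m\<close> forces it to be \<open>h\<close>.\<close>
  define h' where "h' = {c *\<^sub>C v + y | c y. y \<in> m}"
  have h'I: "c *\<^sub>C v + y \<in> h'" if "y \<in> m" for c y unfolding h'_def using that by blast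
  have sh': "subspace h'" unfolding h'_def by (rule subspace_line_sum [OF sm])
  have vh': "br x v \<in> h'" if "x \<in> m" for x
  proof -
    obtain l where "br x v - l *\<^sub>C v \<in> m" using v(3) [OF \<open>x \<in> m\<close>] by blast
    then show ?thesis using h'I [of "br x v - l *\<^sub>C v" l] by simp
  qed
  have "br x y \<in> h'" if "x \<in> h'" "y \<in> h'" for x y
  proof -
    obtain c d x' y' where x: "x = c *\<^sub>C v + x'" "y = d *\<^sub>C v + y'" "x' \<in> m" "y' \<in> m"
      using \<open>x \<in> h'\<close> \<open>y \<in> h'\<close> unfolding h'_def by blast
    have "br x y = d *\<^sub>C br x' v - c *\<^sub>C br y' v + (0 *\<^sub>C v + br x' y')"
      unfolding x using br_swap [of v y'] by (simp add: br_bilinear br_self scale_simps algebra_simps)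
    then show ?thesis
      using vh' x mm h'I [of "br x' y'" 0] subspace_add [OF sh'] subspace_diff [OF sh'] subspace_scale [OF sh']
      by simp
  qed
  then have subh': "subalg h'" unfolding subalg_def using sh' by blast
  have h'h: "h' \<subseteq> h"
    unfolding h'_def using v m(2) subspace_add [OF sh] subspace_scale [OF sh] by blast
  have "m \<subseteq> h'" using h'I [of _ 0] by auto
  moreover have "v \<in> h'" using h'I [of 0 1] subspace_0 [OF sm] by simp
  ultimately have "m \<subset> h'" using v by blast
  then have "dim m < dim h'"
    using fin_dim_psubset_dim [OF fin_dim_subset [OF fh h'h] _ sm sh'] by blast
  then have hh': "h = h'" using mmax [OF subh'] h'h by (metis leD psubsetI)
  obtain g where g: "Vector_Spaces.linear scale (*) g" "\<And>y. y \<in> m \<Longrightarrow> g y = 0" "g v = 1"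
    by (rule vanishing_functional [OF sm v(2)]) blast
  interpret g: Vector_Spaces.linear scale "(*)" g by fact
  have "m = {x \<in> h. g x = 0}"
  proof (intro subset_antisym subsetI)
    fix x assume "x \<in> {x \<in> h. g x = 0}"
    then obtain c y where x: "x = c *\<^sub>C v + y" "y \<in> m" "g x = 0" unfolding hh' h'_def by blast
    then have "c = 0" using g by (simp add: g.add g.scale)
    then show "x \<in> m" using x by simp
  qed (use g(2) m(2) in blast)
  then show thesis
  proof (rule codim_one_sl2 [OF h(1) fh h(2) v(1) g(1,3) _ solm])
    fix e f t k
    assume k: "e \<in> h" "f \<in> h" "t \<in> h" "solv k" "k \<subseteq> h" "e \<notin> k"
      and inv: "\<And>x. x \<in> k \<Longrightarrow> br e x \<in> k" "\<And>x. x \<in> k \<Longrightarrow> br f x \<in> k" "\<And>x. x \<in> k \<Longrightarrow> br t x \<in> k"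
      and sl2: "br t e - 2 *\<^sub>C e \<in> k" "br t f + 2 *\<^sub>C f \<in> k" "br e f = t"
    show thesis
      by (rule that [OF _ _ _ k(4) _ k(6) inv sl2]) (use k h(3) in blast)+
  qed
qed

end

section \<open>Modules over \<open>sl\<^sub>2\<close>\<close>

text \<open>The relations are asked on \<open>M\<close> only: the operators will be adjoint actions
  on a subalgebra, or compressions of such actions to a complement, whose relations may fail
  elsewhere.\<close>

locale sl2_module = complex_space +
  fixes E F H :: "'a \<Rightarrow> 'a" and M :: "'a set"
  assumes linear_E: "Vector_Spaces.linear scale scale E"
    and linear_F: "Vector_Spaces.linear scale scale F"
    and linear_H: "Vector_Spaces.linear scale scale H"
    and subspace_M: "subspace M" and fin_dim_M: "fin_dim M"
    and E_M: "x \<in> M \<Longrightarrow> E x \<in> M" and F_M: "x \<in> M \<Longrightarrow> F x \<in> M" and H_M: "x \<in> M \<Longrightarrow> H x \<in> M"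
    and HE: "x \<in> M \<Longrightarrow> H (E x) = E (H x) + 2 *\<^sub>C E x"
    and HF: "x \<in> M \<Longrightarrow> H (F x) = F (H x) - 2 *\<^sub>C F x"
    and EF: "x \<in> M \<Longrightarrow> E (F x) = F (E x) + H x"
begin

sublocale E: Vector_Spaces.linear scale scale E by (rule linear_E)
sublocale F: Vector_Spaces.linear scale scale F by (rule linear_F)
sublocale H: Vector_Spaces.linear scale scale H by (rule linear_H)

lemmas ops = E.add E.scale E.diff E.neg F.add F.scale F.diff F.neg H.add H.scale H.diff H.neg

text \<open>Eigenvectors for distinct eigenvalues are independent, so an infinite family of them
  exceeds the dimension of \<open>M\<close>. This terminates the ladders built with \<open>E\<close>
  and \<open>F\<close>.\<close>

lemma eigenvectors_finite:
  assumes u: "\<And>k::nat. u k \<in> M" "\<And>k. u k \<noteq> 0" "\<And>k. H (u k) = l k *\<^sub>C u k" and l: "inj l"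
  shows False
proof -
  have zero: "(\<Sum>k<n. c k *\<^sub>C u k) = 0 \<Longrightarrow> k < n \<Longrightarrow> c k = 0" for n k c
  proof (induction n arbitrary: c k)
    case (Suc n)
    \<comment> \<open>Applying \<open>H - l n\<close> removes the last term and multiplies the
      others by \<open>l k - l n\<close>.\<close>
    define d where "d = (\<lambda>k. c k * (l k - l n))"
    have "0 = H (\<Sum>k<Suc n. c k *\<^sub>C u k) - l n *\<^sub>C (\<Sum>k<Suc n. c k *\<^sub>C u k)"
      using Suc(2) by simp
    also have "\<dots> = (\<Sum>k<Suc n. d k *\<^sub>C u k)"
      unfolding H.sum scale_sum_right sum_subtractf [symmetric] d_def
      by (rule sum.cong) (simp_all add: ops u(3) scale_left_diff_distrib algebra_simps)
    also have "\<dots> = (\<Sum>k<n. d k *\<^sub>C u k)" by (simp add: d_def)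
    finally have "d k = 0" if "k < n" for k using Suc(1) [of d k] that by simp
    moreover have "l k \<noteq> l n" if "k < n" for k using l that by (metis injD less_irrefl)
    ultimately have ck: "c k = 0" if "k < n" for k using that unfolding d_def by auto
    then have "c n *\<^sub>C u n = 0" using Suc(2) by simp
    then have "c n = 0" using u(2) by simp
    then show ?case using ck Suc(3) less_Suc_eq by blast
  qed simp
  have inj: "inj u"
  proof (rule injI)
    fix i j assume ij: "u i = u j"
    then have "l i *\<^sub>C u i = l j *\<^sub>C u i" using u(3) by metis
    then have "l i = l j" using u(2) by simp
    then show "i = j" using l by (simp add: injD)
  qed
  define N where "N = Suc (dim M)"
  have "independent (u ` {..<N})"
  proof (rule independent_if_scalars_zero)
    fix f x assume f: "(\<Sum>x\<in>u ` {..<N}. f x *\<^sub>C x) = 0" and x: "x \<in> u ` {..<N}"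
    have "(\<Sum>k<N. f (u k) *\<^sub>C u k) = 0"
      using f inj by (subst (asm) sum.reindex) (auto simp: inj_on_def inj_def)
    then show "f x = 0" using zero [of "\<lambda>k. f (u k)"] x by auto
  qed simp
  moreover obtain B where B: "finite B" "span B = M" "card B = dim M"
    by (rule fin_dim_basis [OF fin_dim_M subspace_M])
  moreover have "u ` {..<N} \<subseteq> span B" using B(2) u(1) by blast
  ultimately have "card (u ` {..<N}) \<le> dim M" using independent_span_bound by metis
  moreover have "card (u ` {..<N}) = N" using inj by (simp add: card_image inj_on_subset)
  ultimately show False unfolding N_def by simp
qed

text \<open>Each \<open>E\<close> raises the weight by \<open>2\<close>, so the powers of
  \<open>E\<close> end at zero; the last nonzero vector is annihilated by \<open>E\<close>.\<close>

lemma highest_weight_vector: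
  assumes w: "w \<in> M" "w \<noteq> 0" "H w = l *\<^sub>C w"
  obtains v k where "v \<in> M" "v \<noteq> 0" "E v = 0" "H v = (l + 2 * of_nat k) *\<^sub>C v"
proof -
  define u where "u = (\<lambda>k. (E ^^ k) w)"
  have uS: "u (Suc k) = E (u k)" for k unfolding u_def by simp
  have uM: "u k \<in> M" for k by (induction k) (use w E_M in \<open>auto simp: u_def\<close>)
  have Hu: "H (u k) = (l + 2 * of_nat k) *\<^sub>C u k" for k
  proof (induction k)
    case 0 then show ?case using w by (simp add: u_def)
  next
    case (Suc k)
    have "H (u (Suc k)) = (l + 2 * of_nat k) *\<^sub>C u (Suc k) + 2 *\<^sub>C u (Suc k)"
      unfolding uS using HE [OF uM] Suc by (simp add: ops)
    then show ?case by (simp add: algebra_simps flip: scale_left_distrib)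
  qed
  have "\<exists>k. u k = 0"
  proof (rule ccontr)
    assume "\<nexists>k. u k = 0"
    then show False by (intro eigenvectors_finite [OF uM _ Hu]) (auto simp: inj_def)
  qed
  define n where "n = (LEAST k. u k = 0)"
  have n: "u n = 0" unfolding n_def using \<open>\<exists>k. u k = 0\<close> by (rule LeastI_ex)
  then have "n \<noteq> 0" using w by (metis u_def funpow_0)
  then obtain k where k: "n = Suc k" using not0_implies_Suc by blast
  then have "u k \<noteq> 0" using not_less_Least [of k "\<lambda>k. u k = 0"] n_def by simp
  then show thesis using that [of "u k" k] uM Hu n k uS by simp
qed

text \<open>Going down with \<open>F\<close>, one has
  \<open>E (F^(k+1) w) = (k + 1) (l - k) F^k w\<close>. At the first vanishing power of
  \<open>F\<close> the left-hand side is zero, which forces \<open>l = k\<close>.\<close>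

lemma highest_weight_natural:
  assumes w: "w \<in> M" "w \<noteq> 0" "E w = 0" "H w = l *\<^sub>C w"
  obtains n :: nat where "l = of_nat n"
proof -
  define u where "u = (\<lambda>k. (F ^^ k) w)"
  have uS: "u (Suc k) = F (u k)" for k unfolding u_def by simp
  have uM: "u k \<in> M" for k by (induction k) (use w F_M in \<open>auto simp: u_def\<close>)
  have Hu: "H (u k) = (l - 2 * of_nat k) *\<^sub>C u k" for k
  proof (induction k)
    case 0 then show ?case using w by (simp add: u_def)
  next
    case (Suc k)
    have "H (u (Suc k)) = (l - 2 * of_nat k) *\<^sub>C u (Suc k) - 2 *\<^sub>C u (Suc k)"
      unfolding uS using HF [OF uM] Suc by (simp add: ops)
    then show ?case by (simp add: algebra_simps flip: scale_left_diff_distrib)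
  qed
  have Eu: "E (u (Suc k)) = (of_nat (Suc k) * (l - of_nat k)) *\<^sub>C u k" for k
  proof (induction k)
    case 0 then show ?case unfolding uS using EF [OF w(1)] w by (simp add: u_def)
  next
    case (Suc k)
    have "E (u (Suc (Suc k))) = F (E (u (Suc k))) + H (u (Suc k))"
      unfolding uS [of "Suc k"] by (rule EF [OF uM])
    also have "\<dots> = (of_nat (Suc k) * (l - of_nat k) + (l - 2 * of_nat (Suc k))) *\<^sub>C u (Suc k)"
      unfolding Suc Hu by (simp add: ops uS scale_left_distrib)
    also have "of_nat (Suc k) * (l - of_nat k) + (l - 2 * of_nat (Suc k))
      = of_nat (Suc (Suc k)) * (l - of_nat (Suc k))" by (simp add: algebra_simps)
    finally show ?case .
  qed
  have "\<exists>k. u k = 0"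
  proof (rule ccontr)
    assume "\<nexists>k. u k = 0"
    then show False by (intro eigenvectors_finite [OF uM _ Hu]) (auto simp: inj_def)
  qed
  define n where "n = (LEAST k. u k = 0)"
  have n: "u n = 0" unfolding n_def using \<open>\<exists>k. u k = 0\<close> by (rule LeastI_ex)
  then have "n \<noteq> 0" using w by (metis u_def funpow_0)
  then obtain k where k: "n = Suc k" using not0_implies_Suc by blast
  then have "u k \<noteq> 0" using not_less_Least [of k "\<lambda>k. u k = 0"] n_def by simp
  then have "of_nat (Suc k) * (l - of_nat k) = 0" using Eu [of k] n k by simp
  then have "l = of_nat k" by (simp del: of_nat_Suc)
  then show thesis by (rule that)
qed

lemma weight_integral:
  assumes w: "w \<in> M" "w \<noteq> 0" "H w = l *\<^sub>C w"
  obtains z where "l = of_int z"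
proof -
  obtain v k where v: "v \<in> M" "v \<noteq> 0" "E v = 0" "H v = (l + 2 * of_nat k) *\<^sub>C v"
    by (rule highest_weight_vector [OF w])
  obtain n :: nat where "l + 2 * of_nat k = of_nat n"
    by (rule highest_weight_natural [OF v])
  then have "l = of_int (int n - 2 * int k)" by (simp add: algebra_simps)
  then show thesis by (rule that)
qed

text \<open>Twice the usual normalisation \<open>E F + F E + H^2 / 2\<close>, which keeps fractions
  away.\<close>

definition casimir :: "'a \<Rightarrow> 'a"
  where "casimir x = 2 *\<^sub>C (E (F x) + F (E x)) + H (H x)"

lemma linear_casimir: "Vector_Spaces.linear scale scale casimir"
  by (rule linear_endoI) (simp_all add: casimir_def ops scale_right_distrib mult.commute add_ac)

lemma casimir_M: "x \<in> M \<Longrightarrow> casimir x \<in> M"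
  unfolding casimir_def by (intro subspace_add [OF subspace_M] subspace_scale [OF subspace_M] E_M F_M H_M)

lemma casimir_E:
  assumes x: "x \<in> M" shows "casimir (E x) = E (casimir x)"
  unfolding casimir_def
  using HE [OF x] HE [OF H_M [OF x]] EF [OF x] EF [OF E_M [OF x]] HE [OF E_M [OF x]]
  by (simp add: ops scale_right_distrib scale_right_diff_distrib)

lemma casimir_F:
  assumes x: "x \<in> M" shows "casimir (F x) = F (casimir x)"
  unfolding casimir_def
  using HF [OF x] HF [OF H_M [OF x]] EF [OF x] EF [OF F_M [OF x]] HF [OF F_M [OF x]]
  by (simp add: ops scale_right_distrib scale_right_diff_distrib)

lemma casimir_H:
  assumes x: "x \<in> M" shows "casimir (H x) = H (casimir x)"
  unfolding casimir_def
  using HF [OF x] HE [OF x] HE [OF F_M [OF x]] HF [OF E_M [OF x]]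
  by (simp add: ops scale_right_distrib scale_right_diff_distrib)

end

locale irreducible_sl2_module = sl2_module +
  assumes nontrivial: "M \<noteq> {0}"
    and irreducible: "subspace N \<Longrightarrow> N \<subseteq> M \<Longrightarrow> (\<And>x. x \<in> N \<Longrightarrow> E x \<in> N) \<Longrightarrow> (\<And>x. x \<in> N \<Longrightarrow> F x \<in> N)
      \<Longrightarrow> (\<And>x. x \<in> N \<Longrightarrow> H x \<in> N) \<Longrightarrow> N = {0} \<or> N = M"
begin

lemma zero_psubset: "{0} \<subset> M"
  using nontrivial subspace_0 [OF subspace_M] by blast

text \<open>Schur's argument: the Casimir operator commutes with the action, so each of its
  eigenspaces is a submodule.\<close>

lemma casimir_scalar: obtains c where "\<And>x. x \<in> M \<Longrightarrow> casimir x = c *\<^sub>C x"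
proof -
  interpret C: Vector_Spaces.linear scale scale casimir by (rule linear_casimir)
  obtain v c where v: "v \<in> M" "v \<notin> {0}" "casimir v - c *\<^sub>C v \<in> {0}"
    by (rule relative_eigenvector [OF linear_casimir fin_dim_M subspace_M _ _ zero_psubset])
      (use casimir_M in auto)
  define N where "N = {x \<in> M. casimir x = c *\<^sub>C x}"
  have "subspace N"
    unfolding N_def subspace_def
    using subspace_0 [OF subspace_M] subspace_add [OF subspace_M] subspace_scale [OF subspace_M]
    by (auto simp: C.add C.scale scale_right_distrib mult.commute)
  moreover have "N \<subseteq> M" unfolding N_def by blast
  moreover have "E x \<in> N" "F x \<in> N" "H x \<in> N" if "x \<in> N" for x
    using that unfolding N_def by (auto simp: casimir_E casimir_F casimir_H E_M F_M H_M ops)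
  ultimately have "N = {0} \<or> N = M" by (intro irreducible)
  moreover have "v \<in> N" using v unfolding N_def by simp
  ultimately have "N = M" using v(2) by blast
  then show thesis using that unfolding N_def by blast
qed

text \<open>On a highest weight vector of weight \<open>n\<close> the Casimir operator is
  \<open>n (n + 2)\<close>, so \<open>n = 0\<close>. That vector is then invariant, and the
  invariants form a nonzero submodule.\<close>

lemma casimir_zero_trivial:
  assumes c: "\<And>x. x \<in> M \<Longrightarrow> casimir x = 0" and x: "x \<in> M"
  shows "E x = 0" "F x = 0" "H x = 0"
proof -
  obtain w l where w: "w \<in> M" "w \<notin> {0}" "H w - l *\<^sub>C w \<in> {0}"
    by (rule relative_eigenvector [OF linear_H fin_dim_M subspace_M _ _ zero_psubset])
      (use H_M in auto)
  then have "w \<noteq> 0" "H w = l *\<^sub>C w" by simp_all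
  from highest_weight_vector [OF w(1) this]
  obtain v k where v: "v \<in> M" "v \<noteq> 0" "E v = 0" "H v = (l + 2 * of_nat k) *\<^sub>C v" by blast
  obtain n :: nat where n: "l + 2 * of_nat k = of_nat n"
    by (rule highest_weight_natural [OF v])
  then have Hv: "H v = of_nat n *\<^sub>C v" using v by simp
  have "0 = casimir v" using c v by simp
  also have "\<dots> = 2 *\<^sub>C H v + H (H v)" unfolding casimir_def EF [OF v(1)] v(3) by simp
  also have "\<dots> = of_nat (2 * n + n * n) *\<^sub>C v" by (simp add: Hv ops scale_left_distrib)
  finally have "n = 0" using v(2) by (simp del: of_nat_add of_nat_mult add: scale_eq_0_iff)
  then have Hv: "H v = 0" using Hv by simp
  \<comment> \<open>Otherwise \<open>F v\<close> would be a highest weight vector of weight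
    \<open>- 2\<close>, which is not a natural number.\<close>
  have Fv: "F v = 0"
  proof (rule ccontr)
    assume "F v \<noteq> 0"
    moreover have "E (F v) = 0" using EF [OF v(1)] v(3) Hv by simp
    moreover have "H (F v) = (- 2) *\<^sub>C F v" using HF [OF v(1)] Hv by (simp add: scale_minus_left)
    ultimately obtain m :: nat where "- 2 = (of_nat m :: complex)"
      using highest_weight_natural [OF F_M [OF v(1)]] by blast
    then have "Re (- 2) = Re (of_nat m)" by simp
    then show False by simp
  qed
  define N where "N = {x \<in> M. E x = 0 \<and> F x = 0 \<and> H x = 0}"
  have "subspace N"
    unfolding N_def subspace_def
    using subspace_0 [OF subspace_M] subspace_add [OF subspace_M] subspace_scale [OF subspace_M]
    by (auto simp: ops)
  moreover have "N \<subseteq> M" unfolding N_def by blast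
  moreover have "E x \<in> N" "F x \<in> N" "H x \<in> N" if "x \<in> N" for x
    using that subspace_0 [OF subspace_M] unfolding N_def by auto
  ultimately have "N = {0} \<or> N = M" by (intro irreducible)
  moreover have "v \<in> N" using v Hv Fv unfolding N_def by simp
  ultimately have "N = M" using v(2) by blast
  then show "E x = 0" "F x = 0" "H x = 0" using x unfolding N_def by blast+
qed

text \<open>
  Vanishing of the second cohomology, in coordinates. The primitive is the one produced by the
  Casimir homotopy: \<open>x = - H p / c\<close> and \<open>y = - H q / c\<close> when the Casimir operator is \<open>c \<noteq> 0\<close>.
\<close>

lemma two_cocycle_primitive:
  assumes p: "p \<in> M" and q: "q \<in> M" and pq: "E q = F p"
  obtains x y where "x \<in> M" "y \<in> M" "p + H x - 2 *\<^sub>C x - E (E y - F x) = 0"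
    "q + H y + 2 *\<^sub>C y - F (E y - F x) = 0"
proof -
  obtain c where c: "\<And>x. x \<in> M \<Longrightarrow> casimir x = c *\<^sub>C x" using casimir_scalar by blast
  show thesis
  proof (cases "c = 0")
    \<comment> \<open>On the trivial module the two equations reduce to \<open>p = 2 x\<close> and
      \<open>q = - 2 y\<close>.\<close>
    case True
    then have triv: "E x = 0" "F x = 0" "H x = 0" if "x \<in> M" for x
      using casimir_zero_trivial that c by auto
    define x where "x = (1 / 2) *\<^sub>C p"
    define y where "y = (- 1 / 2) *\<^sub>C q"
    have xy: "x \<in> M" "y \<in> M" unfolding x_def y_def using p q subspace_scale [OF subspace_M] by blast+
    show thesis
      using that [OF xy] triv [OF xy(1)] triv [OF xy(2)]
      unfolding x_def y_def by (simp add: scale_minus_left)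
  next
    case False
    define r where "r = - 1 / c"
    define x where "x = r *\<^sub>C H p"
    define y where "y = r *\<^sub>C H q"
    have xy: "x \<in> M" "y \<in> M" unfolding x_def y_def using p q H_M subspace_scale [OF subspace_M] by blast+
    have rc: "r *\<^sub>C casimir z = - z" if "z \<in> M" for z
      using c [OF that] False unfolding r_def by (simp add: scale_minus_left)
    \<comment> \<open>The relations give \<open>E H q - F H p = - 4 F p\<close> once
      \<open>E q = F p\<close> is used.\<close>
    have Ey: "E y - F x = - (r *\<^sub>C 2 *\<^sub>C F p + r *\<^sub>C 2 *\<^sub>C F p)"
      using HE [OF q] HF [OF p] pq unfolding x_def y_def
      by (simp add: ops scale_right_diff_distrib scale_minus_left scale_right_distrib algebra_simps)
    have "H x - 2 *\<^sub>C x - E (E y - F x) = r *\<^sub>C casimir p"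
      unfolding Ey unfolding x_def casimir_def using EF [OF p] by (simp add: ops scale_simps)
    then have 1: "p + H x - 2 *\<^sub>C x - E (E y - F x) = 0" using rc [OF p] by (simp add: algebra_simps)
    have "H y + 2 *\<^sub>C y - F (E y - F x) = r *\<^sub>C casimir q"
      unfolding Ey unfolding y_def casimir_def using EF [OF q] pq by (simp add: ops scale_simps)
    then have "q + H y + 2 *\<^sub>C y - F (E y - F x) = 0" using rc [OF q] by (simp add: algebra_simps)
    then show thesis using that [OF xy 1] by blast
  qed
qed

end

section \<open>Lifting \<open>sl\<^sub>2\<close> through a solvable ideal\<close>

context complex_lie
begin

text \<open>As brackets within \<open>a\<close> fall into \<open>b\<close>, the elements
  \<open>e\<close>, \<open>f\<close>, \<open>t\<close> act on \<open>a\<close> modulo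
  \<open>b\<close> as a genuine sl2 triple although their relations hold only modulo
  \<open>a\<close>. The two defects form a 2-cocycle, whose primitive corrects \<open>e\<close> and
  \<open>f\<close>. The third element is always the bracket of the first two, so it follows the
  correction by itself.\<close>

lemma sl2_lift_step:
  assumes a: "subspace a" "fin_dim a" and b: "subspace b" "b \<subset> a"
    and ab: "\<And>x y. x \<in> a \<Longrightarrow> y \<in> a \<Longrightarrow> br x y \<in> b"
    and ea: "\<And>x. x \<in> a \<Longrightarrow> br e x \<in> a" and fa: "\<And>x. x \<in> a \<Longrightarrow> br f x \<in> a"
    and ta: "\<And>x. x \<in> a \<Longrightarrow> br t x \<in> a"
    and eb: "\<And>x. x \<in> b \<Longrightarrow> br e x \<in> b" and fb: "\<And>x. x \<in> b \<Longrightarrow> br f x \<in> b"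
    and tb: "\<And>x. x \<in> b \<Longrightarrow> br t x \<in> b"
    and irred: "\<And>c. subspace c \<Longrightarrow> b \<subseteq> c \<Longrightarrow> c \<subseteq> a \<Longrightarrow> (\<And>x. x \<in> c \<Longrightarrow> br e x \<in> c) \<Longrightarrow>
      (\<And>x. x \<in> c \<Longrightarrow> br f x \<in> c) \<Longrightarrow> (\<And>x. x \<in> c \<Longrightarrow> br t x \<in> c) \<Longrightarrow> c = b \<or> c = a"
    and te: "br t e - 2 *\<^sub>C e \<in> a" and tf: "br t f + 2 *\<^sub>C f \<in> a" and ef: "br e f = t"
  obtains x y where "x \<in> a" "y \<in> a" "br (br (e + x) (f + y)) (e + x) - 2 *\<^sub>C (e + x) \<in> b"
    "br (br (e + x) (f + y)) (f + y) + 2 *\<^sub>C (f + y) \<in> b"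
proof -
  obtain q where q: "Vector_Spaces.linear scale scale q" "\<And>x. x - q x \<in> b" "\<And>x. q x = 0 \<longleftrightarrow> x \<in> b"
    by (rule subspace_projection [OF b(1)]) blast
  interpret q: Vector_Spaces.linear scale scale q by (rule q(1))
  have qq: "q (q x) = q x" for x using q(2) [of x] q(3) [of "x - q x"] by (simp add: q.diff)
  have qa: "q x \<in> a" if "x \<in> a" for x
  proof -
    have "x - (x - q x) \<in> a" using that q(2) [of x] b(2) subspace_diff [OF a(1)] by blast
    then show ?thesis by simp
  qed
  \<comment> \<open>A complement of \<open>b\<close> in \<open>a\<close>, which carries the action
    on the quotient by compression with \<open>q\<close>.\<close>
  define M where "M = q ` a"
  define E where "E = (\<lambda>x. q (br e x))"
  define F where "F = (\<lambda>x. q (br f x))"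
  define H where "H = (\<lambda>x. q (br t x))"
  have Ma: "M \<subseteq> a" unfolding M_def using qa by blast
  have qM: "q x = x" if "x \<in> M" for x using that qq unfolding M_def by auto
  have q_br: "q (br z (q x)) = q (br z x)" if "\<And>x. x \<in> b \<Longrightarrow> br z x \<in> b" for z x
  proof -
    have "br z (x - q x) \<in> b" using q(2) that by blast
    then have "q (br z (x - q x)) = 0" using q(3) by blast
    then show ?thesis by (simp add: br_bilinear q.diff)
  qed
  have qe: "q (br e (q x)) = q (br e x)" and qf: "q (br f (q x)) = q (br f x)"
    and qt: "q (br t (q x)) = q (br t x)" for x
    by (rule q_br, erule eb fb tb)+
  define p where "p = br t e - 2 *\<^sub>C e"
  define r where "r = br t f + 2 *\<^sub>C f"
  have pr: "p \<in> a" "r \<in> a" unfolding p_def r_def using te tf by blast+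
  have te': "br t e = 2 *\<^sub>C e + p" and tf': "br t f = r - 2 *\<^sub>C f" unfolding p_def r_def by simp_all
  have q0: "q (br x y) = 0" if "x \<in> a" "y \<in> a" for x y using q(3) ab that by blast
  interpret irreducible_sl2_module scale E F H M
  proof (intro irreducible_sl2_module.intro sl2_module.intro sl2_module_axioms.intro
      irreducible_sl2_module_axioms.intro)
    show "complex_space scale" by unfold_locales
    show "Vector_Spaces.linear scale scale E" "Vector_Spaces.linear scale scale F"
      "Vector_Spaces.linear scale scale H"
      unfolding E_def F_def H_def by (rule linear_endoI; simp add: br_bilinear q.add q.scale)+
    show sM: "subspace M" unfolding M_def using q.subspace_image a(1) by blast
    show "fin_dim M" using fin_dim_subset [OF a(2) Ma] .
    show inv: "E x \<in> M" "F x \<in> M" "H x \<in> M" if "x \<in> M" for x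
      using that Ma ea fa ta unfolding E_def F_def H_def M_def by blast+
    fix x assume x: "x \<in> M"
    then have xa: "x \<in> a" using Ma by blast
    have "H (E x) = q (br t (br e x))" unfolding H_def E_def by (rule qt)
    also have "br t (br e x) = br (br t e) x + br e (br t x)" by (rule br_derivation)
    also have "q \<dots> = q (br e (br t x)) + 2 *\<^sub>C q (br e x) + q (br p x)"
      unfolding te' by (simp add: br_bilinear q.add q.scale)
    also have "\<dots> = E (H x) + 2 *\<^sub>C E x"
      unfolding H_def E_def qe using q0 [OF pr(1) xa] by simp
    finally show "H (E x) = E (H x) + 2 *\<^sub>C E x" .
    have "H (F x) = q (br t (br f x))" unfolding H_def F_def by (rule qt)
    also have "br t (br f x) = br (br t f) x + br f (br t x)" by (rule br_derivation)
    also have "q \<dots> = q (br f (br t x)) - 2 *\<^sub>C q (br f x) + q (br r x)"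
      unfolding tf' by (simp add: br_bilinear q.add q.diff q.scale)
    also have "\<dots> = F (H x) - 2 *\<^sub>C F x"
      unfolding H_def F_def qf using q0 [OF pr(2) xa] by simp
    finally show "H (F x) = F (H x) - 2 *\<^sub>C F x" .
    have "E (F x) = q (br e (br f x))" unfolding E_def F_def by (rule qe)
    also have "br e (br f x) = br (br e f) x + br f (br e x)" by (rule br_derivation)
    also have "q \<dots> = F (E x) + H x"
      unfolding ef E_def F_def H_def qf by (simp add: q.add)
    finally show "E (F x) = F (E x) + H x" .
  next
    obtain z where "z \<in> a" "z \<notin> b" using b(2) by blast
    then have "q z \<in> M" "q z \<noteq> 0" unfolding M_def using q(3) by auto
    then show "M \<noteq> {0}" by blast
  next
    fix N assume N: "subspace N" "N \<subseteq> M" and EN: "\<And>x. x \<in> N \<Longrightarrow> E x \<in> N"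
      and FN: "\<And>x. x \<in> N \<Longrightarrow> F x \<in> N" and HN: "\<And>x. x \<in> N \<Longrightarrow> H x \<in> N"
    define c where "c = {z \<in> a. q z \<in> N}"
    have sc: "subspace c"
      unfolding c_def subspace_def
      using subspace_0 [OF a(1)] subspace_add [OF a(1)] subspace_scale [OF a(1)]
        subspace_0 [OF N(1)] subspace_add [OF N(1)] subspace_scale [OF N(1)]
      by (auto simp: q.add q.scale)
    have "q x = 0" if "x \<in> b" for x using q(3) that by blast
    then have bc: "b \<subseteq> c" "c \<subseteq> a" unfolding c_def using b(2) subspace_0 [OF N(1)] by auto
    have "br e z \<in> c" if "z \<in> c" for z
      using EN [of "q z"] qe [of z] that ea unfolding c_def E_def by auto
    moreover have "br f z \<in> c" if "z \<in> c" for z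
      using FN [of "q z"] qf [of z] that fa unfolding c_def F_def by auto
    moreover have "br t z \<in> c" if "z \<in> c" for z
      using HN [of "q z"] qt [of z] that ta unfolding c_def H_def by auto
    ultimately have "c = b \<or> c = a" by (rule irred [OF sc bc])
    then show "N = {0} \<or> N = M"
    proof
      assume cb: "c = b"
      have "x = 0" if "x \<in> N" for x
      proof -
        have "q x = x" using qM N(2) that by blast
        moreover have "x \<in> c" unfolding c_def using that N(2) Ma calculation by auto
        ultimately show ?thesis using cb q(3) [of x] by metis
      qed
      then show ?thesis using subspace_0 [OF N(1)] by blast
    next
      assume "c = a"
      then show ?thesis unfolding c_def M_def using N(2) M_def by blast
    qed
  qed
  \<comment> \<open>The cocycle condition: it comes from the derivation rule for \<open>e\<close> on
    \<open>br t f\<close>, together with \<open>br t t = 0\<close>.\<close>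
  have "br e r = br (br e t) f + br t (br e f) + 2 *\<^sub>C t"
    unfolding r_def using br_derivation [of e t f] ef by (simp add: br_bilinear)
  also have "\<dots> = br f p"
    unfolding br_swap [of e t] te' ef unfolding br_bilinear br_self ef br_swap [of p f] by simp
  finally have "E (q r) = F (q p)" unfolding E_def F_def qe qf by simp
  moreover have "q p \<in> M" "q r \<in> M" using pr unfolding M_def by blast+
  ultimately obtain x y where xy: "x \<in> M" "y \<in> M"
    "q p + H x - 2 *\<^sub>C x - E (E y - F x) = 0" "q r + H y + 2 *\<^sub>C y - F (E y - F x) = 0"
    using two_cocycle_primitive by metis
  have xa: "x \<in> a" "y \<in> a" using xy Ma by blast+
  \<comment> \<open>The change of \<open>t\<close> caused by the corrections; its quadratic part
    \<open>br x y\<close> lies in \<open>b\<close>, which leaves a linear problem.\<close>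
  define s where "s = br e y - br f x + br x y"
  have s: "br (e + x) (f + y) = t + s"
    unfolding s_def using ef br_swap [of x f] by (simp add: br_bilinear)
  have "br x y \<in> a" using ab [OF xa] b(2) by blast
  then have sa: "s \<in> a"
    unfolding s_def by (intro subspace_add [OF a(1)] subspace_diff [OF a(1)] ea fa xa)
  have qs: "q s = E y - F x"
    unfolding s_def E_def F_def using q0 xa by (simp add: q.add q.diff)
  have "q (br (t + s) (e + x) - 2 *\<^sub>C (e + x))
    = q (p + br t x - 2 *\<^sub>C x - br e s + br s x)"
    using te' br_swap [of s e] by (simp add: br_bilinear scale_simps algebra_simps)
  also have "\<dots> = q p + H x - 2 *\<^sub>C x - E (q s)"
    unfolding E_def H_def qe using q0 [OF sa xa(1)] qM [OF xy(1)]
    by (simp add: q.add q.diff q.scale)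
  also have "\<dots> = 0" unfolding qs by (rule xy(3))
  finally have 1: "br (t + s) (e + x) - 2 *\<^sub>C (e + x) \<in> b" using q(3) by blast
  have "q (br (t + s) (f + y) + 2 *\<^sub>C (f + y))
    = q (r + br t y + 2 *\<^sub>C y - br f s + br s y)"
    unfolding r_def using br_swap [of s f] by (simp add: br_bilinear scale_simps algebra_simps)
  also have "\<dots> = q r + H y + 2 *\<^sub>C y - F (q s)"
    unfolding F_def H_def qf using q0 [OF sa xa(2)] qM [OF xy(2)]
    by (simp add: q.add q.diff q.scale)
  also have "\<dots> = 0" unfolding qs by (rule xy(4))
  finally have 2: "br (t + s) (f + y) + 2 *\<^sub>C (f + y) \<in> b" using q(3) by blast
  show thesis using that [OF xa] 1 2 unfolding s by blast
qed

lemma br_span_invariant: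
  assumes "\<And>x. x \<in> a \<Longrightarrow> br z x \<in> a" "u \<in> span {br x y | x y. x \<in> a \<and> y \<in> a}"
  shows "br z u \<in> span {br x y | x y. x \<in> a \<and> y \<in> a}"
proof -
  interpret ad: Vector_Spaces.linear scale scale "br z" by (rule linear_br)
  let ?S = "{br x y | x y. x \<in> a \<and> y \<in> a}"
  have "?S \<subseteq> {u. br z u \<in> span ?S}"
  proof safe
    fix x y assume xy: "x \<in> a" "y \<in> a"
    have "br (br z x) y \<in> span ?S" "br x (br z y) \<in> span ?S"
      using xy assms(1) by (blast intro: span_base)+
    then show "br z (br x y) \<in> span ?S" unfolding br_derivation [of z x y] by (rule span_add)
  qed
  then have "span ?S \<subseteq> {u. br z u \<in> span ?S}"
    by (rule span_minimal) (rule ad.subspace_linear_preimage [OF subspace_span])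
  then show ?thesis using assms(2) by blast
qed

text \<open>A Levi splitting for one triple. The ideal is exhausted in irreducible layers: the
  relations are corrected modulo an invariant subspace \<open>b\<close> with irreducible quotient,
  then \<open>b\<close> takes the place of \<open>a\<close>.\<close>

lemma sl2_lift:
  assumes "solv a" "fin_dim a"
    and "\<And>x. x \<in> a \<Longrightarrow> br e x \<in> a" "\<And>x. x \<in> a \<Longrightarrow> br f x \<in> a"
    and "br (br e f) e - 2 *\<^sub>C e \<in> a" "br (br e f) f + 2 *\<^sub>C f \<in> a"
  shows "\<exists>e' f'. e' - e \<in> a \<and> f' - f \<in> a \<and> br (br e' f') e' = 2 *\<^sub>C e' \<and> br (br e' f') f' = - 2 *\<^sub>C f'"
  using assms
proof (induction "dim a" arbitrary: a e f rule: less_induct)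
  case less
  have sa: "subspace a" using less(2) by (rule solv_subspace)
  show ?case
  proof (cases "a = {0}")
    case True
    have "br (br e f) e = 2 *\<^sub>C e" "br (br e f) f = - 2 *\<^sub>C f"
      using less(6,7) unfolding True scale_minus_left eq_neg_iff_add_eq_0 by simp_all
    then show ?thesis using True by (intro exI [of _ e] exI [of _ f]) simp
  next
    case False
    then obtain D where D: "subspace D" "D \<subset> a" "\<And>x y. x \<in> a \<Longrightarrow> y \<in> a \<Longrightarrow> br x y \<in> D"
      using solv_commutator_proper [OF less(2)] by metis
    define t where "t = br e f"
    have ta: "br t x \<in> a" if "x \<in> a" for x
    proof -
      have "br t x = br e (br f x) - br f (br e x)" unfolding t_def using br_derivation [of e f x] by simp
      then show ?thesis using less(4,5) that subspace_diff [OF sa] by simp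
    qed
    \<comment> \<open>The candidates include the span of the brackets of \<open>a\<close>, which is
      proper by solvability. A member of largest dimension leaves no invariant subspace strictly
      between itself and \<open>a\<close>.\<close>
    define P where "P = (\<lambda>b. subspace b \<and> b \<subset> a \<and> (\<forall>x\<in>a. \<forall>y\<in>a. br x y \<in> b)
      \<and> (\<forall>x\<in>b. br e x \<in> b) \<and> (\<forall>x\<in>b. br f x \<in> b) \<and> (\<forall>x\<in>b. br t x \<in> b))"
    define b0 where "b0 = span {br x y | x y. x \<in> a \<and> y \<in> a}"
    have "b0 \<subseteq> D" unfolding b0_def using D(3) by (intro span_minimal [OF _ D(1)]) blast
    moreover have "br x y \<in> b0" if "x \<in> a" "y \<in> a" for x y
      unfolding b0_def using that by (blast intro: span_base)
    ultimately have "P b0"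
      unfolding P_def using D(2) less(4,5) ta br_span_invariant
      unfolding b0_def by auto
    moreover have "\<forall>b. P b \<longrightarrow> dim b < dim a"
      unfolding P_def using fin_dim_psubset_dim [OF less(3) _ _ sa] by blast
    ultimately obtain b where b: "P b" and bmax: "\<forall>c. P c \<longrightarrow> dim c \<le> dim b"
      using ex_has_greatest_nat [of P b0 dim "dim a"] by blast
    have sb: "subspace b" "b \<subset> a" and ab: "\<And>x y. x \<in> a \<Longrightarrow> y \<in> a \<Longrightarrow> br x y \<in> b"
      and binv: "\<And>x. x \<in> b \<Longrightarrow> br e x \<in> b" "\<And>x. x \<in> b \<Longrightarrow> br f x \<in> b" "\<And>x. x \<in> b \<Longrightarrow> br t x \<in> b"
      using b unfolding P_def by blast+
    have irred: "c = b \<or> c = a"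
      if c: "subspace c" "b \<subseteq> c" "c \<subseteq> a" "\<And>x. x \<in> c \<Longrightarrow> br e x \<in> c" "\<And>x. x \<in> c \<Longrightarrow> br f x \<in> c"
        "\<And>x. x \<in> c \<Longrightarrow> br t x \<in> c" for c
    proof (cases "c = a")
      case False
      moreover have "\<forall>x\<in>a. \<forall>y\<in>a. br x y \<in> c" using ab c(2) by blast
      ultimately have "P c" unfolding P_def using c by (simp add: psubset_eq)
      then have "dim c \<le> dim b" using bmax by simp
      then have "b = c"
        by (rule fin_dim_subspace_eq [OF fin_dim_subset [OF less(3) c(3)] c(2) sb(1) c(1)])
      then show ?thesis by simp
    qed simp
    obtain x y where xy: "x \<in> a" "y \<in> a" "br (br (e + x) (f + y)) (e + x) - 2 *\<^sub>C (e + x) \<in> b"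
      "br (br (e + x) (f + y)) (f + y) + 2 *\<^sub>C (f + y) \<in> b"
      by (rule sl2_lift_step [OF sa less(3) sb ab less(4,5) ta binv irred
            less(6,7) [folded t_def] t_def [symmetric]])
    have "solv b" by (rule solv_mono [OF less(2) _ sb(1)]) (use sb(2) ab in blast)+
    moreover have "fin_dim b" using fin_dim_subset less(3) sb(2) by blast
    moreover have "dim b < dim a" by (rule fin_dim_psubset_dim [OF less(3) sb(2,1) sa])
    moreover have "br (e + x) z \<in> b" "br (f + y) z \<in> b" if "z \<in> b" for z
      using binv that ab xy(1,2) sb(2) subspace_add [OF sb(1)] by (auto simp: br_bilinear)
    ultimately obtain e' f' where ef: "e' - (e + x) \<in> b" "f' - (f + y) \<in> b"
      "br (br e' f') e' = 2 *\<^sub>C e'" "br (br e' f') f' = - 2 *\<^sub>C f'"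
      using less(1) [of b "e + x" "f + y"] xy(3,4) by blast
    have "e' - e = (e' - (e + x)) + x" "f' - f = (f' - (f + y)) + y" by simp_all
    then have "e' - e \<in> a" "f' - f \<in> a"
      using ef(1,2) sb(2) xy(1,2) subspace_add [OF sa] by (metis psubsetD)+
    then show ?thesis using ef(3,4) by blast
  qed
qed

theorem nonsolvable_contains_sl2:
  assumes L: "subalg L" "fin_dim L" "\<not> solv L"
  obtains e f t where "e \<in> L" "f \<in> L" "t \<in> L" "e \<noteq> 0" "br e f = t" "br t e = 2 *\<^sub>C e" "br t f = - 2 *\<^sub>C f"
proof (rule nonsolvable_sl2_mod_solvable [OF L])
  fix e f t k
  assume k: "e \<in> L" "f \<in> L" "t \<in> L" "solv k" "k \<subseteq> L" "e \<notin> k"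
    and inv: "\<And>x. x \<in> k \<Longrightarrow> br e x \<in> k" "\<And>x. x \<in> k \<Longrightarrow> br f x \<in> k" "\<And>x. x \<in> k \<Longrightarrow> br t x \<in> k"
    and sl2: "br t e - 2 *\<^sub>C e \<in> k" "br t f + 2 *\<^sub>C f \<in> k" "br e f = t"
  have sk: "subspace k" and sL: "subspace L" using k(4) solv_subspace L(1) unfolding subalg_def by blast+
  obtain e' f' where ef: "e' - e \<in> k" "f' - f \<in> k" "br (br e' f') e' = 2 *\<^sub>C e'" "br (br e' f') f' = - 2 *\<^sub>C f'"
    using sl2_lift [OF k(4) fin_dim_subset [OF L(2) k(5)] inv(1,2)] sl2 by blast
  have "e + (e' - e) \<in> L" "f + (f' - f) \<in> L" using k ef(1,2) subspace_add [OF sL] by blast+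
  then have L': "e' \<in> L" "f' \<in> L" by simp_all
  moreover have "br e' f' \<in> L" using L' L(1) unfolding subalg_def by blast
  moreover have "e' \<noteq> 0"
  proof
    assume "e' = 0"
    then have "- e \<in> k" using ef(1) by simp
    then show False using k(6) subspace_neg [OF sk, of "- e"] by simp
  qed
  ultimately show thesis using that ef(3,4) by blast
qed

end

section \<open>The trace form\<close>

context complex_lie
begin

definition trace_on :: "'a set \<Rightarrow> ('a \<Rightarrow> 'a) \<Rightarrow> complex"
  where "trace_on B T = (\<Sum>b\<in>B. representation B (T b) b)"

lemma trace_on_swap:
  assumes B: "finite B" "independent B" "span B = L" and B': "finite B'" "independent B'" "span B' = L"
    and S: "Vector_Spaces.linear scale scale S" "\<And>x. x \<in> L \<Longrightarrow> S x \<in> L"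
    and T: "Vector_Spaces.linear scale scale T" "\<And>x. x \<in> L \<Longrightarrow> T x \<in> L"
  shows "trace_on B (\<lambda>x. S (T x)) = trace_on B' (\<lambda>x. T (S x))"
proof -
  have expand: "trace_on B (\<lambda>x. S (T x)) = (\<Sum>b\<in>B. \<Sum>c\<in>B'. representation B' (T b) c * representation B (S c) b)"
    if B: "finite B" "independent B" "span B = L" and B': "finite B'" "independent B'" "span B' = L"
    and S: "Vector_Spaces.linear scale scale S" "\<And>x. x \<in> L \<Longrightarrow> S x \<in> L"
    and T: "Vector_Spaces.linear scale scale T" "\<And>x. x \<in> L \<Longrightarrow> T x \<in> L" for B B' S T
  proof -
    interpret S: Vector_Spaces.linear scale scale S by (rule S)
    have "representation B (S (T b)) b = (\<Sum>c\<in>B'. representation B' (T b) c * representation B (S c) b)"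
      if b: "b \<in> B" for b
    proof -
      have TL: "T b \<in> span B'" using T(2) b B(3) B'(3) span_base by blast
      have SL: "S c \<in> span B" if "c \<in> B'" for c using S(2) that B(3) B'(3) span_base by blast
      have "T b = (\<Sum>c\<in>B'. representation B' (T b) c *\<^sub>C c)"
        using sum_representation_eq [OF B'(2) TL B'(1) order_refl] by simp
      then have "S (T b) = (\<Sum>c\<in>B'. representation B' (T b) c *\<^sub>C S c)"
        by (metis (no_types, lifting) S.sum S.scale sum.cong)
      then have "representation B (S (T b)) b
          = representation B (\<Sum>c\<in>B'. representation B' (T b) c *\<^sub>C S c) b" by simp
      also have "\<dots> = (\<Sum>c\<in>B'. representation B (representation B' (T b) c *\<^sub>C S c) b)"
        using SL by (subst representation_sum [OF B(2)]) (auto intro: span_scale)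
      also have "\<dots> = (\<Sum>c\<in>B'. representation B' (T b) c * representation B (S c) b)"
        by (rule sum.cong) (use SL representation_scale [OF B(2)] in auto)
      finally show ?thesis .
    qed
    then show ?thesis unfolding trace_on_def by simp
  qed
  have "trace_on B (\<lambda>x. S (T x)) = (\<Sum>b\<in>B. \<Sum>c\<in>B'. representation B' (T b) c * representation B (S c) b)"
    by (rule expand [OF B B' S T])
  also have "\<dots> = (\<Sum>c\<in>B'. \<Sum>b\<in>B. representation B (S c) b * representation B' (T b) c)"
    by (subst sum.swap) (simp add: mult.commute)
  also have "\<dots> = trace_on B' (\<lambda>x. T (S x))" by (rule expand [OF B' B T S, symmetric])
  finally show ?thesis .
qed

lemma trace_on_add:
  assumes "independent B" "\<And>x. x \<in> span B \<Longrightarrow> S x \<in> span B" "\<And>x. x \<in> span B \<Longrightarrow> T x \<in> span B"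
  shows "trace_on B (\<lambda>x. S x + T x) = trace_on B S + trace_on B T"
    and "trace_on B (\<lambda>x. S x - T x) = trace_on B S - trace_on B T"
    and "trace_on B (\<lambda>x. c *\<^sub>C S x) = c * trace_on B S"
  using assms span_base unfolding trace_on_def
  by (simp_all add: representation_add representation_diff representation_scale sum.distrib
      sum_subtractf sum_distrib_left)

text \<open>The matrix is block triangular: \<open>T\<close> preserves the span of \<open>B\<close>
  and acts by \<open>l\<close> on the added direction.\<close>

lemma trace_on_insert:
  assumes B: "finite B" "independent B" "v \<notin> span B"
    and T: "\<And>x. x \<in> span B \<Longrightarrow> T x \<in> span B" "T v - l *\<^sub>C v \<in> span B"
  shows "trace_on (insert v B) T = trace_on B T + l"
proof -
  have ind: "independent (insert v B)" using B independent_insertI by blast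
  have vB: "v \<notin> B" using B(3) span_base by blast
  have ext: "representation (insert v B) x = representation B x" if "x \<in> span B" for x
    by (rule representation_extend [OF ind that]) blast
  have 1: "representation (insert v B) (T b) b = representation B (T b) b" if "b \<in> B" for b
    using ext T(1) span_base [OF that] by simp
  define z where "z = T v - l *\<^sub>C v"
  have z: "z \<in> span B" unfolding z_def by (rule T(2))
  have vs: "v \<in> span (insert v B)" "z \<in> span (insert v B)"
    using span_base z span_mono [of B "insert v B"] by blast+
  have Tv: "T v = l *\<^sub>C v + z" unfolding z_def by simp
  have "representation (insert v B) (T v) v
      = l * representation (insert v B) v v + representation (insert v B) z v"
    unfolding Tv using vs by (simp add: representation_add [OF ind] representation_scale [OF ind] span_scale)
  also have "representation (insert v B) v v = 1"
    using representation_basis [OF ind, of v] by simp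
  also have "representation (insert v B) z v = 0"
    unfolding ext [OF z] using representation_ne_zero vB by blast
  finally have "representation (insert v B) (T v) v = l" by simp
  then show ?thesis unfolding trace_on_def using B(1) vB 1 by simp
qed

text \<open>A flag invariant under \<open>br t\<close> makes the trace a sum of squares of
  eigenvalues. These are integers and the line of \<open>e\<close> contributes \<open>4\<close>, so
  the sum is at least \<open>4\<close>.\<close>

lemma sl2_trace_square_nonzero:
  assumes L: "subspace L" "fin_dim L" "\<And>x y. x \<in> L \<Longrightarrow> y \<in> L \<Longrightarrow> br x y \<in> L"
    and e: "e \<in> L" "f \<in> L" "t \<in> L" "e \<noteq> 0"
    and sl2: "br e f = t" "br t e = 2 *\<^sub>C e" "br t f = - 2 *\<^sub>C f"
    and B: "finite B" "independent B" "span B = L"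
  shows "trace_on B (\<lambda>x. br t (br t x)) \<noteq> 0"
proof -
  interpret S: sl2_module scale "br e" "br f" "br t" L
  proof (intro sl2_module.intro sl2_module_axioms.intro)
    show "complex_space scale" by unfold_locales
    fix x
    show "br t (br e x) = br e (br t x) + 2 *\<^sub>C br e x"
      using br_derivation [of t e x] sl2 by (simp add: br_bilinear)
    show "br t (br f x) = br f (br t x) - 2 *\<^sub>C br f x"
      using br_derivation [of t f x] sl2 by (simp add: br_bilinear scale_minus_left)
    show "br e (br f x) = br f (br e x) + br t x"
      using br_derivation [of e f x] sl2 by simp
  qed (use L e linear_br in auto)
  \<comment> \<open>A relative eigenvalue modulo \<open>b\<close> is an eigenvalue on
    \<open>L\<close>: either \<open>T\<close> has a kernel in \<open>b\<close>, or it is onto there,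
    and then subtracting from \<open>v\<close> a preimage of \<open>T v\<close> gives a true
    eigenvector.\<close>
  have integral: "\<exists>z. l = of_int z"
    if b: "subspace b" "b \<subseteq> L" "\<And>x. x \<in> b \<Longrightarrow> br t x \<in> b" and v: "v \<in> L" "v \<notin> b" "br t v - l *\<^sub>C v \<in> b" for b v l
  proof -
    define T where "T = (\<lambda>x. br t x - l *\<^sub>C x)"
    have T: "Vector_Spaces.linear scale scale T"
      by (rule linear_endoI) (simp_all add: T_def br_bilinear scale_simps mult.commute)
    interpret T: Vector_Spaces.linear scale scale T by (rule T)
    have "\<exists>w\<in>L. w \<noteq> 0 \<and> T w = 0"
    proof (cases "\<exists>w\<in>b. w \<noteq> 0 \<and> T w = 0")
      case False
      have Tb: "T ` b \<subseteq> b" unfolding T_def using b subspace_diff [OF b(1)] subspace_scale [OF b(1)] by auto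
      have Tv: "T v \<in> b" unfolding T_def by (rule v(3))
      obtain y where y: "y \<in> b" "T v - T y \<in> {0}"
        by (rule inj_mod_imp_surj_mod [OF T fin_dim_subset [OF L(2) b(2)] b(1) Tb _ _ _ _ Tv, of "{0}"])
          (use subspace_0 [OF b(1)] False T.zero in auto)
      have "v - y \<in> L" using v(1) y(1) b(2) subspace_diff [OF L(1)] by blast
      moreover have "v - y \<noteq> 0" using y(1) v(2) by auto
      moreover have "T (v - y) = 0" using y(2) by (simp add: T.diff)
      ultimately show ?thesis by blast
    qed (use b(2) in blast)
    then obtain w where "w \<in> L" "w \<noteq> 0" "br t w = l *\<^sub>C w" unfolding T_def by auto
    from S.weight_integral [OF this] show ?thesis by metis
  qed
  define T where "T = (\<lambda>x. br t (br t x))"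
  have T: "Vector_Spaces.linear scale scale T"
    unfolding T_def by (rule linear_endoI) (simp_all add: br_bilinear)
  \<comment> \<open>An invariant subspace is enlarged by one relative eigenvector at a time. The
    trace grows by the square of an integer, so the bound \<open>4\<close> persists.\<close>
  have flag: "\<exists>B'. finite B' \<and> independent B' \<and> span B' = L \<and> (\<exists>r\<ge>4. trace_on B' T = of_real r)"
    if "finite C" "independent C" "span C \<subseteq> L" "\<And>x. x \<in> span C \<Longrightarrow> br t x \<in> span C"
      "r \<ge> 4" "trace_on C T = of_real r" for C r
    using that
  proof (induction "dim L - dim (span C)" arbitrary: C r rule: less_induct)
    case less
    show ?case
    proof (cases "span C = L")
      case True
      then show ?thesis using less by blast
    next
      case False
      then have CL: "span C \<subset> L" using less by blast
      obtain v l where v: "v \<in> L" "v \<notin> span C" "br t v - l *\<^sub>C v \<in> span C"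
        by (rule relative_eigenvector [OF linear_br L(2,1) _ subspace_span CL, of t]) (use L(3) e in blast)+
      obtain z where z: "l = of_int z"
        using integral [OF subspace_span less(4) less(5) v] by blast
      define C' where "C' = insert v C"
      have vC: "v \<in> span C'" "span C \<subseteq> span C'" unfolding C'_def by (auto intro: span_base span_mono [THEN subsetD])
      have C'L: "span C' \<subseteq> L"
        unfolding C'_def using v(1) less(4) span_superset [of C] by (intro span_minimal L(1)) blast
      have C'inv: "br t x \<in> span C'" if "x \<in> span C'" for x
      proof -
        have "C' \<subseteq> {x. br t x \<in> span C'}"
        proof
          fix x assume "x \<in> C'"
          then consider "x = v" | "x \<in> C" unfolding C'_def by blast
          then have "br t x \<in> span C'"
          proof cases
            case 1
            have "(br t v - l *\<^sub>C v) + l *\<^sub>C v \<in> span C'"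
              using v(3) vC by (intro span_add span_scale) auto
            then show ?thesis using 1 by simp
          next
            case 2
            then show ?thesis using less(5) [OF span_base [OF 2]] vC by blast
          qed
          then show "x \<in> {x. br t x \<in> span C'}" by simp
        qed
        then have "span C' \<subseteq> {x. br t x \<in> span C'}"
          by (rule span_minimal) (rule S.H.subspace_linear_preimage [OF subspace_span])
        then show ?thesis using that by blast
      qed
      have "T v - (l * l) *\<^sub>C v = br t (br t v - l *\<^sub>C v) + l *\<^sub>C (br t v - l *\<^sub>C v)"
        unfolding T_def by (simp add: br_bilinear scale_simps)
      also have "\<dots> \<in> span C" using less(5) v(3) by (intro span_add span_scale)
      finally have "trace_on C' T = trace_on C T + l * l"
        unfolding C'_def using less(5) by (intro trace_on_insert less v) (simp_all add: T_def)
      also have "\<dots> = of_real (r + of_int (z * z))" unfolding less(7) z by simp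
      finally have tr: "trace_on C' T = of_real (r + of_int (z * z))" .
      have "4 \<le> r + of_int (z * z)" using less(6) by (simp add: add_increasing2)
      moreover have "dim L - dim (span C') < dim L - dim (span C)"
      proof -
        have "span C \<subset> span C'" using v vC by blast
        then have "dim (span C) < dim (span C')"
          by (rule fin_dim_psubset_dim [OF fin_dim_subset [OF L(2) C'L] _ subspace_span subspace_span])
        moreover have "dim (span C') \<le> dim L" by (rule fin_dim_dim_mono [OF L(2) C'L subspace_span L(1)])
        ultimately show ?thesis by simp
      qed
      moreover have "finite C'" "independent C'"
        unfolding C'_def using less v independent_insertI by auto
      ultimately show ?thesis using less(1) [OF _ _ _ C'L C'inv _ tr] by blast
    qed
  qed
  have "trace_on {e} T = trace_on {} T + 4"
  proof (rule trace_on_insert)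
    show "T e - 4 *\<^sub>C e \<in> span {}" unfolding T_def using sl2 by (simp add: br_bilinear)
  qed (use e T_def independent_empty in auto)
  then have tr: "trace_on {e} T = of_real 4" by (simp add: trace_on_def)
  have "br t x \<in> span {e}" if "x \<in> span {e}" for x
    using that sl2 by (auto simp: span_singleton br_bilinear)
  moreover have "span {e} \<subseteq> L" using e L(1) by (intro span_minimal) auto
  ultimately obtain B' r where B': "finite B'" "independent B'" "span B' = L" "r \<ge> 4" "trace_on B' T = of_real r"
    using flag [OF _ _ _ _ _ tr] e by (metis dependent_single finite.emptyI finite_insert order_refl)
  have "trace_on B T = trace_on B' T"
    unfolding T_def using trace_on_swap [OF B B'(1-3) linear_br _ linear_br] L(3) e by blast
  then show ?thesis using B'(4,5) T_def by auto
qed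

text \<open>For a basis \<open>B\<close> of a subalgebra this is its Killing form.\<close>

definition trace_form :: "'a set \<Rightarrow> 'a \<Rightarrow> 'a \<Rightarrow> complex"
  where "trace_form B x y = trace_on B (\<lambda>z. br x (br y z))"

lemma trace_form_exact_imp_solv:
  assumes L: "subspace L" "fin_dim L" "\<And>x y. x \<in> L \<Longrightarrow> y \<in> L \<Longrightarrow> br x y \<in> L"
    and B: "finite B" "independent B" "span B = L"
    and a: "\<And>x y. x \<in> L \<Longrightarrow> y \<in> L \<Longrightarrow> \<alpha> x y = - \<alpha> y x"
      "\<And>x y. x \<in> L \<Longrightarrow> y \<in> L \<Longrightarrow> \<alpha> (2 *\<^sub>C x) y = 2 * \<alpha> x y"
      "\<And>x y. x \<in> L \<Longrightarrow> y \<in> L \<Longrightarrow> \<alpha> (- x) y = - \<alpha> x y"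
      "\<And>x y z. x \<in> L \<Longrightarrow> y \<in> L \<Longrightarrow> z \<in> L \<Longrightarrow>
        trace_form B (br x y) z = - \<alpha> (br x y) z + \<alpha> (br x z) y - \<alpha> (br y z) x"
  shows "solv L"
proof (rule ccontr)
  assume "\<not> solv L"
  moreover have "subalg L" unfolding subalg_def using L by blast
  ultimately obtain e f t where e: "e \<in> L" "f \<in> L" "t \<in> L" "e \<noteq> 0" and
    sl2: "br e f = t" "br t e = 2 *\<^sub>C e" "br t f = - 2 *\<^sub>C f"
    using nonsolvable_contains_sl2 [OF _ L(2)] by metis
  \<comment> \<open>With these brackets the right-hand side at \<open>(e, f, t)\<close> is
    \<open>- \<alpha> t t - 2 \<alpha> e f - 2 \<alpha> f e\<close>, which vanishes by
    skew-symmetry.\<close>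
  have "br e t = - (2 *\<^sub>C e)" using br_swap [of e t] sl2 by simp
  moreover have "br f t = 2 *\<^sub>C f" using br_swap [of f t] sl2 by (simp add: scale_minus_left)
  moreover have "\<alpha> t t = 0" using a(1) [OF e(3,3)] by simp
  moreover have "2 *\<^sub>C e \<in> L" using e subspace_scale [OF L(1)] by blast
  ultimately have "trace_form B t t = 0"
    using a(4) [OF e(1-3)] a(1) [OF e(1,2)] e sl2 by (simp add: a(2,3))
  then show False
    using sl2_trace_square_nonzero [OF L e sl2 B] unfolding trace_form_def by simp
qed

lemma
  assumes B: "finite B" "independent B" "\<And>x y. br x y \<in> span B"
  shows trace_form_add: "trace_form B (x + y) z = trace_form B x z + trace_form B y z"
    and trace_form_scale: "trace_form B (c *\<^sub>C x) z = c * trace_form B x z"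
    and trace_form_sym: "trace_form B x z = trace_form B z x"
    and trace_form_invariant: "trace_form B (br x y) z = trace_form B x (br y z)"
proof -
  show "trace_form B (x + y) z = trace_form B x z + trace_form B y z"
    "trace_form B (c *\<^sub>C x) z = c * trace_form B x z"
    unfolding trace_form_def br_bilinear using B(2,3) by (intro trace_on_add; simp)+
  show "trace_form B x z = trace_form B z x"
    unfolding trace_form_def by (rule trace_on_swap [OF B(1,2) refl B(1,2) refl linear_br B(3) linear_br B(3)])
  \<comment> \<open>After expansion the two sides differ only in the traces of \<open>y x z\<close>
    and of \<open>x z y\<close>, which agree by cyclicity.\<close>
  have 1: "br (br x y) (br z w) = br x (br y (br z w)) - br y (br x (br z w))" for w
    using br_derivation [of x y "br z w"] by simp
  have 2: "br x (br (br y z) w) = br x (br y (br z w)) - br x (br z (br y w))" for w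
    using br_derivation [of y z w] by (simp add: br_bilinear)
  have lin: "Vector_Spaces.linear scale scale (\<lambda>w. br x (br z w))"
    by (rule linear_endoI) (simp_all add: br_bilinear)
  have "trace_on B (\<lambda>w. br y (br x (br z w))) = trace_on B (\<lambda>w. br x (br z (br y w)))"
    by (rule trace_on_swap [OF B(1,2) refl B(1,2) refl linear_br B(3) lin B(3)])
  then show "trace_form B (br x y) z = trace_form B x (br y z)"
    unfolding trace_form_def 1 2 using B(2,3) by (simp add: trace_on_add(2))
qed

end

section \<open>Forms on a real Lie algebra and complexification\<close>

text \<open>Linearity is asked in the first slot only and passes to the other by skew-symmetry,
  which over the reals amounts to vanishing on equal arguments.\<close>

definition alt2 :: "'a::real_vector set \<Rightarrow> ('a \<Rightarrow> 'a \<Rightarrow> real) \<Rightarrow> bool"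
  where "alt2 g \<alpha> \<longleftrightarrow>
      (\<forall>x\<in>g. \<forall>y\<in>g. \<forall>z\<in>g. \<alpha> (x + y) z = \<alpha> x z + \<alpha> y z)
    \<and> (\<forall>c. \<forall>x\<in>g. \<forall>y\<in>g. \<alpha> (c *\<^sub>R x) y = c * \<alpha> x y)
    \<and> (\<forall>x\<in>g. \<forall>y\<in>g. \<alpha> y x = - \<alpha> x y)"

definition alt3 :: "'a::real_vector set \<Rightarrow> ('a \<Rightarrow> 'a \<Rightarrow> 'a \<Rightarrow> real) \<Rightarrow> bool"
  where "alt3 g \<phi> \<longleftrightarrow>
      (\<forall>x\<in>g. \<forall>y\<in>g. \<forall>z\<in>g. \<forall>w\<in>g. \<phi> (x + y) z w = \<phi> x z w + \<phi> y z w)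
    \<and> (\<forall>c. \<forall>x\<in>g. \<forall>y\<in>g. \<forall>z\<in>g. \<phi> (c *\<^sub>R x) y z = c * \<phi> x y z)
    \<and> (\<forall>x\<in>g. \<forall>y\<in>g. \<forall>z\<in>g. \<phi> y x z = - \<phi> x y z)
    \<and> (\<forall>x\<in>g. \<forall>y\<in>g. \<forall>z\<in>g. \<phi> x z y = - \<phi> x y z)"

text \<open>The differential \<open>ce_d\<close> for curried forms: the pair of slots
  \<open>i < j\<close>, counted from \<open>0\<close>, carries the sign
  \<open>(- 1) ^ (i + j)\<close>.\<close>

definition d2 :: "('a \<Rightarrow> 'a \<Rightarrow> 'a) \<Rightarrow> ('a \<Rightarrow> 'a \<Rightarrow> real) \<Rightarrow> 'a \<Rightarrow> 'a \<Rightarrow> 'a \<Rightarrow> real"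
  where "d2 br \<alpha> x y z = - \<alpha> (br x y) z + \<alpha> (br x z) y - \<alpha> (br y z) x"

definition d3 :: "('a \<Rightarrow> 'a \<Rightarrow> 'a) \<Rightarrow> ('a \<Rightarrow> 'a \<Rightarrow> 'a \<Rightarrow> real) \<Rightarrow> 'a \<Rightarrow> 'a \<Rightarrow> 'a \<Rightarrow> 'a \<Rightarrow> real"
  where "d3 br \<phi> x y z w = - \<phi> (br x y) z w + \<phi> (br x z) y w - \<phi> (br x w) y z
    - \<phi> (br y z) x w + \<phi> (br y w) x z - \<phi> (br z w) x y"

definition closed3 :: "'a set \<Rightarrow> ('a \<Rightarrow> 'a \<Rightarrow> 'a) \<Rightarrow> ('a \<Rightarrow> 'a \<Rightarrow> 'a \<Rightarrow> real) \<Rightarrow> bool"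
  where "closed3 g br \<phi> \<longleftrightarrow> (\<forall>x\<in>g. \<forall>y\<in>g. \<forall>z\<in>g. \<forall>w\<in>g. d3 br \<phi> x y z w = 0)"

definition exact3 :: "'a::real_vector set \<Rightarrow> ('a \<Rightarrow> 'a \<Rightarrow> 'a) \<Rightarrow> ('a \<Rightarrow> 'a \<Rightarrow> 'a \<Rightarrow> real) \<Rightarrow> bool"
  where "exact3 g br \<phi> \<longleftrightarrow> (\<exists>\<alpha>. alt2 g \<alpha> \<and> (\<forall>x\<in>g. \<forall>y\<in>g. \<forall>z\<in>g. \<phi> x y z = d2 br \<alpha> x y z))"

definition H3_zero :: "'a::real_vector set \<Rightarrow> ('a \<Rightarrow> 'a \<Rightarrow> 'a) \<Rightarrow> bool"
  where "H3_zero g br \<longleftrightarrow> (\<forall>\<phi>. alt3 g \<phi> \<and> closed3 g br \<phi> \<longrightarrow> exact3 g br \<phi>)"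

lemma
  assumes "alt2 g \<alpha>" "x \<in> g" "y \<in> g"
  shows alt2_add: "z \<in> g \<Longrightarrow> \<alpha> (x + z) y = \<alpha> x y + \<alpha> z y"
    and alt2_scale: "\<alpha> (c *\<^sub>R x) y = c * \<alpha> x y"
    and alt2_swap: "\<alpha> y x = - \<alpha> x y"
  using assms unfolding alt2_def by blast+

lemma
  assumes "alt3 g \<phi>" "x \<in> g" "y \<in> g" "z \<in> g"
  shows alt3_add: "w \<in> g \<Longrightarrow> \<phi> (x + w) y z = \<phi> x y z + \<phi> w y z"
    and alt3_scale: "\<phi> (c *\<^sub>R x) y z = c * \<phi> x y z"
    and alt3_swap12: "\<phi> y x z = - \<phi> x y z"
    and alt3_swap23: "\<phi> x z y = - \<phi> x y z"
  using assms unfolding alt3_def by blast+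

text \<open>
  Composing with a projection onto \<open>g\<close> makes any bracket on \<open>g\<close> total, so that the Lie identities hold
  without membership conditions.
\<close>

locale real_lie = L: field_lie "scaleR :: real \<Rightarrow> 'a \<Rightarrow> 'a" br
  for br :: "'a::real_vector \<Rightarrow> 'a \<Rightarrow> 'a" +
  fixes g :: "'a set"
  assumes subspace_g: "subspace g" and finite_dim_g: "finite_dimensional g"
    and br_in_g: "br x y \<in> g"
begin

lemmas br_bilinear = L.br_bilinear

text \<open>The Cartan 3-form of an invariant symmetric form. Shifting all brackets to the second
  argument of \<open>k\<close> leaves \<open>- 2 k x J\<close>, where \<open>J\<close> is the Jacobi
  sum of the other three vectors.\<close>

lemma invariant_form_cocycle:
  fixes k :: "'a \<Rightarrow> 'a \<Rightarrow> real"
  assumes k: "\<And>x y z. k (x + y) z = k x z + k y z" "\<And>c x y. k (c *\<^sub>R x) y = c * k x y"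
    "\<And>x y. k x y = k y x" "\<And>x y z. k (br x y) z = k x (br y z)"
  shows "alt3 g (\<lambda>x y z. k (br x y) z)" "closed3 g br (\<lambda>x y z. k (br x y) z)"
proof -
  have neg: "k (- x) y = - k x y" "k y (- x) = - k y x" for x y
    using k(2) [of "- 1" x y] k(3) by simp_all
  have add_right: "k x (y + z) = k x y + k x z" for x y z using k(1,3) by metis
  have diff_right: "k x (y - z) = k x y - k x z" for x y z using add_right [of x y "- z"] neg by simp
  have zero: "k x 0 = 0" for x using k(2) [of 0 0 x] k(3) by simp
  show "alt3 g (\<lambda>x y z. k (br x y) z)"
    unfolding alt3_def
  proof (intro conjI ballI allI)
    fix x y z
    show "k (br y x) z = - k (br x y) z" using L.br_swap [of y x] by (simp add: neg)
    show "k (br x z) y = - k (br x y) z"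
      unfolding k(4) using L.br_swap [of z y] by (simp add: neg)
  qed (simp_all add: br_bilinear k(1,2))
  show "closed3 g br (\<lambda>x y z. k (br x y) z)"
    unfolding closed3_def
  proof (intro ballI)
    fix x y z w
    have "k (br (br x y) z) w = k x (br y (br z w))" "k (br (br x z) y) w = k x (br z (br y w))"
      "k (br (br x w) y) z = k x (br w (br y z))" by (simp_all add: k(4))
    moreover have "k (br (br y z) x) w = k x (br w (br y z))" "k (br (br y w) x) z = k x (br z (br y w))"
      "k (br (br z w) x) y = k x (br y (br z w))"
      by (metis k(3,4))+
    moreover have "k x (br y (br z w) + br z (br w y) + br w (br y z)) = 0"
      unfolding L.br_jacobi by (rule zero)
    moreover have "br z (br w y) = - br z (br y w)"
      using L.br_swap [of w y] by (simp add: br_bilinear)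
    ultimately show "d3 br (\<lambda>x y z. k (br x y) z) x y z w = 0"
      unfolding d3_def by (simp add: add_right diff_right neg)
  qed
qed

text \<open>A pair \<open>(x, x')\<close> stands for \<open>x + i x'\<close>, so the
  complexification of \<open>g\<close> is \<open>g \<times> g\<close>.\<close>

definition cscale :: "complex \<Rightarrow> 'a \<times> 'a \<Rightarrow> 'a \<times> 'a"
  where "cscale c X = (Re c *\<^sub>R fst X - Im c *\<^sub>R snd X, Re c *\<^sub>R snd X + Im c *\<^sub>R fst X)"

definition cbr :: "'a \<times> 'a \<Rightarrow> 'a \<times> 'a \<Rightarrow> 'a \<times> 'a"
  where "cbr X Y = (br (fst X) (fst Y) - br (snd X) (snd Y), br (fst X) (snd Y) + br (snd X) (fst Y))"

sublocale C: complex_lie cscale cbr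
proof unfold_locales
  fix a b :: complex and X Y Z :: "'a \<times> 'a"
  show "cscale a (X + Y) = cscale a X + cscale a Y"
    "cscale (a + b) X = cscale a X + cscale b X"
    "cscale a (cscale b X) = cscale (a * b) X"
    "cscale 1 X = X"
    by (simp_all add: cscale_def prod_eq_iff algebra_simps)
  show "cbr (X + Y) Z = cbr X Z + cbr Y Z" "cbr X (Y + Z) = cbr X Y + cbr X Z"
    "cbr (cscale a X) Y = cscale a (cbr X Y)" "cbr X (cscale a Y) = cscale a (cbr X Y)"
    by (simp_all add: cbr_def cscale_def prod_eq_iff br_bilinear algebra_simps)
  show "cbr X X = 0"
    using L.br_swap [of "fst X" "snd X"] by (simp add: cbr_def prod_eq_iff L.br_self)
  obtain x x' y y' z z' where X: "X = (x, x')" "Y = (y, y')" "Z = (z, z')" by (metis surj_pair)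
  define J where "J = (\<lambda>a b c. br a (br b c) + br b (br c a) + br c (br a b))"
  have "cbr X (cbr Y Z) + cbr Y (cbr Z X) + cbr Z (cbr X Y)
    = (J x y z - J x y' z' - J x' y z' - J x' y' z, J x' y z + J x y' z + J x y z' - J x' y' z')"
    unfolding X cbr_def J_def by (simp add: br_bilinear algebra_simps)
  also have "\<dots> = 0" unfolding J_def L.br_jacobi by (simp add: zero_prod_def)
  finally show "cbr X (cbr Y Z) + cbr Y (cbr Z X) + cbr Z (cbr X Y) = 0" .
qed

lemma subspace_real_part:
  assumes S: "C.subspace S" shows "subspace {x. (x, 0) \<in> S}"
proof (rule subspaceI)
  show "0 \<in> {x. (x, 0) \<in> S}" using C.subspace_0 [OF S] by (simp add: zero_prod_def)
  show "x + y \<in> {x. (x, 0) \<in> S}" if "x \<in> {x. (x, 0) \<in> S}" "y \<in> {x. (x, 0) \<in> S}" for x y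
    using C.subspace_add [OF S, of "(x, 0)" "(y, 0)"] that by simp
  show "c *\<^sub>R x \<in> {x. (x, 0) \<in> S}" if "x \<in> {x. (x, 0) \<in> S}" for c x
    using C.subspace_scale [OF S, of "(x, 0)" "of_real c"] that by (simp add: cscale_def)
qed

lemma complex_fin_dim: "C.fin_dim (g \<times> g)"
proof -
  obtain A where A: "finite A" "span A = g" using finite_dim_g unfolding finite_dimensional_def by blast
  define S where "S = C.span ((\<lambda>a. (a, 0)) ` A)"
  have sS: "C.subspace S" unfolding S_def by simp
  have sub: "subspace {x. (x, 0) \<in> S}" by (rule subspace_real_part [OF sS])
  have "A \<subseteq> {x. (x, 0) \<in> S}" unfolding S_def by (auto intro: C.span_base)
  then have g: "g \<subseteq> {x. (x, 0) \<in> S}" using A(2) sub span_minimal by blast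
  have "(x, y) \<in> S" if "x \<in> g" "y \<in> g" for x y
  proof -
    have "(x, 0) + cscale \<i> (y, 0) \<in> S" using g that C.subspace_add [OF sS] C.subspace_scale [OF sS] by blast
    then show ?thesis by (simp add: cscale_def)
  qed
  then have "g \<times> g \<subseteq> S" by blast
  then show ?thesis unfolding C.fin_dim_def S_def using A(1) by blast
qed

lemma complex_subspace: "C.subspace (g \<times> g)"
  using subspace_0 [OF subspace_g] subspace_add [OF subspace_g] subspace_scale [OF subspace_g]
    subspace_diff [OF subspace_g]
  by (auto simp: C.subspace_def cscale_def zero_prod_def)

lemma cbr_in: "cbr X Y \<in> g \<times> g"
  unfolding cbr_def using br_in_g subspace_add [OF subspace_g] subspace_diff [OF subspace_g] by simp

text \<open>The real vectors of each member of the chain form a real subspace, and brackets of real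
  vectors are real; thus the derived series of \<open>A\<close> descends along the chain.\<close>

lemma complex_solv_imp_solvable:
  assumes "C.solv S" "subspace A" "\<And>x. x \<in> A \<Longrightarrow> (x, 0) \<in> S"
  shows "lie_solvable A br"
  using assms
proof (induction arbitrary: A rule: C.solv.induct)
  case solv_zero
  then have "A = {0}" using subspace_0 [OF solv_zero(1)] by (auto simp: zero_prod_def)
  then have "derived_series A br 0 = {0}" by simp
  then show ?case unfolding lie_solvable_def by blast
next
  case (solv_step S D)
  have sD: "C.subspace D" using solv_step.hyps(2) by (rule C.solv_subspace)
  have "subspace {x. (x, 0) \<in> D}" by (rule subspace_real_part [OF sD])
  moreover have "{br x y | x y. x \<in> A \<and> y \<in> A} \<subseteq> {x. (x, 0) \<in> D}"
  proof safe
    fix x y assume "x \<in> A" "y \<in> A"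
    then have "cbr (x, 0) (y, 0) \<in> D" using solv_step.prems(2) solv_step.hyps(4) by blast
    then show "(br x y, 0) \<in> D" by (simp add: cbr_def)
  qed
  ultimately have "derived_algebra A br \<subseteq> {x. (x, 0) \<in> D}"
    unfolding derived_algebra_def bracket_span_def by (rule span_minimal [rotated])
  then have "lie_solvable (derived_algebra A br) br"
    using solv_step.IH [of "derived_algebra A br"]
    unfolding derived_algebra_def bracket_span_def by blast
  then obtain n where n: "derived_series (derived_algebra A br) br n = {0}"
    unfolding lie_solvable_def by blast
  have "derived_series A br (Suc n) = derived_series (derived_algebra A br) br n" for n
    by (induction n) simp_all
  then show ?case unfolding lie_solvable_def using n by blast
qed

theorem H3_zero_imp_solvable:
  assumes H3: "H3_zero g br"
  shows "lie_solvable g br"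
proof -
  obtain B where B: "finite B" "\<not> C.dependent B" "C.span B = g \<times> g"
    by (rule C.fin_dim_basis [OF complex_fin_dim complex_subspace])
  define \<kappa> where "\<kappa> = C.trace_form B"
  have in_span: "cbr X Y \<in> C.span B" for X Y unfolding B(3) by (rule cbr_in)
  note \<kappa>_add = C.trace_form_add [OF B(1,2) in_span, folded \<kappa>_def]
    and \<kappa>_scale = C.trace_form_scale [OF B(1,2) in_span, folded \<kappa>_def]
    and \<kappa>_sym = C.trace_form_sym [OF B(1,2) in_span, folded \<kappa>_def]
    and \<kappa>_inv = C.trace_form_invariant [OF B(1,2) in_span, folded \<kappa>_def]
  \<comment> \<open>The trace form on real vectors, still complex-valued; the hypothesis is applied
    to its real and imaginary parts separately.\<close>
  define k where "k = (\<lambda>x y. \<kappa> (x, 0) (y, 0))"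
  have k_add: "k (x + y) z = k x z + k y z" for x y z
    unfolding k_def using \<kappa>_add [of "(x, 0)" "(y, 0)"] by simp
  have k_scale: "k (c *\<^sub>R x) y = of_real c * k x y" for c x y
    unfolding k_def using \<kappa>_scale [of "of_real c" "(x, 0)"] by (simp add: cscale_def)
  have k_sym: "k x y = k y x" for x y unfolding k_def by (rule \<kappa>_sym)
  have k_inv: "k (br x y) z = k x (br y z)" for x y z
    unfolding k_def using \<kappa>_inv [of "(x, 0)" "(y, 0)" "(z, 0)"] by (simp add: cbr_def)
  have "exact3 g br (\<lambda>x y z. Re (k (br x y) z))"
  proof (rule H3 [unfolded H3_zero_def, rule_format], rule conjI)
    have "Re (k (x + y) z) = Re (k x z) + Re (k y z)" "Re (k (c *\<^sub>R x) y) = c * Re (k x y)"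
      "Re (k x y) = Re (k y x)" "Re (k (br x y) z) = Re (k x (br y z))" for c x y z
      unfolding k_add k_scale k_inv k_sym [of y x] by simp_all
    then show "alt3 g (\<lambda>x y z. Re (k (br x y) z))" "closed3 g br (\<lambda>x y z. Re (k (br x y) z))"
      by (rule invariant_form_cocycle)+
  qed
  then obtain \<alpha>1 where \<alpha>1: "alt2 g \<alpha>1"
    "\<And>x y z. x \<in> g \<Longrightarrow> y \<in> g \<Longrightarrow> z \<in> g \<Longrightarrow> Re (k (br x y) z) = d2 br \<alpha>1 x y z"
    unfolding exact3_def by blast
  have "exact3 g br (\<lambda>x y z. Im (k (br x y) z))"
  proof (rule H3 [unfolded H3_zero_def, rule_format], rule conjI)
    have "Im (k (x + y) z) = Im (k x z) + Im (k y z)" "Im (k (c *\<^sub>R x) y) = c * Im (k x y)"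
      "Im (k x y) = Im (k y x)" "Im (k (br x y) z) = Im (k x (br y z))" for c x y z
      unfolding k_add k_scale k_inv k_sym [of y x] by simp_all
    then show "alt3 g (\<lambda>x y z. Im (k (br x y) z))" "closed3 g br (\<lambda>x y z. Im (k (br x y) z))"
      by (rule invariant_form_cocycle)+
  qed
  then obtain \<alpha>2 where \<alpha>2: "alt2 g \<alpha>2"
    "\<And>x y z. x \<in> g \<Longrightarrow> y \<in> g \<Longrightarrow> z \<in> g \<Longrightarrow> Im (k (br x y) z) = d2 br \<alpha>2 x y z"
    unfolding exact3_def by blast
  define a where "a = (\<lambda>x y. Complex (\<alpha>1 x y) (\<alpha>2 x y))"
  have a_add: "a (x + y) z = a x z + a y z" if "x \<in> g" "y \<in> g" "z \<in> g" for x y z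
    using alt2_add [OF \<alpha>1(1)] alt2_add [OF \<alpha>2(1)] that unfolding a_def by (simp add: complex_eq_iff)
  have a_scale: "a (c *\<^sub>R x) y = of_real c * a x y" if "x \<in> g" "y \<in> g" for c x y
    using alt2_scale [OF \<alpha>1(1)] alt2_scale [OF \<alpha>2(1)] that unfolding a_def by (simp add: complex_eq_iff)
  have a_neg: "a (- x) y = - a x y" if "x \<in> g" "y \<in> g" for x y
    using a_scale [OF that, of "- 1"] by simp
  have a_diff: "a (x - y) z = a x z - a y z" if "x \<in> g" "y \<in> g" "z \<in> g" for x y z
    using a_add [of x "- y" z] a_neg [of y z] that subspace_neg [OF subspace_g] by simp
  have a_swap: "a y x = - a x y" if "x \<in> g" "y \<in> g" for x y
    unfolding a_def alt2_swap [OF \<alpha>1(1) that] alt2_swap [OF \<alpha>2(1) that] by (simp add: complex_eq_iff)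
  have ka: "k (br x y) z = - a (br x y) z + a (br x z) y - a (br y z) x"
    if "x \<in> g" "y \<in> g" "z \<in> g" for x y z
    using \<alpha>1(2) [OF that] \<alpha>2(2) [OF that] unfolding a_def d2_def by (simp add: complex_eq_iff)
  \<comment> \<open>The complex bilinear extension of \<open>a\<close> to pairs.\<close>
  define A where "A = (\<lambda>X Y. a (fst X) (fst Y) - a (snd X) (snd Y)
    + \<i> * (a (fst X) (snd Y) + a (snd X) (fst Y)))"
  have \<kappa>_expand: "\<kappa> (x, x') (y, y') = k x y - k x' y' + \<i> * (k x y' + k x' y)" for x x' y y'
  proof -
    have 1: "\<kappa> (x, x') Y = \<kappa> (x, 0) Y + \<i> * \<kappa> (x', 0) Y" for x x' Y
      using \<kappa>_add [of "(x, 0)" "cscale \<i> (x', 0)" Y] \<kappa>_scale [of \<i> "(x', 0)" Y] by (simp add: cscale_def)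
    have 2: "\<kappa> X (y, y') = \<kappa> X (y, 0) + \<i> * \<kappa> X (y', 0)" for X y y'
      using 1 \<kappa>_sym by metis
    show ?thesis unfolding k_def by (subst 1, subst (1 2) 2) (simp add: algebra_simps)
  qed
  have "C.solv (g \<times> g)"
  proof (rule C.trace_form_exact_imp_solv [OF complex_subspace complex_fin_dim cbr_in B])
    fix X Y assume "X \<in> g \<times> g" "Y \<in> g \<times> g"
    then have XY: "fst X \<in> g" "snd X \<in> g" "fst Y \<in> g" "snd Y \<in> g" by auto
    show "A X Y = - A Y X"
      unfolding A_def using XY a_swap [of "fst X" "fst Y"] a_swap [of "snd X" "snd Y"]
        a_swap [of "fst X" "snd Y"] a_swap [of "snd X" "fst Y"] by (simp add: algebra_simps)
    show "A (cscale 2 X) Y = 2 * A X Y"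
      unfolding A_def cscale_def using XY by (simp add: a_scale algebra_simps)
    show "A (- X) Y = - A X Y"
      unfolding A_def using XY by (simp add: a_neg algebra_simps)
  next
    fix X Y Z assume "X \<in> g \<times> g" "Y \<in> g \<times> g" "Z \<in> g \<times> g"
    then obtain x x' y y' z z' where X: "X = (x, x')" "Y = (y, y')" "Z = (z, z')"
      and m: "x \<in> g" "x' \<in> g" "y \<in> g" "y' \<in> g" "z \<in> g" "z' \<in> g" by auto
    have k_diff: "k (u - v) w = k u w - k v w" for u v w
      using k_add [of u "- 1 *\<^sub>R v" w] k_scale [of "- 1" v w] by simp
    show "C.trace_form B (cbr X Y) Z = - A (cbr X Y) Z + A (cbr X Z) Y - A (cbr Y Z) X"
      unfolding \<kappa>_def [symmetric] X cbr_def A_def fst_conv snd_conv \<kappa>_expand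
      using m br_in_g by (simp add: k_add k_diff ka a_add a_diff algebra_simps)
  qed
  then show ?thesis by (rule complex_solv_imp_solvable [OF _ subspace_g])
    (use subspace_0 [OF subspace_g] in auto)
qed

end

section \<open>Extending a closed form from an ideal of codimension one\<close>

interpretation rv: field_space "scaleR :: real \<Rightarrow> 'a \<Rightarrow> 'a::real_vector"
  by unfold_locales

lemma real_vanishing_functional:
  fixes x :: "'a::real_vector"
  assumes "subspace D" "x \<notin> D"
  obtains l where "linear l" "\<And>y. y \<in> D \<Longrightarrow> l y = (0::real)" "l x = 1"
proof -
  obtain l where l: "Vector_Spaces.linear scaleR (*) l" "\<forall>y\<in>D. l y = 0" "l x = 1"
    using rv.vanishing_functional [OF assms] by metis
  have "linear l" using l(1) by (simp add: Vector_Spaces.linear_iff linear_iff)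
  then show thesis using that l by blast
qed

lemma alt2_subset: "alt2 h \<alpha> \<Longrightarrow> h' \<subseteq> h \<Longrightarrow> alt2 h' \<alpha>"
  unfolding alt2_def by blast

lemma exact3_subset: "exact3 h br \<phi> \<Longrightarrow> h' \<subseteq> h \<Longrightarrow> exact3 h' br \<phi>"
  unfolding exact3_def by (meson alt2_subset subsetD)

lemma exact3_cong:
  assumes "\<And>x y z. x \<in> h \<Longrightarrow> y \<in> h \<Longrightarrow> z \<in> h \<Longrightarrow> \<phi> x y z = \<psi> x y z"
  shows "exact3 h br \<phi> \<Longrightarrow> exact3 h br \<psi>"
  unfolding exact3_def using assms by simp

text \<open>Pulled back along a linear retraction onto \<open>h\<close>, the form obeys its rules on
  the whole space, so that later computations carry no membership conditions.\<close>

lemma alt2_extend: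
  assumes "subspace h" "alt2 h \<alpha>"
  obtains \<beta> where "alt2 UNIV \<beta>" "\<And>x y. x \<in> h \<Longrightarrow> y \<in> h \<Longrightarrow> \<beta> x y = \<alpha> x y"
proof -
  obtain p where p: "range p \<subseteq> h" "linear p" "\<forall>v\<in>h. p v = v"
    using linear_exists_left_inverse_on [OF linear_id assms(1) inj_on_id] unfolding id_apply by blast
  have ph: "p x \<in> h" for x using p(1) by blast
  have "alt2 UNIV (\<lambda>x y. \<alpha> (p x) (p y))"
    unfolding alt2_def linear_add [OF p(2)] linear_scale [OF p(2)]
    using alt2_add [OF assms(2) ph ph ph] alt2_scale [OF assms(2) ph ph] alt2_swap [OF assms(2) ph ph]
    by blast
  then show thesis by (rule that) (simp add: p(3))
qed

section \<open>Multilinear rules for everywhere defined forms\<close>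

lemma alt2_UNIV:
  assumes "alt2 UNIV \<alpha>"
  shows "\<alpha> (x + y) z = \<alpha> x z + \<alpha> y z" "\<alpha> (c *\<^sub>R x) y = c * \<alpha> x y"
    "\<alpha> z (x + y) = \<alpha> z x + \<alpha> z y" "\<alpha> y (c *\<^sub>R x) = c * \<alpha> y x"
    "\<alpha> (- x) y = - \<alpha> x y" "\<alpha> y (- x) = - \<alpha> y x"
    "\<alpha> (x - y) z = \<alpha> x z - \<alpha> y z" "\<alpha> z (x - y) = \<alpha> z x - \<alpha> z y"
proof -
  have 1: "\<alpha> (x + y) z = \<alpha> x z + \<alpha> y z" "\<alpha> (c *\<^sub>R x) y = c * \<alpha> x y" "\<alpha> y x = - \<alpha> x y" for x y z c
    using alt2_add [OF assms] alt2_scale [OF assms] alt2_swap [OF assms] by blast+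
  show 2: "\<alpha> (x + y) z = \<alpha> x z + \<alpha> y z" "\<alpha> (c *\<^sub>R x) y = c * \<alpha> x y" by (rule 1)+
  have 3: "\<alpha> z (x + y) = \<alpha> z x + \<alpha> z y" "\<alpha> y (c *\<^sub>R x) = c * \<alpha> y x" for x y z c
    using 1(1) [of x y z] 1(3) [of "x + y" z] 1(3) [of x z] 1(3) [of y z]
      1(2) [of c x y] 1(3) [of "c *\<^sub>R x" y] 1(3) [of x y] by simp_all
  show "\<alpha> z (x + y) = \<alpha> z x + \<alpha> z y" "\<alpha> y (c *\<^sub>R x) = c * \<alpha> y x" by (rule 3)+
  have 4: "\<alpha> (- x) y = - \<alpha> x y" "\<alpha> y (- x) = - \<alpha> y x" for x y
    using 1(2) [of "- 1"] 3(2) [of _ "- 1"] by simp_all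
  show "\<alpha> (- x) y = - \<alpha> x y" "\<alpha> y (- x) = - \<alpha> y x" by (rule 4)+
  show "\<alpha> (x - y) z = \<alpha> x z - \<alpha> y z" "\<alpha> z (x - y) = \<alpha> z x - \<alpha> z y"
    using 1(1) [of x "- y" z] 3(1) [of z x "- y"] 4 by simp_all
qed

lemma alt3_UNIV:
  assumes "alt3 UNIV \<phi>"
  shows "\<phi> (x + y) z w = \<phi> x z w + \<phi> y z w" "\<phi> (c *\<^sub>R x) z w = c * \<phi> x z w"
    "\<phi> z (x + y) w = \<phi> z x w + \<phi> z y w" "\<phi> z (c *\<^sub>R x) w = c * \<phi> z x w"
    "\<phi> z w (x + y) = \<phi> z w x + \<phi> z w y" "\<phi> z w (c *\<^sub>R x) = c * \<phi> z w x"
    "\<phi> (- x) z w = - \<phi> x z w" "\<phi> z (- x) w = - \<phi> z x w" "\<phi> z w (- x) = - \<phi> z w x"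
    "\<phi> (x - y) z w = \<phi> x z w - \<phi> y z w" "\<phi> z (x - y) w = \<phi> z x w - \<phi> z y w"
    "\<phi> z w (x - y) = \<phi> z w x - \<phi> z w y"
    "\<phi> 0 z w = 0" "\<phi> z 0 w = 0" "\<phi> z w 0 = 0"
proof -
  have 1: "\<phi> (x + y) z w = \<phi> x z w + \<phi> y z w" "\<phi> (c *\<^sub>R x) z w = c * \<phi> x z w"
    "\<phi> y x z = - \<phi> x y z" "\<phi> x z y = - \<phi> x y z" for x y z w c
    using alt3_add [OF assms] alt3_scale [OF assms] alt3_swap12 [OF assms] alt3_swap23 [OF assms] by blast+
  show "\<phi> (x + y) z w = \<phi> x z w + \<phi> y z w" "\<phi> (c *\<^sub>R x) z w = c * \<phi> x z w" by (rule 1)+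
  have 2: "\<phi> z (x + y) w = \<phi> z x w + \<phi> z y w" "\<phi> z (c *\<^sub>R x) w = c * \<phi> z x w" for x y z w c
    using 1(1) [of x y z w] 1(3) [of "x + y" z w] 1(3) [of x z w] 1(3) [of y z w]
      1(2) [of c x z w] 1(3) [of "c *\<^sub>R x" z w] by simp_all
  show "\<phi> z (x + y) w = \<phi> z x w + \<phi> z y w" "\<phi> z (c *\<^sub>R x) w = c * \<phi> z x w" by (rule 2)+
  have 3: "\<phi> z w (x + y) = \<phi> z w x + \<phi> z w y" "\<phi> z w (c *\<^sub>R x) = c * \<phi> z w x" for x y z w c
    using 2(1) [of z x y w] 1(4) [of z "x + y" w] 1(4) [of z x w] 1(4) [of z y w]
      2(2) [of z c x w] 1(4) [of z "c *\<^sub>R x" w] by simp_all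
  show "\<phi> z w (x + y) = \<phi> z w x + \<phi> z w y" "\<phi> z w (c *\<^sub>R x) = c * \<phi> z w x" by (rule 3)+
  have 4: "\<phi> (- x) z w = - \<phi> x z w" "\<phi> z (- x) w = - \<phi> z x w" "\<phi> z w (- x) = - \<phi> z w x" for x z w
    using 1(2) [of "- 1"] 2(2) [of _ "- 1"] 3(2) [of _ _ "- 1"] by simp_all
  show "\<phi> (- x) z w = - \<phi> x z w" "\<phi> z (- x) w = - \<phi> z x w" "\<phi> z w (- x) = - \<phi> z w x" by (rule 4)+
  show "\<phi> (x - y) z w = \<phi> x z w - \<phi> y z w" "\<phi> z (x - y) w = \<phi> z x w - \<phi> z y w"
    "\<phi> z w (x - y) = \<phi> z w x - \<phi> z w y"
    using 1(1) [of x "- y"] 2(1) [of _ x "- y"] 3(1) [of _ _ x "- y"] 4 by simp_all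
  show "\<phi> 0 z w = 0" "\<phi> z 0 w = 0" "\<phi> z w 0 = 0"
    using 1(2) [of 0] 2(2) [of _ 0] 3(2) [of _ _ 0] by simp_all
qed

context real_lie
begin

text \<open>Every bracket sits in the first slot, so that expansions need no reordering of arguments.\<close>

definition lie_deriv :: "'a \<Rightarrow> ('a \<Rightarrow> 'a \<Rightarrow> 'a \<Rightarrow> real) \<Rightarrow> 'a \<Rightarrow> 'a \<Rightarrow> 'a \<Rightarrow> real"
  where "lie_deriv x f y z w = - f (br x y) z w + f (br x z) y w - f (br x w) y z"

lemma alt3_lie_deriv:
  assumes f: "alt3 UNIV f" shows "alt3 UNIV (lie_deriv x f)"
proof -
  have s: "f b a c = - f a b c" "f a c b = - f a b c" for a b c
    using alt3_swap12 [OF f] alt3_swap23 [OF f] by blast+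
  show ?thesis
    unfolding alt3_def
  proof (intro conjI ballI allI)
    fix y z w
    show "lie_deriv x f z y w = - lie_deriv x f y z w"
      unfolding lie_deriv_def s(2) [of "br x w" z y] by simp
    show "lie_deriv x f y w z = - lie_deriv x f y z w"
      unfolding lie_deriv_def s(2) [of "br x y" w z] by simp
  qed (simp_all add: lie_deriv_def br_bilinear alt3_UNIV [OF f] algebra_simps)
qed

text \<open>The Lie derivative commutes with the differential: \<open>d3\<close> of
  \<open>lie_deriv x f\<close> is minus the sum of the values of \<open>d3 br f\<close> with
  \<open>br x\<close> inserted in one slot at a time.\<close>

lemma closed3_lie_deriv:
  assumes f: "alt3 UNIV f" "closed3 h br f" and x: "\<And>y. y \<in> h \<Longrightarrow> br x y \<in> h"
  shows "closed3 h br (lie_deriv x f)"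
  unfolding closed3_def
proof (intro ballI)
  fix y z w v assume m: "y \<in> h" "z \<in> h" "w \<in> h" "v \<in> h"
  have 1: "f (br x p) (br q r) s = - f (br q r) (br x p) s" for p q r s
    using alt3_swap12 [OF f(1)] by blast
  have 2: "f p r (br x q) = - f p (br x q) r" for p q r using alt3_swap23 [OF f(1)] by blast
  have 3: "br p (br x q) = - br (br x q) p" for p q by (rule L.br_swap)
  have 4: "br x (br p q) = br (br x p) q - br (br x q) p" for p q
    using L.br_derivation [of x p q] 3 by simp
  have "d3 br (lie_deriv x f) y z w v
    = - d3 br f (br x y) z w v - d3 br f y (br x z) w v - d3 br f y z (br x w) v - d3 br f y z w (br x v)"
    unfolding d3_def lie_deriv_def 4 unfolding 3 by (simp add: 1 2 alt3_UNIV [OF f(1)])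
  then show "d3 br (lie_deriv x f) y z w v = 0"
    using f(2) m x unfolding closed3_def by simp
qed

text \<open>Every application puts one more \<open>br x\<close> into one of three slots; after
  \<open>3 N\<close> applications some slot contains at least \<open>N\<close> of them.\<close>

lemma lie_deriv_nilpotent:
  assumes f: "alt3 UNIV f" and N: "\<And>y. y \<in> h \<Longrightarrow> (br x ^^ N) y = 0"
    and "y \<in> h" "z \<in> h" "w \<in> h"
  shows "(lie_deriv x ^^ (3 * N)) f y z w = 0"
proof -
  have z0: "(br x ^^ a) y = 0" if "a \<ge> N" "y \<in> h" for a y
  proof -
    have "(br x ^^ k) 0 = 0" for k by (induction k) simp_all
    then have "(br x ^^ (a - N + N)) y = 0" unfolding funpow_add using N that by simp
    then show ?thesis using that by simp
  qed
  \<comment> \<open>Generalised over powers already present in the slots, since the induction on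
    \<open>j\<close> moves brackets into the arguments.\<close>
  have "(lie_deriv x ^^ j) f ((br x ^^ a) y) ((br x ^^ b) z) ((br x ^^ c) w) = 0"
    if "a + b + c + j \<ge> 3 * N" "y \<in> h" "z \<in> h" "w \<in> h" for j a b c y z w
    using that
  proof (induction j arbitrary: a b c y z w)
    case 0
    then consider "a \<ge> N" | "b \<ge> N" | "c \<ge> N" by linarith
    then show ?case using 0 z0 by cases (simp_all add: alt3_UNIV [OF f])
  next
    case (Suc j)
    have "(lie_deriv x ^^ j) f ((br x ^^ Suc a) y) ((br x ^^ b) z) ((br x ^^ c) w) = 0"
      "(lie_deriv x ^^ j) f ((br x ^^ Suc b) z) ((br x ^^ a) y) ((br x ^^ c) w) = 0"
      "(lie_deriv x ^^ j) f ((br x ^^ Suc c) w) ((br x ^^ a) y) ((br x ^^ b) z) = 0"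
      using Suc.prems by (intro Suc.IH; simp)+
    then show ?case by (simp add: lie_deriv_def [of x "(lie_deriv x ^^ j) f"])
  qed
  from this [of 0 0 0 "3 * N"] show ?thesis using assms by simp
qed

lemma exact3_zero:
  assumes "\<And>x y z. x \<in> h \<Longrightarrow> y \<in> h \<Longrightarrow> z \<in> h \<Longrightarrow> \<phi> x y z = 0"
  shows "exact3 h br \<phi>"
  unfolding exact3_def by (rule exI [of _ "\<lambda>_ _. 0"]) (simp add: alt2_def d2_def assms)

text \<open>Write \<open>h\<close> as the line of \<open>x\<close> plus the ideal \<open>h'\<close>,
  and let \<open>K\<close> be a primitive of the Lie derivative of \<open>f\<close>. The form
  \<open>f + l \<and> K\<close>, pulled back by the projection along \<open>x\<close>, is closed; it
  is not exact because it restricts to \<open>f\<close> on \<open>h'\<close>.\<close>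

lemma extend_closed_nonexact:
  assumes h: "subspace h" "x \<in> h"
    and l: "linear l" "l x = (1::real)" "\<And>y z. y \<in> h \<Longrightarrow> z \<in> h \<Longrightarrow> l (br y z) = 0"
    and h': "h' = {y \<in> h. l y = 0}"
    and cl: "\<And>y z. y \<in> h \<Longrightarrow> z \<in> h \<Longrightarrow> br y z \<in> h"
    and f: "alt3 UNIV f" "closed3 h' br f" "\<not> exact3 h' br f" "exact3 h' br (lie_deriv x f)"
  shows "\<exists>F. alt3 UNIV F \<and> closed3 h br F \<and> \<not> exact3 h br F"
proof -
  have lin: "l (y + z) = l y + l z" "l (c *\<^sub>R y) = c * l y" "l (y - z) = l y - l z" "l (- y) = - l y" for y z c
    using linear_add [OF l(1)] linear_scale [OF l(1)] linear_diff [OF l(1)] linear_neg [OF l(1)] by auto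
  have sh': "subspace h'"
    unfolding h' subspace_def
    using subspace_0 [OF h(1)] subspace_add [OF h(1)] subspace_scale [OF h(1)] linear_0 [OF l(1)] by (auto simp: lin)
  obtain K0 where K0: "alt2 h' K0" "\<And>y z w. y \<in> h' \<Longrightarrow> z \<in> h' \<Longrightarrow> w \<in> h' \<Longrightarrow> lie_deriv x f y z w = d2 br K0 y z w"
    using f(4) unfolding exact3_def by blast
  obtain K where K: "alt2 UNIV K" "\<And>y z. y \<in> h' \<Longrightarrow> z \<in> h' \<Longrightarrow> K y z = K0 y z"
    by (rule alt2_extend [OF sh' K0(1)]) blast
  have clh': "br y z \<in> h'" if "y \<in> h" "z \<in> h" for y z unfolding h' using cl l(3) that by blast
  have Kd: "lie_deriv x f y z w = d2 br K y z w" if "y \<in> h'" "z \<in> h'" "w \<in> h'" for y z w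
  proof -
    have "br y z \<in> h'" "br y w \<in> h'" "br z w \<in> h'" using that clh' unfolding h' by blast+
    then show ?thesis using K0(2) [OF that] K(2) that unfolding d2_def by simp
  qed
  define P where "P = (\<lambda>y. y - l y *\<^sub>R x)"
  have P: "P (y + z) = P y + P z" "P (c *\<^sub>R y) = c *\<^sub>R P y" for y z c
    unfolding P_def by (simp_all add: lin algebra_simps)
  have Ph: "P y \<in> h'" if "y \<in> h" for y
    unfolding P_def h' using that h l(2) subspace_diff [OF h(1)] subspace_scale [OF h(1)] by (simp add: lin)
  have Ph': "P y = y" if "y \<in> h'" for y using that unfolding P_def h' by simp
  define F where "F = (\<lambda>y z w. f (P y) (P z) (P w)
    + l y * K (P z) (P w) - l z * K (P y) (P w) + l w * K (P y) (P z))"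
  have "alt3 UNIV F"
    unfolding alt3_def
  proof (intro conjI ballI allI)
    fix y z w
    have s: "f (P z) (P y) (P w) = - f (P y) (P z) (P w)" "f (P y) (P w) (P z) = - f (P y) (P z) (P w)"
      using alt3_swap12 [OF f(1)] alt3_swap23 [OF f(1)] by blast+
    have t: "K (P z) (P y) = - K (P y) (P z)" "K (P w) (P z) = - K (P z) (P w)"
      using alt2_swap [OF K(1)] by blast+
    show "F z y w = - F y z w" unfolding F_def s t by (simp add: algebra_simps)
    show "F y w z = - F y z w" unfolding F_def s t by (simp add: algebra_simps)
  qed (simp_all add: F_def P lin alt3_UNIV [OF f(1)] alt2_UNIV [OF K(1)] algebra_simps)
  moreover have "closed3 h br F"
    unfolding closed3_def
  proof (intro ballI)
    fix y z w v assume m: "y \<in> h" "z \<in> h" "w \<in> h" "v \<in> h"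
    define a b c d where abcd: "a = l y" "b = l z" "c = l w" "d = l v"
    define y' z' w' v' where p: "y' = P y" "z' = P z" "w' = P w" "v' = P v"
    have m': "y' \<in> h'" "z' \<in> h'" "w' \<in> h'" "v' \<in> h'" unfolding p using Ph m by blast+
    have brP: "br (s *\<^sub>R x + p) (t *\<^sub>R x + q) = br p q + s *\<^sub>R br x q - t *\<^sub>R br x p" for s t p q
      using L.br_swap [of p x] by (simp add: br_bilinear L.br_self)
    have Fbr: "F (br p q) r s = f (br p q) (P r) (P s) - l r * K (br p q) (P s) + l s * K (br p q) (P r)"
      if "p \<in> h" "q \<in> h" for p q r s
      unfolding F_def using l(3) [OF that] Ph' [OF clh' [OF that]] by simp
    have e: "y = a *\<^sub>R x + y'" "z = b *\<^sub>R x + z'" "w = c *\<^sub>R x + w'" "v = d *\<^sub>R x + v'"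
      unfolding abcd p P_def by simp_all
    have "d3 br F y z w v = - (f (br y z) w' v' - c * K (br y z) v' + d * K (br y z) w')
      + (f (br y w) z' v' - b * K (br y w) v' + d * K (br y w) z')
      - (f (br y v) z' w' - b * K (br y v) w' + c * K (br y v) z')
      - (f (br z w) y' v' - a * K (br z w) v' + d * K (br z w) y')
      + (f (br z v) y' w' - a * K (br z v) w' + c * K (br z v) y')
      - (f (br w v) y' z' - a * K (br w v) z' + b * K (br w v) y')"
      unfolding d3_def using m by (simp add: Fbr abcd p)
    \<comment> \<open>Sorted by the coefficients along \<open>x\<close>: the part free of them is
      the differential of \<open>f\<close>, and each linear part is the Lie derivative of
      \<open>f\<close> minus the differential of \<open>K\<close>.\<close>
    also have "\<dots> = d3 br f y' z' w' v' + a * (lie_deriv x f z' w' v' - d2 br K z' w' v')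
      - b * (lie_deriv x f y' w' v' - d2 br K y' w' v') + c * (lie_deriv x f y' z' v' - d2 br K y' z' v')
      - d * (lie_deriv x f y' z' w' - d2 br K y' z' w')"
      unfolding e brP d3_def lie_deriv_def d2_def
      by (simp add: alt3_UNIV [OF f(1)] alt2_UNIV [OF K(1)] algebra_simps)
    also have "\<dots> = 0" using Kd m' f(2) unfolding closed3_def by simp
    finally show "d3 br F y z w v = 0" .
  qed
  moreover have "\<not> exact3 h br F"
  proof
    assume "exact3 h br F"
    then have "exact3 h' br F" by (rule exact3_subset) (auto simp: h')
    then have "exact3 h' br f"
      by (rule exact3_cong [rotated]) (simp add: F_def Ph', simp add: h')
    then show False using f(3) by blast
  qed
  ultimately show ?thesis by blast
qed

end

section \<open>Nilpotent Lie algebras\<close>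

definition H2_zero :: "'a::real_vector set \<Rightarrow> ('a \<Rightarrow> 'a \<Rightarrow> 'a) \<Rightarrow> bool"
  where "H2_zero g br \<longleftrightarrow> (\<forall>\<alpha>. alt2 g \<alpha> \<and> (\<forall>x\<in>g. \<forall>y\<in>g. \<forall>z\<in>g. d2 br \<alpha> x y z = 0) \<longrightarrow>
    (\<exists>\<eta>. (\<forall>x\<in>g. \<forall>y\<in>g. \<eta> (x + y) = \<eta> x + \<eta> y) \<and> (\<forall>c. \<forall>x\<in>g. \<eta> (c *\<^sub>R x) = c * \<eta> x)
      \<and> (\<forall>x\<in>g. \<forall>y\<in>g. \<alpha> x y = - \<eta> (br x y))))"

lemma alt3_UNIV_imp: "alt3 UNIV \<phi> \<Longrightarrow> alt3 h \<phi>"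
  unfolding alt3_def by blast

context real_lie
begin

lemma fin_dim_g: "rv.fin_dim g"
  using finite_dim_g unfolding finite_dimensional_def rv.fin_dim_def by blast

definition closed_under :: "'a set \<Rightarrow> bool"
  where "closed_under h \<longleftrightarrow> subspace h \<and> h \<subseteq> g \<and> (\<forall>x\<in>h. \<forall>y\<in>h. br x y \<in> h)"

lemma closed_underD:
  assumes "closed_under h"
  shows "subspace h" "h \<subseteq> g" "\<And>x y. x \<in> h \<Longrightarrow> y \<in> h \<Longrightarrow> br x y \<in> h"
  using assms unfolding closed_under_def by blast+

lemma br_in_bracket_span: "x \<in> h \<Longrightarrow> y \<in> k \<Longrightarrow> br x y \<in> bracket_span br h k"
  unfolding bracket_span_def by (blast intro: span_base)

lemma bracket_span_mono: "h \<subseteq> h' \<Longrightarrow> k \<subseteq> k' \<Longrightarrow> bracket_span br h k \<subseteq> bracket_span br h' k'"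
  unfolding bracket_span_def by (rule span_mono) blast

lemma bracket_span_subset:
  "subspace V \<Longrightarrow> (\<And>x y. x \<in> h \<Longrightarrow> y \<in> k \<Longrightarrow> br x y \<in> V) \<Longrightarrow> bracket_span br h k \<subseteq> V"
  unfolding bracket_span_def by (rule span_minimal) blast

lemma lower_central_series_mono:
  "h \<subseteq> h' \<Longrightarrow> lower_central_series h br n \<subseteq> lower_central_series h' br n"
  by (induction n) (simp_all add: bracket_span_mono)

lemma lower_central_series_subset:
  assumes "closed_under h" shows "lower_central_series h br n \<subseteq> h"
proof (induction n)
  case (Suc n)
  show ?case
    unfolding lower_central_series.simps
    by (rule bracket_span_subset [OF closed_underD(1) [OF assms]])
      (use closed_underD(3) [OF assms] Suc in blast)
qed simp

text \<open>The last term of the lower central series before the first one inside \<open>b\<close>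
  supplies \<open>v\<close>, as its brackets lie in the next term.\<close>

lemma nilpotent_step:
  assumes h: "closed_under h" and N: "lower_central_series h br N \<subseteq> {0}"
    and b: "subspace b" "b \<subset> h"
  obtains v where "v \<in> h" "v \<notin> b" "\<And>x. x \<in> h \<Longrightarrow> br x v \<in> b"
proof -
  define Q where "Q = (\<lambda>i. lower_central_series h br i \<subseteq> b)"
  have QN: "Q N" unfolding Q_def using N subspace_0 [OF b(1)] by blast
  define n where "n = (LEAST i. Q i)"
  have n: "Q n" unfolding n_def using QN by (rule LeastI)
  have "n \<noteq> 0"
  proof
    assume "n = 0"
    then have "h \<subseteq> b" using n unfolding Q_def by simp
    then show False using b by blast
  qed
  then obtain i where i: "n = Suc i" using not0_implies_Suc by blast
  then have "\<not> Q i" using not_less_Least [of i Q] n_def by simp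
  then obtain v where v: "v \<in> lower_central_series h br i" "v \<notin> b" unfolding Q_def by blast
  have "br x v \<in> b" if "x \<in> h" for x
    using br_in_bracket_span [OF that v(1)] n i unfolding Q_def by auto
  then show thesis using that v lower_central_series_subset [OF h] by blast
qed

text \<open>The volume form works: in an adapted basis nilpotency leaves the single bracket
  \<open>[x2, x3] = r x1\<close>, so every exact 3-form vanishes on that basis.\<close>

lemma dim_three_closed_nonexact:
  assumes h: "closed_under h" and N: "lower_central_series h br N \<subseteq> {0}" and dim: "dim h = 3"
  shows "\<exists>\<phi>. alt3 UNIV \<phi> \<and> closed3 h br \<phi> \<and> \<not> exact3 h br \<phi>"
proof -
  have big: "span S \<subset> h" if "finite S" "S \<subseteq> h" "card S < 3" for S
  proof -
    have "span S \<subseteq> h" using that closed_underD(1) [OF h] by (intro span_minimal)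
    moreover have "dim (span S) \<le> card S" using dim_le_card [of "span S" S] that(1) by simp
    ultimately show ?thesis using dim that(3) by auto
  qed
  obtain x1 where x1: "x1 \<in> h" "x1 \<notin> span {}" "\<And>x. x \<in> h \<Longrightarrow> br x x1 \<in> span {}"
    using nilpotent_step [OF h N, of "span {}"] big [of "{}"] by auto
  have "span {x1} \<subset> h" using big [of "{x1}"] x1 by simp
  then obtain x2 where x2: "x2 \<in> h" "x2 \<notin> span {x1}" "\<And>x. x \<in> h \<Longrightarrow> br x x2 \<in> span {x1}"
    using nilpotent_step [OF h N subspace_span] by blast
  have "span {x1, x2} \<subset> h" using big [of "{x1, x2}"] x1 x2 card_2_iff by (cases "x1 = x2") auto
  then obtain x3 where x3: "x3 \<in> h" "x3 \<notin> span {x1, x2}" by blast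
  have ne: "x1 \<noteq> x2" "x3 \<noteq> x1" "x3 \<noteq> x2" using x2 x3 by (auto intro: span_base)
  have ind: "independent {x3, x2, x1}"
    using x1 x2 x3 by (intro independent_insertI) (auto simp: insert_commute independent_empty)
  have "h \<subseteq> span {x3, x2, x1}"
  proof
    fix y assume y: "y \<in> h"
    show "y \<in> span {x3, x2, x1}"
    proof (rule ccontr)
      assume n: "y \<notin> span {x3, x2, x1}"
      then have i: "independent (insert y {x3, x2, x1})" using ind by (rule independent_insertI)
      have "y \<notin> {x3, x2, x1}" using n span_superset [of "{x3, x2, x1}"] by blast
      then have c: "card (insert y {x3, x2, x1}) = 4" using ne by simp
      obtain B where B: "B \<subseteq> h" "independent B" "h \<subseteq> span B" "card B = dim h" by (rule basis_exists)
      have "insert y {x3, x2, x1} \<subseteq> span B" using y x1 x2 x3 B(3) by auto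
      moreover have "finite B" using B(4) dim by (metis card.infinite zero_neq_numeral)
      ultimately have "card (insert y {x3, x2, x1}) \<le> card B" using i independent_span_bound by blast
      then show False using c B(4) dim by simp
    qed
  qed
  then have coords: "\<exists>a b c. y = a *\<^sub>R x3 + b *\<^sub>R x2 + c *\<^sub>R x1" if "y \<in> h" for y
  proof -
    have "y \<in> span (insert x3 (insert x2 {x1}))" using that \<open>h \<subseteq> span {x3, x2, x1}\<close> by blast
    then obtain a b c where "y - a *\<^sub>R x3 - b *\<^sub>R x2 = c *\<^sub>R x1"
      unfolding span_breakdown_eq span_singleton by blast
    then have "y = a *\<^sub>R x3 + b *\<^sub>R x2 + c *\<^sub>R x1" by (simp add: algebra_simps)
    then show ?thesis by blast
  qed
  obtain l1 where l1: "linear l1" "l1 x1 = (1::real)"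
    using real_vanishing_functional [OF subspace_span x1(2)] by metis
  obtain l2 where l2: "linear l2" "\<And>y. y \<in> span {x1} \<Longrightarrow> l2 y = (0::real)" "l2 x2 = 1"
    by (rule real_vanishing_functional [OF subspace_span x2(2)]) blast
  obtain l3 where l3: "linear l3" "\<And>y. y \<in> span {x1, x2} \<Longrightarrow> l3 y = (0::real)" "l3 x3 = 1"
    by (rule real_vanishing_functional [OF subspace_span x3(2)]) blast
  have z: "l2 x1 = 0" "l3 x1 = 0" "l3 x2 = 0" using l2(2) l3(2) by (auto intro: span_base)
  note lin = linear_add [OF l1(1)] linear_scale [OF l1(1)] linear_add [OF l2(1)] linear_scale [OF l2(1)]
    linear_add [OF l3(1)] linear_scale [OF l3(1)]
  \<comment> \<open>The determinant of the three functionals. Normalising \<open>l1\<close> at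
    \<open>x1\<close> alone is enough, since \<open>l2\<close> and \<open>l3\<close> make the matrix
    on \<open>x1\<close>, \<open>x2\<close>, \<open>x3\<close> triangular with unit
    diagonal.\<close>
  define \<phi> where "\<phi> = (\<lambda>y z w. l1 y * (l2 z * l3 w - l3 z * l2 w) - l1 z * (l2 y * l3 w - l3 y * l2 w)
    + l1 w * (l2 y * l3 z - l3 y * l2 z))"
  have "alt3 UNIV \<phi>" unfolding alt3_def \<phi>_def by (simp add: lin algebra_simps)
  moreover
  obtain r where r: "br x2 x3 = r *\<^sub>R x1"
    using x2(3) [OF x3(1)] L.br_swap [of x2 x3] by (metis span_breakdown_eq span_empty singletonD
        eq_iff_diff_eq_0 scaleR_minus_left)
  have c1: "br y x1 = 0" "br x1 y = 0" if "y \<in> h" for y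
    using x1(3) [OF that] L.br_swap [of x1 y] by simp_all
  have br_h: "\<exists>t. br y z = t *\<^sub>R x1 \<and> t = r * (l2 y * l3 z - l3 y * l2 z)" if "y \<in> h" "z \<in> h" for y z
  proof -
    obtain a b c a' b' c' where e: "y = a *\<^sub>R x3 + b *\<^sub>R x2 + c *\<^sub>R x1" "z = a' *\<^sub>R x3 + b' *\<^sub>R x2 + c' *\<^sub>R x1"
      using coords \<open>y \<in> h\<close> \<open>z \<in> h\<close> by metis
    have "br y z = (b * a' - a * b') *\<^sub>R br x2 x3"
      unfolding e using L.br_swap [of x3 x2] c1 x1(1) x2(1) x3(1)
      by (simp add: br_bilinear L.br_self algebra_simps)
    moreover have "l2 y * l3 z - l3 y * l2 z = b * a' - a * b'"
      unfolding e by (simp add: lin z l2(3) l3(3) algebra_simps)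
    ultimately show ?thesis using r by (simp add: mult.commute)
  qed
  have "closed3 h br \<phi>"
    unfolding closed3_def
  proof (intro ballI)
    \<comment> \<open>On brackets the form is \<open>r\<close> times a product of two values of
      \<open>l2 \<and> l3\<close>; closedness becomes the Pluecker relation for this decomposable
      form.\<close>
    have *: "\<phi> (br p q) s t = r * (l2 p * l3 q - l3 p * l2 q) * (l2 s * l3 t - l3 s * l2 t)"
      if "p \<in> h" "q \<in> h" for p q s t
      using br_h [OF that] unfolding \<phi>_def by (auto simp: lin z l1(2))
    fix y z w v assume m: "y \<in> h" "z \<in> h" "w \<in> h" "v \<in> h"
    show "d3 br \<phi> y z w v = 0"
      unfolding d3_def using m by (simp add: * algebra_simps)
  qed
  moreover have "\<not> exact3 h br \<phi>"
  proof
    assume "exact3 h br \<phi>"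
    then obtain \<alpha> where \<alpha>: "alt2 h \<alpha>" "\<And>x y z. x \<in> h \<Longrightarrow> y \<in> h \<Longrightarrow> z \<in> h \<Longrightarrow> \<phi> x y z = d2 br \<alpha> x y z"
      unfolding exact3_def by blast
    have "\<alpha> x1 x1 = - \<alpha> x1 x1" by (rule alt2_swap [OF \<alpha>(1) x1(1) x1(1)])
    then have a0: "\<alpha> (c *\<^sub>R x1) x1 = 0" for c using alt2_scale [OF \<alpha>(1) x1(1) x1(1)] by simp
    have a00: "\<alpha> 0 y = 0" if "y \<in> h" for y using alt2_scale [OF \<alpha>(1) x1(1) that, of 0] by simp
    have "\<phi> x1 x2 x3 = d2 br \<alpha> x1 x2 x3" using \<alpha>(2) x1 x2 x3 by blast
    also have "\<dots> = 0" unfolding d2_def r using c1 x2(1) x3(1) a0 a00 by simp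
    finally show False unfolding \<phi>_def by (simp add: z l1(2) l2(3) l3(3))
  qed
  ultimately show ?thesis by blast
qed

lemma nilpotent_closed_nonexact:
  assumes "closed_under h" "lower_central_series h br N \<subseteq> {0}" "dim h \<ge> 3"
  shows "\<exists>\<phi>. alt3 UNIV \<phi> \<and> closed3 h br \<phi> \<and> \<not> exact3 h br \<phi>"
  using assms
proof (induction "dim h" arbitrary: h rule: less_induct)
  case less
  note h = closed_underD [OF less(2)]
  show ?case
  proof (cases "dim h = 3")
    case True
    then show ?thesis using dim_three_closed_nonexact less by blast
  next
    case False
    define D where "D = bracket_span br h h"
    have sD: "subspace D" unfolding D_def bracket_span_def by simp
    \<comment> \<open>A nonzero nilpotent algebra is not perfect: otherwise every term of its lower
      central series would contain \<open>h\<close>.\<close>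
    have "\<not> h \<subseteq> D"
    proof
      assume a: "h \<subseteq> D"
      have "h \<subseteq> lower_central_series h br n" for n
      proof (induction n)
        case (Suc n)
        have "D \<subseteq> bracket_span br h (lower_central_series h br n)"
          unfolding D_def by (rule bracket_span_mono) (use Suc in auto)
        then show ?case using a by simp
      qed simp
      then have "h \<subseteq> span {}" using less(3) by fastforce
      then have "dim h \<le> 0" using dim_le_card [of h "{}"] by simp
      then show False using less(4) by simp
    qed
    then obtain x where x: "x \<in> h" "x \<notin> D" by blast
    obtain l where l: "linear l" "\<And>y. y \<in> D \<Longrightarrow> l y = (0::real)" "l x = 1"
      by (rule real_vanishing_functional [OF sD x(2)]) blast
    define h' where "h' = {y \<in> h. l y = 0}"
    have lbr: "l (br y z) = 0" if "y \<in> h" "z \<in> h" for y z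
      using l(2) br_in_bracket_span [OF that] unfolding D_def by blast
    have sh': "subspace h'"
      unfolding h'_def subspace_def
      using subspace_0 [OF h(1)] subspace_add [OF h(1)] subspace_scale [OF h(1)]
      by (simp add: linear_0 [OF l(1)] linear_add [OF l(1)] linear_scale [OF l(1)])
    have sub: "h' \<subseteq> h" unfolding h'_def by blast
    have ch': "closed_under h'"
      unfolding closed_under_def using sh' sub h lbr unfolding h'_def by blast
    have fh: "rv.fin_dim h" using rv.fin_dim_subset [OF fin_dim_g h(2)] .
    have "x \<notin> h'" using l(3) unfolding h'_def by simp
    then have "h' \<subset> h" using x(1) sub by blast
    then have lt: "dim h' < dim h" by (rule rv.fin_dim_psubset_dim [OF fh _ sh' h(1)])
    obtain B where B: "finite B" "independent B" "span B = h'" "B \<subseteq> h'" "card B = dim h'"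
      by (rule rv.fin_dim_basis [OF rv.fin_dim_subset [OF fh sub] sh'])
    have "h \<subseteq> span (insert x B)"
    proof
      fix y assume y: "y \<in> h"
      have "y - l y *\<^sub>R x \<in> h'"
        unfolding h'_def using y x(1) l(3) subspace_diff [OF h(1)] subspace_scale [OF h(1)]
        by (simp add: linear_diff [OF l(1)] linear_scale [OF l(1)])
      then show "y \<in> span (insert x B)" unfolding span_breakdown_eq B(3) by blast
    qed
    then have "dim h \<le> card (insert x B)" using B(1) by (intro dim_le_card) auto
    also have "\<dots> \<le> Suc (dim h')" using B(1,5) by (simp add: card_insert_if)
    \<comment> \<open>At most one dimension is lost, and \<open>dim h\<close> is at least
      \<open>4\<close> in this case.\<close>
    finally have ge: "dim h' \<ge> 3" using False less(4) by simp
    have N': "lower_central_series h' br N \<subseteq> {0}"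
      using lower_central_series_mono [OF sub] less(3) by blast
    obtain f0 where f0: "alt3 UNIV f0" "closed3 h' br f0" "\<not> exact3 h' br f0"
      using less(1) [OF lt ch' N' ge] by blast
    have xh': "br x y \<in> h'" if "y \<in> h'" for y
      using h(3) [OF x(1)] lbr [OF x(1)] that unfolding h'_def by blast
    have adN: "(br x ^^ n) y \<in> lower_central_series h br n" if "y \<in> h" for n y
      by (induction n) (use that x(1) br_in_bracket_span in auto)
    have "(br x ^^ N) y = 0" if "y \<in> h'" for y
      using adN [of y N] that sub less(3) by blast
    from lie_deriv_nilpotent [OF f0(1) this]
    have "exact3 h' br ((lie_deriv x ^^ (3 * N)) f0)" by (intro exact3_zero) blast
    then have ex: "\<exists>j. exact3 h' br ((lie_deriv x ^^ j) f0)" by blast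
    \<comment> \<open>Iterated Lie derivatives of \<open>f0\<close> end in a form that is zero on
      \<open>h'\<close>, hence exact; the one just before the first exact one is the form to
      extend.\<close>
    define n where "n = (LEAST j. exact3 h' br ((lie_deriv x ^^ j) f0))"
    have n: "exact3 h' br ((lie_deriv x ^^ n) f0)" unfolding n_def using ex by (rule LeastI_ex)
    have "n \<noteq> 0" using n f0(3) by (metis funpow_0)
    then obtain j where j: "n = Suc j" using not0_implies_Suc by blast
    define f where "f = (lie_deriv x ^^ j) f0"
    have "\<not> exact3 h' br f"
      using not_less_Least [of j "\<lambda>j. exact3 h' br ((lie_deriv x ^^ j) f0)"] j unfolding n_def f_def by simp
    moreover have "exact3 h' br (lie_deriv x f)" using n j unfolding f_def by simp
    moreover have "alt3 UNIV ((lie_deriv x ^^ i) f0) \<and> closed3 h' br ((lie_deriv x ^^ i) f0)" for i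
      by (induction i) (simp_all add: f0 alt3_lie_deriv closed3_lie_deriv xh')
    then have "alt3 UNIV f" "closed3 h' br f" unfolding f_def by blast+
    ultimately show ?thesis
      using extend_closed_nonexact [OF h(1) x(1) l(1,3) lbr h'_def h(3)] by blast
  qed
qed

lemma closed_under_g: "closed_under g"
  unfolding closed_under_def using subspace_g br_in_g by blast

text \<open>Dimension three or more is ruled out by the closed non-exact form. Below that, a central
  vector leaves at most one further direction, so the algebra is abelian and is one of the two
  exceptions.\<close>

theorem H3_zero_imp_not_nilpotent:
  assumes "H3_zero g br" "g \<noteq> {0}" "\<not> (lie_abelian g br \<and> dim g = 1)" "\<not> (lie_abelian g br \<and> dim g = 2)"
  shows "\<not> lie_nilpotent g br"
proof
  assume "lie_nilpotent g br"
  then obtain N where N: "lower_central_series g br N \<subseteq> {0}" unfolding lie_nilpotent_def by blast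
  have "\<not> dim g \<ge> 3"
    using nilpotent_closed_nonexact [OF closed_under_g N] assms(1) alt3_UNIV_imp
    unfolding H3_zero_def by blast
  then have d: "dim g \<le> 2" by simp
  have "{0} \<subset> g" using assms(2) subspace_0 [OF subspace_g] by blast
  then obtain x1 where x1: "x1 \<in> g" "x1 \<noteq> 0" "\<And>x. x \<in> g \<Longrightarrow> br x x1 = 0"
    using nilpotent_step [OF closed_under_g N, of "{0}"] by auto
  have x1': "br x1 x = 0" if "x \<in> g" for x using x1(3) [OF that] L.br_swap [of x1 x] by simp
  have ind1: "independent {x1}" using x1(2) by simp
  have s1: "span {x1} \<subseteq> g" using x1(1) subspace_g by (intro span_minimal) auto
  show False
  proof (cases "g = span {x1}")
    case True
    have "dim g = 1" unfolding True using dim_span_eq_card_independent [OF ind1] by simp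
    moreover have "lie_abelian g br"
      unfolding lie_abelian_def
    proof (intro ballI)
      fix x y assume "x \<in> g" "y \<in> g"
      then obtain c where "y = c *\<^sub>R x1" using True by (auto simp: span_singleton)
      then show "br x y = 0" using x1(3) [OF \<open>x \<in> g\<close>] by (simp add: br_bilinear)
    qed
    ultimately show False using assms(3) by blast
  next
    case False
    then have "span {x1} \<subset> g" using s1 by blast
    then obtain x2 where x2: "x2 \<in> g" "x2 \<notin> span {x1}" by blast
    have ind2: "independent {x2, x1}" using x2(2) ind1 by (rule independent_insertI)
    have ne: "x2 \<noteq> x1" using x2(2) span_superset [of "{x1}"] by blast
    have s2: "span {x2, x1} \<subseteq> g" using x1(1) x2(1) subspace_g by (intro span_minimal) auto
    have d2: "dim (span {x2, x1}) = 2" using dim_span_eq_card_independent [OF ind2] ne by simp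
    have g: "span {x2, x1} = g"
      using rv.fin_dim_subspace_eq [OF fin_dim_g s2 subspace_span subspace_g] d d2 by simp
    have "lie_abelian g br"
      unfolding lie_abelian_def
    proof (intro ballI)
      fix x y assume xy: "x \<in> g" "y \<in> g"
      then obtain a b a' b' where "x - a *\<^sub>R x2 = b *\<^sub>R x1" "y - a' *\<^sub>R x2 = b' *\<^sub>R x1"
        unfolding g [symmetric] span_breakdown_eq [of _ x2] span_singleton by blast
      then have e: "x = a *\<^sub>R x2 + b *\<^sub>R x1" "y = a' *\<^sub>R x2 + b' *\<^sub>R x1" by (simp_all add: algebra_simps)
      show "br x y = 0"
        unfolding e using x1(1) x2(1) x1(3) x1' by (simp add: br_bilinear L.br_self)
    qed
    then show False using assms(4) d2 g by simp
  qed
qed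

end

section \<open>Consequences of \<open>b\<^sub>2 = 0\<close>\<close>

context real_lie
begin

lemma subspace_derived: "subspace (derived_algebra h br)"
  unfolding derived_algebra_def bracket_span_def by simp

lemma br_in_derived: "x \<in> h \<Longrightarrow> y \<in> h \<Longrightarrow> br x y \<in> derived_algebra h br"
  unfolding derived_algebra_def by (rule br_in_bracket_span)

lemma derived_subset: "closed_under h \<Longrightarrow> derived_algebra h br \<subseteq> h"
  unfolding derived_algebra_def using closed_underD by (intro bracket_span_subset) auto

text \<open>A perfect subalgebra is contained in every term of the derived series of
  \<open>g\<close>, hence is zero when \<open>g\<close> is solvable.\<close>

lemma derived_proper:
  assumes s: "lie_solvable g br" and h: "closed_under h" "h \<noteq> {0}"
  obtains x where "x \<in> h" "x \<notin> derived_algebra h br"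
proof (rule ccontr)
  assume "\<not> thesis"
  then have a: "h \<subseteq> derived_algebra h br" using that by blast
  have "h \<subseteq> derived_series g br n" for n
  proof (induction n)
    case 0 then show ?case using closed_underD(2) [OF h(1)] by simp
  next
    case (Suc n)
    have "derived_algebra h br \<subseteq> derived_algebra (derived_series g br n) br"
      unfolding derived_algebra_def by (rule bracket_span_mono) (use Suc in auto)
    then show ?case using a by simp
  qed
  moreover obtain n where "derived_series g br n = {0}" using s unfolding lie_solvable_def by blast
  ultimately have "h \<subseteq> {0}" by metis
  then show False using h(2) subspace_0 [OF closed_underD(1) [OF h(1)]] by blast
qed

text \<open>
  Two independent closed \<open>1\<close>-forms \<open>\<beta>, \<gamma>\<close> force \<open>b\<^sub>2 > 0\<close>: as \<open>\<gamma>\<close> vanishes on brackets, \<open>ad x\<close> is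
  not surjective on \<open>h / [h, h]\<close> for \<open>h = ker \<beta>\<close>, hence not injective, and a closed \<open>1\<close>-form \<open>\<delta>\<close> of
  \<open>h\<close> not vanishing on its kernel gives a non-exact \<open>\<beta> \<and> \<delta>\<close>.
\<close>

lemma H2_zero_codim:
  assumes H2: "H2_zero g br" and x: "x \<in> g" "x \<notin> derived_algebra g br" and y: "y \<in> g"
  shows "y \<in> span (insert x (derived_algebra g br))"
proof (rule ccontr)
  assume ny: "y \<notin> span (insert x (derived_algebra g br))"
  define D where "D = derived_algebra g br"
  have sD: "subspace D" unfolding D_def by (rule subspace_derived)
  have brD: "br u v \<in> D" if "u \<in> g" "v \<in> g" for u v unfolding D_def using that by (rule br_in_derived)
  \<comment> \<open>Both functionals \<open>b\<close> and \<open>c\<close> vanish on brackets. The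
    second also vanishes at \<open>x\<close>, which makes it independent of the first.\<close>
  obtain b where b: "linear b" "\<And>y. y \<in> D \<Longrightarrow> b y = (0::real)" "b x = 1"
    by (rule real_vanishing_functional [OF sD x(2) [folded D_def]]) blast
  obtain c where c: "linear c" "\<And>z. z \<in> span (insert x D) \<Longrightarrow> c z = (0::real)" "c y = 1"
    by (rule real_vanishing_functional [OF subspace_span ny [folded D_def]]) blast
  have cD: "c z = 0" if "z \<in> D" for z by (rule c(2)) (simp add: span_base that)
  have cx: "c x = 0" by (rule c(2)) (simp add: span_base)
  define h where "h = {z \<in> g. b z = 0}"
  have hg: "h \<subseteq> g" unfolding h_def by blast
  have sh: "subspace h"
    unfolding h_def subspace_def
    using subspace_0 [OF subspace_g] subspace_add [OF subspace_g] subspace_scale [OF subspace_g]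
    by (simp add: linear_0 [OF b(1)] linear_add [OF b(1)] linear_scale [OF b(1)])
  have brh: "br u v \<in> h" if "u \<in> g" "v \<in> g" for u v
    unfolding h_def using br_in_g b(2) [OF brD [OF that]] by blast
  have ch: "closed_under h" unfolding closed_under_def using sh hg brh by blast
  define E where "E = derived_algebra h br"
  have sE: "subspace E" unfolding E_def by (rule subspace_derived)
  have Eh: "E \<subseteq> h" unfolding E_def by (rule derived_subset [OF ch])
  have ED: "E \<subseteq> D" unfolding E_def D_def derived_algebra_def by (rule bracket_span_mono [OF hg hg])
  have TE: "br x ` E \<subseteq> E"
  proof -
    have "bracket_span br h h \<subseteq> {z. br x z \<in> E}"
    proof (rule bracket_span_subset)
      show "subspace {z. br x z \<in> E}"
        using subspace_0 [OF sE] subspace_add [OF sE] subspace_scale [OF sE]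
        by (simp add: subspace_def [of "{z. br x z \<in> E}"] br_bilinear)
      fix u v assume uv: "u \<in> h" "v \<in> h"
      have "br x u \<in> h" "br x v \<in> h" using brh x(1) uv hg by blast+
      then have "br (br x u) v \<in> E" "br u (br x v) \<in> E"
        unfolding E_def using uv br_in_derived by blast+
      then have "br x (br u v) \<in> E" unfolding L.br_derivation [of x u v] by (rule subspace_add [OF sE])
      then show "br u v \<in> {z. br x z \<in> E}" by simp
    qed
    then show ?thesis unfolding E_def derived_algebra_def by blast
  qed
  have Th: "br x ` h \<subseteq> h" using brh x(1) hg by blast
  \<comment> \<open>If \<open>br x\<close> were injective on \<open>h\<close> modulo
    \<open>E\<close>, it would be onto, and \<open>y - b y x\<close> would be a bracket modulo
    \<open>E\<close>; but \<open>c\<close> is \<open>1\<close> there and \<open>0\<close> on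
    \<open>E\<close> and on brackets.\<close>
  have "\<exists>w\<in>h. br x w \<in> E \<and> w \<notin> E"
  proof (rule ccontr)
    assume "\<not> ?thesis"
    then have inj: "\<And>w. w \<in> h \<Longrightarrow> br x w \<in> E \<Longrightarrow> w \<in> E" by blast
    have yh: "y - b y *\<^sub>R x \<in> h"
      unfolding h_def using y x(1) b(3) subspace_diff [OF subspace_g] subspace_scale [OF subspace_g]
      by (simp add: linear_diff [OF b(1)] linear_scale [OF b(1)])
    have "linear (br x)" by (simp add: linear_iff br_bilinear)
    then obtain w where w: "w \<in> h" "y - b y *\<^sub>R x - br x w \<in> E"
      by (rule rv.inj_mod_imp_surj_mod [OF _ rv.fin_dim_subset [OF fin_dim_g hg] sh Th sE Eh TE inj yh])
    have "c (y - b y *\<^sub>R x - br x w) = 0" using w(2) ED cD by blast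
    moreover have "c (br x w) = 0" using cD brD x(1) w(1) hg by blast
    ultimately show False using c(3) cx by (simp add: linear_diff [OF c(1)] linear_scale [OF c(1)])
  qed
  then obtain w where w: "w \<in> h" "br x w \<in> E" "w \<notin> E" by blast
  obtain d where d: "linear d" "\<And>z. z \<in> E \<Longrightarrow> d z = (0::real)" "d w = 1"
    by (rule real_vanishing_functional [OF sE w(3)]) blast
  note lin = linear_add [OF b(1)] linear_scale [OF b(1)] linear_diff [OF b(1)]
    linear_add [OF d(1)] linear_scale [OF d(1)] linear_diff [OF d(1)]
  \<comment> \<open>The form \<open>b \<and> d\<close>, where \<open>d\<close> vanishes on the
    brackets of \<open>h\<close> but possibly not on those of \<open>g\<close>.\<close>
  define \<alpha> where "\<alpha> = (\<lambda>u v. b u * d v - b v * d u)"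
  have "alt2 g \<alpha>" unfolding alt2_def \<alpha>_def by (simp add: lin algebra_simps)
  moreover have "\<forall>u\<in>g. \<forall>v\<in>g. \<forall>z\<in>g. d2 br \<alpha> u v z = 0"
  proof (intro ballI)
    have bbr: "b (br u v) = 0" if "u \<in> g" "v \<in> g" for u v using b(2) brD that by blast
    \<comment> \<open>Subtracting multiples of \<open>x\<close> puts both arguments into
      \<open>h\<close>, where \<open>d\<close> kills brackets. The formula says that the
      differential of \<open>d\<close> is divisible by \<open>b\<close>, so the wedge product with
      \<open>b\<close> is closed.\<close>
    have dbr: "d (br u v) = b u * d (br x v) - b v * d (br x u)" if "u \<in> g" "v \<in> g" for u v
    proof -
      define u' where "u' = u - b u *\<^sub>R x"
      define v' where "v' = v - b v *\<^sub>R x"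
      have "u' \<in> h" "v' \<in> h"
        unfolding u'_def v'_def h_def
        using that x(1) b(3) subspace_diff [OF subspace_g] subspace_scale [OF subspace_g] by (simp_all add: lin)
      then have "d (br u' v') = 0" using d(2) br_in_derived unfolding E_def by blast
      moreover have "br u' v' = br u v - b u *\<^sub>R br x v + b v *\<^sub>R br x u"
        unfolding u'_def v'_def using L.br_swap [of u x] by (simp add: br_bilinear L.br_self algebra_simps)
      ultimately show ?thesis by (simp add: lin)
    qed
    fix u v z assume "u \<in> g" "v \<in> g" "z \<in> g"
    then show "d2 br \<alpha> u v z = 0"
      unfolding d2_def \<alpha>_def by (simp add: bbr dbr algebra_simps)
  qed
  ultimately obtain e where e: "\<And>x y. x \<in> g \<Longrightarrow> y \<in> g \<Longrightarrow> e (x + y) = e x + e y"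
    "\<And>c x. x \<in> g \<Longrightarrow> e (c *\<^sub>R x) = c * e x" "\<And>x y. x \<in> g \<Longrightarrow> y \<in> g \<Longrightarrow> \<alpha> x y = - e (br x y)"
    using H2 unfolding H2_zero_def by metis
  have e0: "e 0 = 0" using e(2) [OF x(1), of 0] by simp
  \<comment> \<open>On \<open>h\<close> the form vanishes, since \<open>b\<close> does, so its
    primitive vanishes on \<open>E\<close>. As \<open>br x w\<close> lies in \<open>E\<close>, this
    contradicts \<open>\<alpha> x w = 1\<close>.\<close>
  have "E \<subseteq> {z \<in> g. e z = 0}"
    unfolding E_def derived_algebra_def
  proof (rule bracket_span_subset)
    show "subspace {z \<in> g. e z = 0}"
      unfolding subspace_def
      using subspace_0 [OF subspace_g] subspace_add [OF subspace_g] subspace_scale [OF subspace_g] e0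
      by (simp add: e(1,2))
    fix u v assume "u \<in> h" "v \<in> h"
    then have "u \<in> g" "v \<in> g" "\<alpha> u v = 0" unfolding h_def \<alpha>_def by auto
    then show "br u v \<in> {z \<in> g. e z = 0}" using e(3) br_in_g by force
  qed
  then have "e (br x w) = 0" using w(2) by blast
  then have "\<alpha> x w = 0" using e(3) x(1) w(1) hg by (metis neg_equal_0_iff_equal subsetD)
  moreover have "b w = 0" using w(1) unfolding h_def by blast
  ultimately show False unfolding \<alpha>_def using b(3) d(3) by simp
qed

theorem H2_zero_codim_one:
  assumes H2: "H2_zero g br" and s: "lie_solvable g br" "g \<noteq> {0}"
  shows "quotient_dim g (derived_algebra g br) = 1"
proof -
  define D where "D = derived_algebra g br"
  have sD: "subspace D" and Dg: "D \<subseteq> g"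
    unfolding D_def using subspace_derived derived_subset [OF closed_under_g] by blast+
  obtain x where x: "x \<in> g" "x \<notin> D"
    unfolding D_def by (rule derived_proper [OF s(1) closed_under_g s(2)])
  obtain B where B: "finite B" "independent B" "span B = D" "B \<subseteq> D" "card B = dim D"
    by (rule rv.fin_dim_basis [OF rv.fin_dim_subset [OF fin_dim_g Dg] sD])
  have xB: "x \<notin> span B" using x B by simp
  then have ind: "independent (insert x B)" using B(2) by (rule independent_insertI)
  have "g \<subseteq> span (insert x D)" using H2_zero_codim [OF H2 x(1)] x(2) unfolding D_def by blast
  also have "\<dots> \<subseteq> span (insert x B)"
    by (intro span_minimal subspace_span) (use B(3) span_mono [of B "insert x B"] in \<open>auto intro: span_base\<close>)
  finally have g: "g \<subseteq> span (insert x B)" .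
  have "dim g = card (insert x B)"
    by (rule dim_unique [OF _ g ind refl]) (use x B Dg in auto)
  also have "\<dots> = Suc (dim D)"
    using B xB span_base by (metis card_insert_disjoint)
  finally have "dim g = Suc (dim D)" .
  moreover have "quotient_dim g D + dim D = dim g"
    by (rule quotient_dim_eq [OF sD subspace_g Dg _ g]) (use B(1) in simp)
  ultimately show ?thesis unfolding D_def by simp
qed

theorem H2_zero_indecomposable:
  assumes H2: "H2_zero g br" and s: "lie_solvable g br"
    and hk: "h \<noteq> {0}" "k \<noteq> {0}" "lie_direct_sum g h k br"
  shows False
proof -
  note ds = hk(3) [unfolded lie_direct_sum_def]
  have g: "g = {x + y | x y. x \<in> h \<and> y \<in> k}" by (rule ds [THEN conjunct2, THEN conjunct2, THEN conjunct1])
  have int: "h \<inter> k = {0}" and comm': "\<forall>x\<in>h. \<forall>y\<in>k. br x y = 0" using ds by simp_all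
  have "lie_subalgebra h g br" "lie_subalgebra k g br"
    by (rule ds [THEN conjunct1] ds [THEN conjunct2, THEN conjunct1])+
  then have ch: "closed_under h" "closed_under k"
    unfolding lie_subalgebra_def closed_under_def by simp_all
  have comm: "br x y = 0" if "x \<in> h" "y \<in> k" for x y using comm' that by blast
  define H where "H = derived_algebra h br"
  define K where "K = derived_algebra k br"
  have sub: "subspace H" "H \<subseteq> h" "subspace K" "K \<subseteq> k"
    unfolding H_def K_def by (intro subspace_derived derived_subset ch)+
  have sh: "subspace h" "subspace k" "h \<subseteq> g" "k \<subseteq> g" by (intro closed_underD ch)+
  obtain x where x: "x \<in> h" "x \<notin> H" unfolding H_def by (rule derived_proper [OF s ch(1) hk(1)])
  obtain y where y: "y \<in> k" "y \<notin> K" unfolding K_def by (rule derived_proper [OF s ch(2) hk(2)])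
  \<comment> \<open>Since \<open>h\<close> and \<open>k\<close> commute, this sum of the two derived
    algebras contains all brackets of \<open>g\<close>; hence \<open>x\<close> and \<open>y\<close>
    stay independent modulo the derived algebra.\<close>
  define S where "S = {u + v | u v. u \<in> H \<and> v \<in> K}"
  have "derived_algebra g br \<subseteq> S"
    unfolding derived_algebra_def
  proof (rule bracket_span_subset)
    show "subspace S" unfolding S_def by (rule subspace_sums [OF sub(1,3)])
    fix a b assume "a \<in> g" "b \<in> g"
    then obtain u v u' v' where e: "a = u + v" "b = u' + v'" "u \<in> h" "v \<in> k" "u' \<in> h" "v' \<in> k"
      unfolding g by blast
    have "br a b = br u u' + br v v'"
      unfolding e(1,2) using comm e(3-6) L.br_swap [of v u'] by (simp add: br_bilinear)
    moreover have "br u u' \<in> H" "br v v' \<in> K" unfolding H_def K_def using e(3-6) br_in_derived by blast+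
    ultimately show "br a b \<in> S" unfolding S_def by blast
  qed
  moreover have "u = u' \<and> v = v'" if "u + v = u' + v'" "u \<in> h" "v \<in> k" "u' \<in> h" "v' \<in> k" for u v u' v'
  proof -
    have "u - u' = v' - v" using that(1) by (simp add: algebra_simps)
    moreover have "u - u' \<in> h" "v' - v \<in> k" using that subspace_diff sh(1,2) by blast+
    ultimately have "u - u' \<in> h \<inter> k" "v' - v \<in> h \<inter> k" by auto
    then show ?thesis unfolding int by simp
  qed
  note unique = this
  have zero: "0 \<in> h" "0 \<in> k" using subspace_0 sh(1,2) by blast+
  have "x \<notin> derived_algebra g br"
  proof
    assume "x \<in> derived_algebra g br"
    then obtain u v where "x = u + v" "u \<in> H" "v \<in> K" using calculation unfolding S_def by blast
    then have "x = u" using unique [of x 0 u v] x(1) zero sub by auto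
    then show False using x(2) \<open>u \<in> H\<close> by blast
  qed
  then have "y \<in> span (insert x (derived_algebra g br))"
    using H2_zero_codim [OF H2] x(1) y(1) sh by blast
  then obtain c where "y - c *\<^sub>R x \<in> derived_algebra g br"
    unfolding span_breakdown_eq using span_eq_iff subspace_derived by blast
  then obtain u v where uv: "y - c *\<^sub>R x = u + v" "u \<in> H" "v \<in> K" using calculation unfolding S_def by blast
  then have "0 + y = (u + c *\<^sub>R x) + v" by (simp add: algebra_simps)
  moreover have "u + c *\<^sub>R x \<in> h" using uv x(1) sub subspace_add [OF sh(1)] subspace_scale [OF sh(1)] by blast
  ultimately have "y = v" using unique [of 0 y "u + c *\<^sub>R x" v] zero y(1) uv(3) sub by blast
  then show False using y(2) uv(3) by blast
qed

end

section \<open>Comparison with cochains on lists\<close>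

lemma fun_scaleR_apply [simp]: "(c *\<^sub>R f) x = c *\<^sub>R f x"
  by (simp add: scaleR_fun_def)

text \<open>Evaluation at the points of \<open>P\<close> is injective on \<open>C\<close>. Removing
  one point replaces \<open>C\<close> by the kernel of the evaluation there, which has codimension
  at most one.\<close>

lemma function_space_fin_dim:
  fixes C :: "('l \<Rightarrow> real) set"
  assumes "finite P" "subspace C" "\<And>f. f \<in> C \<Longrightarrow> (\<And>p. p \<in> P \<Longrightarrow> f p = 0) \<Longrightarrow> f = 0"
  shows "\<exists>A. finite A \<and> C \<subseteq> span A"
  using assms
proof (induction P arbitrary: C rule: finite_induct)
  case empty
  have "f \<in> span {}" if "f \<in> C" for f
    using empty(2) [OF that] by (simp only: span_empty empty_iff simp_thms singleton_iff)
  then have "C \<subseteq> span {}" by blast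
  then show ?case by blast
next
  case (insert p P)
  define C' where "C' = {f \<in> C. f p = 0}"
  have "subspace C'"
    unfolding C'_def subspace_def
    using subspace_0 [OF insert.prems(1)] subspace_add [OF insert.prems(1)] subspace_scale [OF insert.prems(1)]
    by simp
  moreover have "f = 0" if "f \<in> C'" "\<And>q. q \<in> P \<Longrightarrow> f q = 0" for f
    using insert.prems(2) [of f] that unfolding C'_def by blast
  ultimately obtain A where A: "finite A" "C' \<subseteq> span A" using insert.IH by blast
  show ?case
  proof (cases "C = C'")
    case False
    then obtain h where h: "h \<in> C" "h p \<noteq> 0" unfolding C'_def by blast
    have "f \<in> span (Set.insert h A)" if "f \<in> C" for f
    proof -
      have "f - (f p / h p) *\<^sub>R h \<in> C'"
        unfolding C'_def using that h subspace_diff [OF insert.prems(1)] subspace_scale [OF insert.prems(1)]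
        by simp
      then show ?thesis unfolding span_breakdown_eq using A(2) by blast
    qed
    then show ?thesis using A(1) by (intro exI [of _ "Set.insert h A"]) auto
  qed (use A in blast)
qed

lemma cochainsD:
  assumes "f \<in> cochains g n"
  shows "\<not> (length xs = n \<and> set xs \<subseteq> g) \<Longrightarrow> f xs = 0"
    and "length xs = n \<Longrightarrow> set xs \<subseteq> g \<Longrightarrow> i < n \<Longrightarrow> x \<in> g \<Longrightarrow> y \<in> g \<Longrightarrow>
        f (xs[i := x + y]) = f (xs[i := x]) + f (xs[i := y])"
    and "length xs = n \<Longrightarrow> set xs \<subseteq> g \<Longrightarrow> i < n \<Longrightarrow> x \<in> g \<Longrightarrow> f (xs[i := c *\<^sub>R x]) = c * f (xs[i := x])"
    and "length xs = n \<Longrightarrow> set xs \<subseteq> g \<Longrightarrow> \<not> distinct xs \<Longrightarrow> f xs = 0"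
  using assms unfolding cochains_def by blast+

lemma subspace_cochains: "subspace (cochains g n)"
proof (rule subspaceI)
  show "0 \<in> cochains g n" unfolding cochains_def by simp
next
  fix f h assume "f \<in> cochains g n" "h \<in> cochains g n"
  note f = cochainsD [OF this(1)] and h = cochainsD [OF this(2)]
  show "f + h \<in> cochains g n"
    unfolding cochains_def by (auto simp: f h distrib_left)
next
  fix c f assume "f \<in> cochains g n"
  note f = cochainsD [OF this]
  show "c *\<^sub>R f \<in> cochains g n"
    unfolding cochains_def by (auto simp: f distrib_left)
qed

text \<open>Multilinearity lets the entries be replaced one position at a time by elements of the
  spanning set.\<close>

lemma cochains_zeroI:
  assumes f: "f \<in> cochains g n" and A: "span A = g"
    and z: "\<And>xs. length xs = n \<Longrightarrow> set xs \<subseteq> A \<Longrightarrow> f xs = 0"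
  shows "f = 0"
proof
  note D = cochainsD [OF f]
  \<comment> \<open>The first \<open>k\<close> entries are arbitrary elements of \<open>g\<close>,
    all later ones lie in \<open>A\<close>; the case \<open>k = n\<close> is the claim.\<close>
  have *: "f xs = 0" if "length xs = n" "set xs \<subseteq> g" "\<And>i. k \<le> i \<Longrightarrow> i < n \<Longrightarrow> xs ! i \<in> A" "k \<le> n" for xs k
    using that
  proof (induction k arbitrary: xs)
    case 0
    then have "set xs \<subseteq> A" by (auto simp: in_set_conv_nth)
    then show ?case using 0 z by blast
  next
    case (Suc k)
    have k: "k < n" using Suc by simp
    have upd: "length (xs[k := x]) = n" "set (xs[k := x]) \<subseteq> g" if "x \<in> g" for x
      using Suc.prems that by (simp_all add: set_update_subsetI)
    have "subspace {x \<in> g. f (xs[k := x]) = 0}"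
      unfolding subspace_def
      using subspace_span [of A] k Suc.prems D(3) [of xs k 0 0] unfolding A
      by (auto simp: D(2,3) subspace_add subspace_scale subspace_0)
    moreover have "A \<subseteq> {x \<in> g. f (xs[k := x]) = 0}"
    proof
      fix x assume x: "x \<in> A"
      then have xg: "x \<in> g" using A span_base by blast
      have "f (xs[k := x]) = 0"
      proof (rule Suc.IH [OF upd [OF xg]])
        show "xs[k := x] ! i \<in> A" if "k \<le> i" "i < n" for i
          using that x Suc.prems by (cases "i = k") auto
      qed (use k in simp)
      then show "x \<in> {x \<in> g. f (xs[k := x]) = 0}" using xg by blast
    qed
    ultimately have "g \<subseteq> {x \<in> g. f (xs[k := x]) = 0}" unfolding A [symmetric] by (intro span_minimal)
    moreover have "xs ! k \<in> g" using Suc.prems k by (meson nth_mem subsetD)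
    ultimately have "f (xs[k := xs ! k]) = 0" by blast
    then show ?case by simp
  qed
  fix xs
  show "f xs = 0 xs" using D(1) * [of xs n] by (cases "length xs = n \<and> set xs \<subseteq> g") auto
qed

lemma cochains_fin_dim:
  assumes "finite_dimensional g"
  shows "\<exists>A. finite A \<and> cochains g n \<subseteq> span A"
proof -
  obtain A where A: "finite A" "span A = g" using assms unfolding finite_dimensional_def by blast
  have "finite {xs. set xs \<subseteq> A \<and> length xs = n}" by (rule finite_lists_length_eq [OF A(1)])
  then show ?thesis
    by (rule function_space_fin_dim [OF _ subspace_cochains]) (rule cochains_zeroI [OF _ A(2)], auto)
qed

lemma linear_ce_d: "linear (ce_d g br)"
  by (rule linearI) (auto simp: ce_d_def fun_eq_iff distrib_left sum.distrib sum_distrib_left mult.left_commute)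

lemma subspace_cocycles: "subspace (cocycles g br n)"
  unfolding cocycles_def subspace_def
  using subspace_0 [OF subspace_cochains [of g n]] subspace_add [OF subspace_cochains [of g n]]
    subspace_scale [OF subspace_cochains [of g n]]
  by (simp add: linear_0 [OF linear_ce_d] linear_add [OF linear_ce_d] linear_scale [OF linear_ce_d])

text \<open>Finite dimension of the cochains and the inclusion of coboundaries in cocycles turn the
  Betti number into a difference of dimensions, so its vanishing means equality.\<close>

lemma betti_zero_imp_exact:
  assumes "finite_dimensional g" "betti g br (Suc n) = 0" "ce_d g br ` cochains g n \<subseteq> cocycles g br (Suc n)"
  shows "cocycles g br (Suc n) = ce_d g br ` cochains g n"
proof -
  define V where "V = cocycles g br (Suc n)"
  define W where "W = ce_d g br ` cochains g n"
  obtain A where A: "finite A" "cochains g (Suc n) \<subseteq> span A" using cochains_fin_dim [OF assms(1)] by blast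
  have VA: "V \<subseteq> span A" using A(2) unfolding V_def cocycles_def by blast
  have sV: "subspace V" unfolding V_def by (rule subspace_cocycles)
  have sW: "subspace W" unfolding W_def by (rule linear_subspace_image [OF linear_ce_d subspace_cochains])
  have WV: "W \<subseteq> V" using assms(3) unfolding V_def W_def .
  have "dim W = dim V"
    using quotient_dim_eq [OF sW sV WV A(1) VA] assms(2) unfolding betti_def V_def W_def by simp
  moreover have "rv.fin_dim V" unfolding rv.fin_dim_def using A(1) VA by blast
  ultimately have "W = V" using rv.fin_dim_subspace_eq [OF _ WV sW sV] by simp
  then show ?thesis unfolding V_def W_def by simp
qed

text \<open>Only brackets of elements of \<open>g\<close> enter the differential, so cohomology is
  unchanged when the bracket is made total.\<close>

lemma ce_d_cong:
  assumes "\<And>x y. x \<in> g \<Longrightarrow> y \<in> g \<Longrightarrow> br x y = br' x y"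
  shows "ce_d g br = ce_d g br'"
proof (intro ext)
  fix f xs
  have "br (xs ! i) (xs ! j) = br' (xs ! i) (xs ! j)" if "set xs \<subseteq> g" "j < length xs" "i < j" for i j
    using that by (intro assms) (meson nth_mem subsetD less_trans)+
  then show "ce_d g br f xs = ce_d g br' f xs"
    unfolding ce_d_def by (auto intro!: sum.cong)
qed

lemma betti_cong:
  assumes "\<And>x y. x \<in> g \<Longrightarrow> y \<in> g \<Longrightarrow> br x y = br' x y"
  shows "betti g br n = betti g br' n"
proof -
  have "ce_d g br = ce_d g br'" using assms by (rule ce_d_cong)
  then show ?thesis unfolding betti_def cocycles_def by (cases n) simp_all
qed

lemma ce_d_support:
  assumes f: "f \<in> cochains g n" and xs: "length xs \<noteq> Suc n \<or> \<not> set xs \<subseteq> g"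
  shows "ce_d g br f xs = 0"
proof (cases "set xs \<subseteq> g")
  case True
  have "f (br (xs ! i) (xs ! j) # nths xs (- {i, j})) = 0" if ij: "i < j" "j < length xs" for i j
  proof -
    \<comment> \<open>Two entries leave the list and one bracket enters, so the length drops by
      one.\<close>
    have "{k. k < length xs \<and> k \<in> - {i, j}} = {..<length xs} - {i, j}" by auto
    then have "length (nths xs (- {i, j})) = length xs - 2"
      unfolding length_nths using ij by (simp add: card_Diff_subset)
    then have "length (br (xs ! i) (xs ! j) # nths xs (- {i, j})) \<noteq> n" using ij xs True by simp
    then show ?thesis using cochainsD(1) [OF f] by blast
  qed
  then show ?thesis unfolding ce_d_def by simp
qed (simp add: ce_d_def)

section \<open>The list differential in low degrees\<close>

lemma ce_d_2: "set [x, y] \<subseteq> g \<Longrightarrow> ce_d g br f [x, y] = - f [br x y]"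
  by (simp add: ce_d_def lessThan_Suc nths_Cons eval_nat_numeral)

lemma ce_d_3: "set [x, y, z] \<subseteq> g \<Longrightarrow> ce_d g br f [x, y, z] = d2 br (\<lambda>x y. f [x, y]) x y z"
  by (simp add: ce_d_def d2_def lessThan_Suc nths_Cons eval_nat_numeral)

lemma ce_d_4: "set [x, y, z, w] \<subseteq> g \<Longrightarrow> ce_d g br f [x, y, z, w] = d3 br (\<lambda>x y z. f [x, y, z]) x y z w"
  by (simp add: ce_d_def d3_def lessThan_Suc nths_Cons eval_nat_numeral)


lemma ce_d_zeroI:
  assumes f: "f \<in> cochains g 3"
    and z: "\<And>x y z w. x \<in> g \<Longrightarrow> y \<in> g \<Longrightarrow> z \<in> g \<Longrightarrow> w \<in> g \<Longrightarrow>
      d3 br (\<lambda>x y z. f [x, y, z]) x y z w = 0"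
  shows "ce_d g br f = 0"
proof
  fix xs show "ce_d g br f xs = 0 xs"
  proof (cases "length xs = 4 \<and> set xs \<subseteq> g")
    case True
    then obtain x y z w where xs: "xs = [x, y, z, w]" by (auto simp: length_Suc_conv eval_nat_numeral)
    then show ?thesis using True ce_d_4 [of x y z w g br f] z [of x y z w] by simp
  next
    case False
    then have "length xs \<noteq> Suc 3 \<or> \<not> set xs \<subseteq> g" by auto
    then show ?thesis using ce_d_support [OF f] by simp
  qed
qed

text \<open>The list form of a curried form, extended by zero to meet the normalisation in
  \<open>cochains\<close>.\<close>

definition cochain2 :: "'a::real_vector set \<Rightarrow> ('a \<Rightarrow> 'a \<Rightarrow> real) \<Rightarrow> 'a list \<Rightarrow> real"
  where "cochain2 g \<alpha> = (\<lambda>xs. if length xs = 2 \<and> set xs \<subseteq> g then \<alpha> (xs ! 0) (xs ! 1) else 0)"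

definition cochain3 :: "'a::real_vector set \<Rightarrow> ('a \<Rightarrow> 'a \<Rightarrow> 'a \<Rightarrow> real) \<Rightarrow> 'a list \<Rightarrow> real"
  where "cochain3 g \<phi> = (\<lambda>xs. if length xs = 3 \<and> set xs \<subseteq> g then \<phi> (xs ! 0) (xs ! 1) (xs ! 2) else 0)"

lemma length_2E:
  assumes "length xs = 2" obtains x y where "xs = [x, y]"
  using assms by (auto simp: length_Suc_conv eval_nat_numeral)

lemma length_3E:
  assumes "length xs = 3" obtains x y z where "xs = [x, y, z]"
  using assms by (auto simp: length_Suc_conv eval_nat_numeral)

lemma cochain2_in_cochains:
  assumes g: "subspace g" and a: "alt2 g \<alpha>"
  shows "cochain2 g \<alpha> \<in> cochains g 2"
proof -
  note add = alt2_add [OF a] and scale = alt2_scale [OF a] and swap = alt2_swap [OF a]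
  have add2: "\<alpha> z (x + y) = \<alpha> z x + \<alpha> z y" if "x \<in> g" "y \<in> g" "z \<in> g" for x y z
    using add [OF that(1,3,2)] swap [of "x + y" z] swap [of x z] swap [of y z] that subspace_add [OF g] by simp
  have scale2: "\<alpha> y (c *\<^sub>R x) = c * \<alpha> y x" if "x \<in> g" "y \<in> g" for x y c
    using scale [OF that, of c] swap [of "c *\<^sub>R x" y] swap [of x y] that subspace_scale [OF g] by simp
  have zero: "\<alpha> x x = 0" if "x \<in> g" for x using swap [OF that that] by simp
  have sa: "x + y \<in> g" "c *\<^sub>R x \<in> g" if "x \<in> g" "y \<in> g" for x y c
    using that subspace_add [OF g] subspace_scale [OF g] by blast+
  show ?thesis
    unfolding cochains_def
  proof (intro CollectI conjI allI impI)
    fix xs and i :: nat and x y assume "length xs = 2 \<and> set xs \<subseteq> g \<and> i < 2 \<and> x \<in> g \<and> y \<in> g"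
    then obtain a b where "xs = [a, b]" "a \<in> g" "b \<in> g" "i = 0 \<or> i = 1" "x \<in> g" "y \<in> g"
      by (auto elim!: length_2E simp: less_2_cases_iff)
    then show "cochain2 g \<alpha> (xs[i := x + y]) = cochain2 g \<alpha> (xs[i := x]) + cochain2 g \<alpha> (xs[i := y])"
      using sa add add2 by (auto simp: cochain2_def)
  next
    fix xs and i :: nat and c x assume "length xs = 2 \<and> set xs \<subseteq> g \<and> i < 2 \<and> x \<in> g"
    then obtain a b where "xs = [a, b]" "a \<in> g" "b \<in> g" "i = 0 \<or> i = 1" "x \<in> g"
      by (auto elim!: length_2E simp: less_2_cases_iff)
    then show "cochain2 g \<alpha> (xs[i := c *\<^sub>R x]) = c * cochain2 g \<alpha> (xs[i := x])"
      using sa scale scale2 by (auto simp: cochain2_def)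
  next
    fix xs assume "length xs = 2 \<and> set xs \<subseteq> g \<and> \<not> distinct xs"
    then obtain a where "xs = [a, a]" "a \<in> g" by (auto elim!: length_2E)
    then show "cochain2 g \<alpha> xs = 0" using zero by (simp add: cochain2_def)
  qed (auto simp: cochain2_def)
qed

lemma cochain3_in_cochains:
  assumes g: "subspace g" and a: "alt3 g \<phi>"
  shows "cochain3 g \<phi> \<in> cochains g 3"
proof -
  note add = alt3_add [OF a] and scale = alt3_scale [OF a]
    and s12 = alt3_swap12 [OF a] and s23 = alt3_swap23 [OF a]
  have sa: "x + y \<in> g" "c *\<^sub>R x \<in> g" if "x \<in> g" "y \<in> g" for x y c
    using that subspace_add [OF g] subspace_scale [OF g] by blast+
  have add2: "\<phi> z (x + y) w = \<phi> z x w + \<phi> z y w" if "x \<in> g" "y \<in> g" "z \<in> g" "w \<in> g" for x y z w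
    using add [OF that(1,3,4,2)] s12 [of "x + y" z w] s12 [of x z w] s12 [of y z w] that sa by simp
  have scale2: "\<phi> y (c *\<^sub>R x) w = c * \<phi> y x w" if "x \<in> g" "y \<in> g" "w \<in> g" for x y w c
    using scale [OF that, of c] s12 [of "c *\<^sub>R x" y w] s12 [of x y w] that sa by simp
  have add3: "\<phi> z w (x + y) = \<phi> z w x + \<phi> z w y" if "x \<in> g" "y \<in> g" "z \<in> g" "w \<in> g" for x y z w
    using add2 [OF that] s23 [of z "x + y" w] s23 [of z x w] s23 [of z y w] that sa by simp
  have scale3: "\<phi> y w (c *\<^sub>R x) = c * \<phi> y w x" if "x \<in> g" "y \<in> g" "w \<in> g" for x y w c
    using scale2 [OF that, of c] s23 [of y "c *\<^sub>R x" w] s23 [of y x w] that sa by simp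
  have zero: "\<phi> x x y = 0" "\<phi> y x x = 0" "\<phi> x y x = 0" if "x \<in> g" "y \<in> g" for x y
    using s12 [of x x y] s23 [of y x x] s23 [of x x y] that by simp_all
  show ?thesis
    unfolding cochains_def
  proof (intro CollectI conjI allI impI)
    fix xs and i :: nat and x y assume "length xs = 3 \<and> set xs \<subseteq> g \<and> i < 3 \<and> x \<in> g \<and> y \<in> g"
    moreover from this have "i = 0 \<or> i = 1 \<or> i = 2" by linarith
    ultimately obtain a b c where "xs = [a, b, c]" "a \<in> g" "b \<in> g" "c \<in> g" "i = 0 \<or> i = 1 \<or> i = 2" "x \<in> g" "y \<in> g"
      by (auto elim!: length_3E)
    then show "cochain3 g \<phi> (xs[i := x + y]) = cochain3 g \<phi> (xs[i := x]) + cochain3 g \<phi> (xs[i := y])"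
      using sa add add2 add3 by (auto simp: cochain3_def eval_nat_numeral)
  next
    fix xs and i :: nat and r x assume "length xs = 3 \<and> set xs \<subseteq> g \<and> i < 3 \<and> x \<in> g"
    moreover from this have "i = 0 \<or> i = 1 \<or> i = 2" by linarith
    ultimately obtain a b c where "xs = [a, b, c]" "a \<in> g" "b \<in> g" "c \<in> g" "i = 0 \<or> i = 1 \<or> i = 2" "x \<in> g"
      by (auto elim!: length_3E)
    then show "cochain3 g \<phi> (xs[i := r *\<^sub>R x]) = r * cochain3 g \<phi> (xs[i := x])"
      using sa scale scale2 scale3 by (auto simp: cochain3_def eval_nat_numeral)
  next
    fix xs assume "length xs = 3 \<and> set xs \<subseteq> g \<and> \<not> distinct xs"
    then obtain x y z where "xs = [x, y, z]" "x \<in> g" "y \<in> g" "z \<in> g" "x = y \<or> x = z \<or> y = z"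
      by (auto elim!: length_3E)
    then show "cochain3 g \<phi> xs = 0" using zero by (auto simp: cochain3_def)
  qed (auto simp: cochain3_def)
qed

text \<open>Polarising the vanishing on equal entries gives skew-symmetry.\<close>

lemma cochains_alt2:
  assumes g: "subspace g" and f: "f \<in> cochains g 2"
  shows "alt2 g (\<lambda>x y. f [x, y])"
proof -
  note D = cochainsD [OF f]
  have add: "f [x + y, z] = f [x, z] + f [y, z]" "f [z, x + y] = f [z, x] + f [z, y]"
    if "x \<in> g" "y \<in> g" "z \<in> g" for x y z
    using D(2) [of "[x, z]" 0 x y] D(2) [of "[z, x]" 1 x y] that by simp_all
  have scale: "f [c *\<^sub>R x, y] = c * f [x, y]" if "x \<in> g" "y \<in> g" for x y c
    using D(3) [of "[x, y]" 0 x c] that by simp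
  have zero: "f [x, x] = 0" if "x \<in> g" for x using D(4) [of "[x, x]"] that by simp
  have "f [y, x] = - f [x, y]" if "x \<in> g" "y \<in> g" for x y
    using add(1) [of x y "x + y"] add(2) [of x y x] add(2) [of x y y] zero that subspace_add [OF g] by simp
  then show ?thesis unfolding alt2_def using add(1) scale by blast
qed

lemma alt3_cong:
  assumes g: "subspace g" and a: "alt3 g \<phi>"
    and eq: "\<And>x y z. x \<in> g \<Longrightarrow> y \<in> g \<Longrightarrow> z \<in> g \<Longrightarrow> \<phi> x y z = \<psi> x y z"
  shows "alt3 g \<psi>"
  unfolding alt3_def
proof (intro conjI ballI allI)
  fix x y z w c assume m: "x \<in> g" "y \<in> g" "z \<in> g"
  show "\<psi> y x z = - \<psi> x y z" using eq [OF m] eq [OF m(2,1,3)] alt3_swap12 [OF a m] by simp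
  show "\<psi> x z y = - \<psi> x y z" using eq [OF m] eq [OF m(1,3,2)] alt3_swap23 [OF a m] by simp
  show "\<psi> (c *\<^sub>R x) y z = c * \<psi> x y z"
    using eq [OF m] eq [OF subspace_scale [OF g m(1)] m(2,3)] alt3_scale [OF a m] by simp
  show "\<psi> (x + y) z w = \<psi> x z w + \<psi> y z w" if w: "w \<in> g"
    using eq [OF subspace_add [OF g m(1,2)] m(3) w] eq [OF m(1,3) w] eq [OF m(2,3) w]
      alt3_add [OF a m(1,3) w m(2)] by simp
qed

context real_lie
begin

lemma alt3_d2:
  assumes a: "alt2 g \<alpha>" shows "alt3 g (d2 br \<alpha>)"
proof -
  obtain \<beta> where b: "alt2 UNIV \<beta>" "\<And>x y. x \<in> g \<Longrightarrow> y \<in> g \<Longrightarrow> \<beta> x y = \<alpha> x y"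
    by (rule alt2_extend [OF subspace_g a]) blast
  have swap: "\<beta> y x = - \<beta> x y" for x y using alt2_swap [OF b(1)] by blast
  have "alt3 UNIV (d2 br \<beta>)"
    unfolding alt3_def
  proof (intro conjI ballI allI)
    fix x y z
    show "d2 br \<beta> y x z = - d2 br \<beta> x y z" "d2 br \<beta> x z y = - d2 br \<beta> x y z"
      unfolding d2_def L.br_swap [of y x] L.br_swap [of z y] by (simp_all add: alt2_UNIV [OF b(1)])
  qed (simp_all add: d2_def br_bilinear alt2_UNIV [OF b(1)] algebra_simps)
  then have "alt3 g (d2 br \<beta>)" by (rule alt3_UNIV_imp)
  then show ?thesis
  proof (rule alt3_cong [OF subspace_g])
    show "d2 br \<beta> x y z = d2 br \<alpha> x y z" if "x \<in> g" "y \<in> g" "z \<in> g" for x y z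
      unfolding d2_def using b(2) br_in_g that by simp
  qed
qed

text \<open>Terms with nested brackets cancel in threes by the Jacobi identity, terms
  \<open>\<beta> [p, q] [r, s]\<close> in pairs by skew-symmetry.\<close>

lemma d3_d2:
  assumes a: "alt2 g \<alpha>" and m: "x \<in> g" "y \<in> g" "z \<in> g" "w \<in> g"
  shows "d3 br (d2 br \<alpha>) x y z w = 0"
proof -
  obtain \<beta> where b: "alt2 UNIV \<beta>" "\<And>x y. x \<in> g \<Longrightarrow> y \<in> g \<Longrightarrow> \<beta> x y = \<alpha> x y"
    by (rule alt2_extend [OF subspace_g a]) blast
  have swap: "\<beta> (br p q) (br r s) = - \<beta> (br r s) (br p q)" for p q r s using alt2_swap [OF b(1)] by blast
  have jac: "br (br p q) r - br (br p r) q + br (br q r) p = 0" for p q r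
    unfolding L.br_swap [of "br q r" p] L.br_derivation [of p q r] L.br_swap [of q "br p r"] by simp
  have j: "\<beta> (br (br p q) r) s - \<beta> (br (br p r) q) s + \<beta> (br (br q r) p) s = 0" for p q r s
  proof -
    have "\<beta> (br (br p q) r - br (br p r) q + br (br q r) p) s = 0"
      unfolding jac using alt2_UNIV(2) [OF b(1), of 0 0 s] by simp
    then show ?thesis by (simp add: alt2_UNIV(1,7) [OF b(1)])
  qed
  have "d3 br (d2 br \<beta>) x y z w = 0"
    unfolding d3_def d2_def
    using j [of x y z w] j [of x y w z] j [of x z w y] j [of y z w x]
      swap [of x y z w] swap [of x z y w] swap [of x w y z] by linarith
  moreover have "d2 br \<beta> x y z = d2 br \<alpha> x y z" if "x \<in> g" "y \<in> g" "z \<in> g" for x y z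
    unfolding d2_def using b(2) br_in_g that by simp
  ultimately show ?thesis using m br_in_g unfolding d3_def by simp
qed

text \<open>The inclusion of coboundaries in cocycles is established beforehand, since the dimension
  count rests on it; then curried forms are translated to lists and their primitives back.\<close>

lemma betti_3_zero_imp_H3_zero:
  assumes b3: "betti g br 3 = 0"
  shows "H3_zero g br"
proof -
  have "ce_d g br f \<in> cocycles g br 3" if f: "f \<in> cochains g 2" for f
  proof -
    define \<alpha> where "\<alpha> = (\<lambda>x y. f [x, y])"
    have a: "alt2 g \<alpha>" unfolding \<alpha>_def by (rule cochains_alt2 [OF subspace_g f])
    have "ce_d g br f = cochain3 g (d2 br \<alpha>)"
    proof
      fix xs show "ce_d g br f xs = cochain3 g (d2 br \<alpha>) xs"
      proof (cases "length xs = 3 \<and> set xs \<subseteq> g")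
        case True
        then obtain x y z where xs: "xs = [x, y, z]" by (auto elim!: length_3E)
        then show ?thesis using True ce_d_3 [of x y z g br f] by (simp add: cochain3_def \<alpha>_def)
      next
        case False
        then have "length xs \<noteq> Suc 2 \<or> \<not> set xs \<subseteq> g" by auto
        then have "ce_d g br f xs = 0" by (rule ce_d_support [OF f])
        then show ?thesis using False by (auto simp: cochain3_def)
      qed
    qed
    then have c3: "ce_d g br f \<in> cochains g 3" using cochain3_in_cochains [OF subspace_g alt3_d2 [OF a]] by simp
    moreover have "ce_d g br (ce_d g br f) = 0"
    proof (rule ce_d_zeroI [OF c3])
      fix x y z w assume m: "x \<in> g" "y \<in> g" "z \<in> g" "w \<in> g"
      have "d3 br (\<lambda>x y z. ce_d g br f [x, y, z]) x y z w = d3 br (d2 br \<alpha>) x y z w"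
        unfolding d3_def using m br_in_g by (simp add: ce_d_3 \<alpha>_def)
      also have "\<dots> = 0" by (rule d3_d2 [OF a m])
      finally show "d3 br (\<lambda>x y z. ce_d g br f [x, y, z]) x y z w = 0" .
    qed
    ultimately show ?thesis unfolding cocycles_def by blast
  qed
  then have sub: "ce_d g br ` cochains g 2 \<subseteq> cocycles g br (Suc 2)" by (auto simp: eval_nat_numeral)
  have eq: "cocycles g br (Suc 2) = ce_d g br ` cochains g 2"
    by (rule betti_zero_imp_exact [OF finite_dim_g _ sub]) (use b3 in \<open>simp add: eval_nat_numeral\<close>)
  show ?thesis
    unfolding H3_zero_def
  proof (intro allI impI)
    fix \<phi> assume p: "alt3 g \<phi> \<and> closed3 g br \<phi>"
    define f where "f = cochain3 g \<phi>"
    have f: "f \<in> cochains g 3" unfolding f_def using p by (intro cochain3_in_cochains [OF subspace_g]) blast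
    have f\<phi>: "f [x, y, z] = \<phi> x y z" if "x \<in> g" "y \<in> g" "z \<in> g" for x y z
      using that by (simp add: f_def cochain3_def)
    have "ce_d g br f = 0"
    proof (rule ce_d_zeroI [OF f])
      fix x y z w assume m: "x \<in> g" "y \<in> g" "z \<in> g" "w \<in> g"
      have "d3 br (\<lambda>x y z. f [x, y, z]) x y z w = d3 br \<phi> x y z w"
        unfolding d3_def using m br_in_g by (simp add: f\<phi>)
      also have "\<dots> = 0" using p m unfolding closed3_def by blast
      finally show "d3 br (\<lambda>x y z. f [x, y, z]) x y z w = 0" .
    qed
    then have "f \<in> cocycles g br (Suc 2)" using f unfolding cocycles_def by (simp add: eval_nat_numeral)
    then obtain h where h: "h \<in> cochains g 2" "f = ce_d g br h" unfolding eq by blast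
    have "\<phi> x y z = d2 br (\<lambda>x y. h [x, y]) x y z" if "x \<in> g" "y \<in> g" "z \<in> g" for x y z
      using f\<phi> [OF that] ce_d_3 [of x y z g br h] that unfolding h(2) by simp
    then show "exact3 g br \<phi>" unfolding exact3_def using cochains_alt2 [OF subspace_g h(1)] by blast
  qed
qed

lemma betti_2_zero_imp_H2_zero:
  assumes b2: "betti g br 2 = 0"
  shows "H2_zero g br"
proof -
  have ext: "ce_d g br f xs = 0 xs"
    if f: "f \<in> cochains g 2" and z: "\<And>x y z. x \<in> g \<Longrightarrow> y \<in> g \<Longrightarrow> z \<in> g \<Longrightarrow> d2 br (\<lambda>x y. f [x, y]) x y z = 0" for f xs
  proof (cases "length xs = 3 \<and> set xs \<subseteq> g")
    case True
    then obtain x y z where xs: "xs = [x, y, z]" by (auto elim!: length_3E)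
    then show ?thesis using True ce_d_3 [of x y z g br f] z [of x y z] by simp
  next
    case False
    then have "length xs \<noteq> Suc 2 \<or> \<not> set xs \<subseteq> g" by auto
    then show ?thesis using ce_d_support [OF f] by simp
  qed
  have lin1: "f [x + y] = f [x] + f [y]" "f [c *\<^sub>R x] = c * f [x]"
    if "f \<in> cochains g 1" "x \<in> g" "y \<in> g" for f x y c
    using cochainsD(2) [OF that(1), of "[x]" 0 x y] cochainsD(3) [OF that(1), of "[x]" 0 x c] that by simp_all
  have "ce_d g br f \<in> cocycles g br 2" if f: "f \<in> cochains g 1" for f
  proof -
    define \<alpha> where "\<alpha> = (\<lambda>x y. - f [br x y])"
    note lin = lin1 [OF f]
    have neg: "f [- x] = - f [x]" if "x \<in> g" for x using lin(2) [OF that that, of "- 1"] by simp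
    have a: "alt2 g \<alpha>"
      unfolding alt2_def
    proof (intro conjI ballI allI)
      fix x y show "\<alpha> y x = - \<alpha> x y" unfolding \<alpha>_def L.br_swap [of y x] using neg br_in_g by simp
    qed (simp_all add: \<alpha>_def br_bilinear lin br_in_g)
    have "ce_d g br f = cochain2 g \<alpha>"
    proof
      fix xs show "ce_d g br f xs = cochain2 g \<alpha> xs"
      proof (cases "length xs = 2 \<and> set xs \<subseteq> g")
        case True
        then obtain x y where xs: "xs = [x, y]" by (auto elim!: length_2E)
        then show ?thesis using True ce_d_2 [of x y g br f] by (simp add: cochain2_def \<alpha>_def)
      next
        case False
        then have "length xs \<noteq> Suc 1 \<or> \<not> set xs \<subseteq> g" by auto
        then have "ce_d g br f xs = 0" by (rule ce_d_support [OF f])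
        then show ?thesis using False by (auto simp: cochain2_def)
      qed
    qed
    then have c2: "ce_d g br f \<in> cochains g 2" using cochain2_in_cochains [OF subspace_g a] by simp
    have "d2 br (\<lambda>x y. ce_d g br f [x, y]) x y z = 0" if m: "x \<in> g" "y \<in> g" "z \<in> g" for x y z
    proof -
      have zero: "f [0] = 0" using lin(2) [OF m(1) m(1), of 0] by simp
      \<comment> \<open>The Jacobi identity, arranged as in \<open>d2\<close>, so that linearity of
        \<open>f\<close> turns it into closedness.\<close>
      have "br (br x y) z + (- br (br x z) y + br (br y z) x) = 0"
        unfolding L.br_swap [of "br y z" x] L.br_derivation [of x y z] L.br_swap [of y "br x z"] by simp
      then have "f [br (br x y) z] + (- f [br (br x z) y] + f [br (br y z) x]) = 0"
        using lin(1) neg zero br_in_g subspace_add [OF subspace_g] subspace_neg [OF subspace_g] by metis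
      then show ?thesis unfolding d2_def using m br_in_g by (simp add: ce_d_2)
    qed
    from ext [OF c2 this] have "ce_d g br (ce_d g br f) = 0" by blast
    then show ?thesis unfolding cocycles_def using c2 by blast
  qed
  then have sub: "ce_d g br ` cochains g 1 \<subseteq> cocycles g br (Suc 1)" by (auto simp: eval_nat_numeral)
  have eq: "cocycles g br (Suc 1) = ce_d g br ` cochains g 1"
    by (rule betti_zero_imp_exact [OF finite_dim_g _ sub]) (use b2 in \<open>simp add: eval_nat_numeral\<close>)
  show ?thesis
    unfolding H2_zero_def
  proof (intro allI impI)
    fix \<alpha> assume p: "alt2 g \<alpha> \<and> (\<forall>x\<in>g. \<forall>y\<in>g. \<forall>z\<in>g. d2 br \<alpha> x y z = 0)"
    define f where "f = cochain2 g \<alpha>"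
    have f: "f \<in> cochains g 2" unfolding f_def using p by (intro cochain2_in_cochains [OF subspace_g]) blast
    have fa: "f [x, y] = \<alpha> x y" if "x \<in> g" "y \<in> g" for x y
      using that by (simp add: f_def cochain2_def)
    have "d2 br (\<lambda>x y. f [x, y]) x y z = 0" if "x \<in> g" "y \<in> g" "z \<in> g" for x y z
      using p that br_in_g fa unfolding d2_def by simp
    from ext [OF f this] have "ce_d g br f = 0" by blast
    then have "f \<in> cocycles g br (Suc 1)" using f unfolding cocycles_def by (simp add: eval_nat_numeral)
    then obtain h where h: "h \<in> cochains g 1" "f = ce_d g br h" unfolding eq by blast
    show "\<exists>\<eta>. (\<forall>x\<in>g. \<forall>y\<in>g. \<eta> (x + y) = \<eta> x + \<eta> y) \<and> (\<forall>c. \<forall>x\<in>g. \<eta> (c *\<^sub>R x) = c * \<eta> x)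
      \<and> (\<forall>x\<in>g. \<forall>y\<in>g. \<alpha> x y = - \<eta> (br x y))"
    proof (rule exI [of _ "\<lambda>x. h [x]"], intro conjI ballI allI)
      fix x y assume xy: "x \<in> g" "y \<in> g"
      show "h [x + y] = h [x] + h [y]" by (rule lin1(1) [OF h(1) xy])
      show "\<alpha> x y = - h [br x y]" using fa [OF xy] ce_d_2 [of x y g br h] xy unfolding h(2) by simp
    next
      fix c x assume x: "x \<in> g"
      show "h [c *\<^sub>R x] = c * h [x]" by (rule lin1(2) [OF h(1) x x])
    qed
  qed
qed

end

section \<open>The theorem\<close>

text \<open>Both arguments are retracted onto \<open>g\<close> before taking the bracket. The Jacobi
  identity survives because the retraction fixes brackets of elements of \<open>g\<close>.\<close>

lemma total_bracket:
  assumes "lie_algebra g br" "finite_dimensional g"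
  obtains br' where "real_lie br' g" "\<And>x y. x \<in> g \<Longrightarrow> y \<in> g \<Longrightarrow> br x y = br' x y"
proof -
  interpret lie_algebra g br by fact
  obtain p where p: "range p \<subseteq> g" "linear p" "\<forall>v\<in>g. p v = v"
    using linear_exists_left_inverse_on [OF linear_id subspace_carrier inj_on_id] unfolding id_apply by blast
  have pg: "p x \<in> g" for x using p(1) by blast
  have pp: "p x = x" if "x \<in> g" for x using p(3) that by blast
  define br' where "br' = (\<lambda>x y. br (p x) (p y))"
  note lin = linear_add [OF p(2)] linear_scale [OF p(2)]
  have "real_lie br' g"
  proof unfold_locales
    fix x y z :: 'a and c :: real
    show "br' (x + y) z = br' x z + br' y z" "br' (c *\<^sub>R x) y = c *\<^sub>R br' x y"
      "br' x (y + z) = br' x y + br' x z" "br' x (c *\<^sub>R y) = c *\<^sub>R br' x y" "br' x x = 0"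
      unfolding br'_def lin
      by (simp_all add: pg bracket_add_left bracket_add_right bracket_scale_left bracket_scale_right bracket_self)
    show "br' x (br' y z) + br' y (br' z x) + br' z (br' x y) = 0"
      unfolding br'_def using jacobi [OF pg pg pg, of x y z] by (simp add: pp pg bracket_closed)
    show "br' x y \<in> g" unfolding br'_def by (intro bracket_closed pg)
  qed (rule subspace_carrier assms(2))+
  moreover have "br x y = br' x y" if "x \<in> g" "y \<in> g" for x y unfolding br'_def using that by (simp add: pp)
  ultimately show thesis by (rule that)
qed

lemma bracket_span_cong:
  "(\<And>x y. x \<in> h \<Longrightarrow> y \<in> k \<Longrightarrow> br x y = br' x y) \<Longrightarrow> bracket_span br h k = bracket_span br' h k"
  unfolding bracket_span_def by (rule arg_cong [of _ _ span]) (force)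

lemma (in real_lie) series_subset:
  "derived_series g br n \<subseteq> g" "lower_central_series g br n \<subseteq> g"
proof -
  show "derived_series g br n \<subseteq> g"
    by (induction n)
      (simp_all add: derived_algebra_def bracket_span_subset [OF subspace_g br_in_g])
  show "lower_central_series g br n \<subseteq> g" by (rule lower_central_series_subset [OF closed_under_g])
qed

theorem theorem4p1:
  fixes g :: "'a::real_vector set" and br :: "'a \<Rightarrow> 'a \<Rightarrow> 'a"
  assumes "lie_algebra g br"
    and "finite_dimensional g"
    and "g \<noteq> {0}"
    and "\<not> (lie_abelian g br \<and> dim g = 1)"
    and "\<not> (lie_abelian g br \<and> dim g = 2)"
    and "betti g br 3 = 0"
  shows "lie_solvable g br \<and> \<not> lie_nilpotent g br
    \<and> (betti g br 2 = 0 \<longrightarrow>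
        \<not> (\<exists>h k. h \<noteq> {0} \<and> k \<noteq> {0} \<and> lie_direct_sum g h k br)
        \<and> lie_ideal (derived_algebra g br) g br
        \<and> quotient_dim g (derived_algebra g br) = 1)"
proof -
  obtain br' where br': "real_lie br' g" and eq: "\<And>x y. x \<in> g \<Longrightarrow> y \<in> g \<Longrightarrow> br x y = br' x y"
    using total_bracket [OF assms(1,2)] by metis
  interpret real_lie br' g by (rule br')
  \<comment> \<open>The two brackets agree on \<open>g\<close> only, so transferring the derived and
    lower central series uses that all their terms lie in \<open>g\<close>.\<close>
  have derived: "derived_algebra S br = derived_algebra S br'" if "S \<subseteq> g" for S
    unfolding derived_algebra_def by (rule bracket_span_cong) (use eq that in blast)
  have ds: "derived_series g br n = derived_series g br' n" for n
    by (induction n) (simp_all add: derived series_subset)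
  have lcs: "lower_central_series g br n = lower_central_series g br' n" for n
  proof (induction n)
    case (Suc n)
    show ?case
      unfolding lower_central_series.simps Suc
      by (rule bracket_span_cong) (use eq series_subset(2) in blast)
  qed simp
  have abelian: "lie_abelian g br = lie_abelian g br'" unfolding lie_abelian_def using eq by simp
  have H3: "H3_zero g br'" using assms(6) betti_cong [of g br br', OF eq] by (intro betti_3_zero_imp_H3_zero) simp
  have sol': "lie_solvable g br'" by (rule H3_zero_imp_solvable [OF H3])
  have sol: "lie_solvable g br" using sol' unfolding lie_solvable_def ds .
  have "\<not> lie_nilpotent g br'" using H3_zero_imp_not_nilpotent [OF H3 assms(3)] assms(4,5) abelian by simp
  then have nil: "\<not> lie_nilpotent g br" unfolding lie_nilpotent_def lcs .
  have "\<not> (\<exists>h k. h \<noteq> {0} \<and> k \<noteq> {0} \<and> lie_direct_sum g h k br)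
        \<and> lie_ideal (derived_algebra g br) g br
        \<and> quotient_dim g (derived_algebra g br) = 1" if b2: "betti g br 2 = 0"
  proof (intro conjI)
    have H2: "H2_zero g br'" using b2 betti_cong [of g br br', OF eq] by (intro betti_2_zero_imp_H2_zero) simp
    show "quotient_dim g (derived_algebra g br) = 1"
      unfolding derived [OF order_refl] by (rule H2_zero_codim_one [OF H2 sol' assms(3)])
    show "lie_ideal (derived_algebra g br) g br"
      unfolding lie_ideal_def derived [OF order_refl]
      using subspace_derived derived_subset [OF closed_under_g] br_in_derived eq by (metis subsetD)
    show "\<not> (\<exists>h k. h \<noteq> {0} \<and> k \<noteq> {0} \<and> lie_direct_sum g h k br)"
    proof
      assume "\<exists>h k. h \<noteq> {0} \<and> k \<noteq> {0} \<and> lie_direct_sum g h k br"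
      then obtain h k where hk: "h \<noteq> {0}" "k \<noteq> {0}" "lie_direct_sum g h k br" by blast
      note ds = hk(3) [unfolded lie_direct_sum_def]
      have "lie_subalgebra h g br" "lie_subalgebra k g br"
        by (rule ds [THEN conjunct1] ds [THEN conjunct2, THEN conjunct1])+
      then have sub: "h \<subseteq> g" "k \<subseteq> g" unfolding lie_subalgebra_def by simp_all
      have "br x y = br' x y" if "x \<in> h \<or> x \<in> k" "y \<in> h \<or> y \<in> k" for x y
        using eq sub that by blast
      then have "lie_direct_sum g h k br = lie_direct_sum g h k br'"
        unfolding lie_direct_sum_def lie_subalgebra_def by simp
      then have "lie_direct_sum g h k br'" using hk(3) by simp
      then show False using H2_zero_indecomposable [OF H2 sol' hk(1,2)] by blast
    qed
  qed
  then show ?thesis using sol nil by blast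
qed

end
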